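(* The greedy elements $x[a_1,a_2]$ for $(a_1, a_2) \in \mathbb{Z}^2$ form a $\mathbb{K}[p_{1,1},\dots,p_{1,\ell_1},p_{2,1},\dots,p_{2,\ell_2}]$-basis for $\mathcal{A}(P_1,P_2)$.
   Context: Let $\mathbb{K}$ be a field of characteristic zero, $P_1=1+\sum_{j=1}^{\ell_1}p_{1,j}z^j$, $P_2=1+\sum_{j=1}^{\ell_2}p_{2,j}z^j$ with $p_{i,j}$ indeterminates, $\overline P_i(z)=\frac1{p_{i,\ell_i}}z^{\ell_i}P_i(z^{-1})$, and cluster pre-variables $x_k$ ($k\in\mathbb{Z}$) defined by $x_{k+1}x_{k-1}=P_1(x_k),P_2(x_k),\overline P_1(x_k),\overline P_2(x_k)$ according as $k\equiv1,2,3,0\pmod4$; each lies in $\underline{\mathbb{K}}=\mathbb{K}[p_{i,j},p_{1,\ell_1}^{-1},p_{2,\ell_2}^{-1}][x_1^{\pm1},x_2^{\pm1}]$. Let $X_k=p_{1,\ell_1}^{a_k}p_{2,\ell_2}^{b_k}x_k$ ($a_k,b_k\in\mathbb{Z}$) be normalized so that its unique lowest total degree term has coefficient $1$; $\mathcal A(P_1,P_2)$ is the $\mathbb{K}[p_{i,j}]$-subalgebra of $\underline{\mathbb{K}}$ generated by all $X_k$. For $(a_1,a_2)\in\mathbb{Z}^2$, $x[a_1,a_2]=x_1^{-a_1}x_2^{-a_2}\sum_\omega\mathrm{wt}(\omega)x_1^{\omega(E_2)}x_2^{\omega(E_1)}$, summed over all compatible gradings on $E([a_1]_+,[a_2]_+)$,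 with $[a]_+=\max(a,0)$. Here, on the maximal Dyck path $\mathcal P(m,n)$ (north/east unit-step path from $(0,0)$ to $(m,n)$ closest to the diagonal without crossing strictly above it) with horizontal edges $u_1,\dots,u_m$ forming $E_1$ and vertical edges $v_1,\dots,v_n$ forming $E_2$, a grading $\omega:E_1\cup E_2\to\mathbb{Z}_{\ge0}$ is compatible if for every $u\in E_1$, $v\in E_2$ there is an edge $e$ on the subpath $\overrightarrow{uv}$ (going east, cyclically, from the left endpoint of $u$ to the top endpoint of $v$) with ($e\ne v$ and the number of vertical edges of $\overrightarrow{ue}$ equals the sum of $\omega$ over its horizontal edges) or ($e\ne u$ and the number of horizontal edges of $\overrightarrow{ev}$ equals the sum of $\omega$ over its vertical edges); and $\mathrm{wt}(\omega)=\prod_ip_{2,\omega(u_i)}\prod_jp_{1,\omega(v_j)}$ with $p_{i,0}=1$. *)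

theory Defs
  imports
    "HOL-Library.Poly_Mapping"
    "HOL-Library.Nat_Bijection"
    "HOL-Library.FuncSet"
    "HOL-Computational_Algebra.Polynomial_Factorial"
begin

subsection \<open>The ambient field\<close>

text \<open>
  Laurent polynomials in x_1, x_2 whose coefficients are Laurent polynomials over \<open>'k\<close> in the
  p_{i,j}. Monomials are finitely supported exponent vectors. The outer variables are indexed by
  nat, x_i having index i; the inner ones are indexed by nat as well, p_{i,j} having index
  \<open>prod_encode (i, j)\<close>. The types thus contain further, unused variables; the subrings considered
  below only involve x_1, x_2 and the p_{i,j} with j at most l_i.
\<close>

type_synonym 'k pcoeff = "(nat \<Rightarrow>\<^sub>0 int) \<Rightarrow>\<^sub>0 'k"

type_synonym 'k laurent = "(nat \<Rightarrow>\<^sub>0 int) \<Rightarrow>\<^sub>0 'k pcoeff"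

definition emb_coeff :: "'k pcoeff \<Rightarrow> 'k::field_char_0 laurent fract" where
  "emb_coeff c = to_fract (Poly_Mapping.single 0 c)"

definition const :: "'k \<Rightarrow> 'k::field_char_0 laurent fract" where
  "const a = emb_coeff (Poly_Mapping.single 0 a)"

definition pvar :: "nat \<Rightarrow> nat \<Rightarrow> 'k::field_char_0 laurent fract" where
  "pvar i j = emb_coeff (Poly_Mapping.single (Poly_Mapping.single (prod_encode (i, j)) 1) 1)"

definition xvar :: "nat \<Rightarrow> 'k::field_char_0 laurent fract" where
  "xvar i = to_fract (Poly_Mapping.single (Poly_Mapping.single i 1) 1)"


subsection \<open>Subrings, generated algebras and bases\<close>

inductive_set subring_gen :: "'a::comm_ring_1 set \<Rightarrow> 'a set" for S where
  one: "1 \<in> subring_gen S"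
| gen: "a \<in> S \<Longrightarrow> a \<in> subring_gen S"
| diff: "a \<in> subring_gen S \<Longrightarrow> b \<in> subring_gen S \<Longrightarrow> a - b \<in> subring_gen S"
| mult: "a \<in> subring_gen S \<Longrightarrow> b \<in> subring_gen S \<Longrightarrow> a * b \<in> subring_gen S"

text \<open>For a subring \<open>R\<close>, this is the \<open>R\<close>-subalgebra generated by \<open>S\<close>.\<close>

definition subalgebra_gen :: "'a::comm_ring_1 set \<Rightarrow> 'a set \<Rightarrow> 'a set" where
  "subalgebra_gen R S = subring_gen (R \<union> S)"

text \<open>
  The family \<open>g\<close> is a basis of the \<open>R\<close>-module \<open>M\<close>: it spans \<open>M\<close> and is linearly independent
  over \<open>R\<close>. Independence of the family includes that its members are pairwise distinct.
\<close>

definition module_basis :: "'a::comm_ring_1 set \<Rightarrow> ('i \<Rightarrow> 'a) \<Rightarrow> 'a set \<Rightarrow> bool" where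
  "module_basis R g M \<longleftrightarrow>
     M = {\<Sum>i\<in>S. c i * g i | S c. finite S \<and> (\<forall>i\<in>S. c i \<in> R)} \<and>
     (\<forall>S c. finite S \<and> (\<forall>i\<in>S. c i \<in> R) \<and> (\<Sum>i\<in>S. c i * g i) = 0 \<longrightarrow> (\<forall>i\<in>S. c i = 0))"

definition coeff_ring :: "nat \<Rightarrow> nat \<Rightarrow> 'k::field_char_0 laurent fract set" where
  "coeff_ring l1 l2 =
     subring_gen (range const \<union> {pvar 1 j | j. 1 \<le> j \<and> j \<le> l1} \<union> {pvar 2 j | j. 1 \<le> j \<and> j \<le> l2})"


subsection \<open>Cluster variables\<close>

definition exch_poly :: "nat \<Rightarrow> nat \<Rightarrow> 'k::field_char_0 laurent fract poly" where
  "exch_poly i l = 1 + (\<Sum>j=1..l. monom (pvar i j) j)"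

definition exch_poly_bar :: "nat \<Rightarrow> nat \<Rightarrow> 'k::field_char_0 laurent fract poly" where
  "exch_poly_bar i l = smult (inverse (pvar i l)) (reflect_poly (exch_poly i l))"

definition exch_poly_at :: "nat \<Rightarrow> nat \<Rightarrow> int \<Rightarrow> 'k::field_char_0 laurent fract poly" where
  "exch_poly_at l1 l2 k =
     (if k mod 4 = 1 then exch_poly 1 l1
      else if k mod 4 = 2 then exch_poly 2 l2
      else if k mod 4 = 3 then exch_poly_bar 1 l1
      else exch_poly_bar 2 l2)"

text \<open>
  The exchange relation at k expresses x_{k+1} through x_k and x_{k-1}, and x_{k-1} through x_k
  and x_{k+1}; starting from x_1 and x_2 it is run upwards and downwards.
\<close>

function cluster_prevar :: "nat \<Rightarrow> nat \<Rightarrow> int \<Rightarrow> 'k::field_char_0 laurent fract" where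
  "cluster_prevar l1 l2 k =
     (if k = 1 then xvar 1
      else if k = 2 then xvar 2
      else if k > 2 then
        poly (exch_poly_at l1 l2 (k - 1)) (cluster_prevar l1 l2 (k - 1)) / cluster_prevar l1 l2 (k - 2)
      else
        poly (exch_poly_at l1 l2 (k + 1)) (cluster_prevar l1 l2 (k + 1)) / cluster_prevar l1 l2 (k + 2))"
  by pat_completeness auto
termination
  by (relation "measure (\<lambda>(l1, l2, k). nat \<bar>2 * k - 3\<bar>)") auto

declare cluster_prevar.simps [simp del]

definition total_degree :: "(nat \<Rightarrow>\<^sub>0 int) \<Rightarrow> int" where
  "total_degree m = (\<Sum>i\<in>Poly_Mapping.keys m. Poly_Mapping.lookup m i)"

text \<open>Here the degree is the one in x_1 and x_2 only, the p_{i,j} being part of the coefficients.\<close>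

definition unit_lowest_term :: "'k::field_char_0 laurent \<Rightarrow> bool" where
  "unit_lowest_term f \<longleftrightarrow>
     (\<exists>m\<in>Poly_Mapping.keys f. Poly_Mapping.lookup f m = 1 \<and>
        (\<forall>m'\<in>Poly_Mapping.keys f. m' \<noteq> m \<longrightarrow> total_degree m < total_degree m'))"

definition cluster_var :: "nat \<Rightarrow> nat \<Rightarrow> int \<Rightarrow> 'k::field_char_0 laurent fract" where
  "cluster_var l1 l2 k =
     (THE y. (\<exists>a b. y = pvar 1 l1 powi a * pvar 2 l2 powi b * cluster_prevar l1 l2 k) \<and>
             (\<exists>f. y = to_fract f \<and> unit_lowest_term f))"

definition cluster_algebra :: "nat \<Rightarrow> nat \<Rightarrow> 'k::field_char_0 laurent fract set" where
  "cluster_algebra l1 l2 = subalgebra_gen (coeff_ring l1 l2) (range (cluster_var l1 l2))"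


subsection \<open>Maximal Dyck paths and compatible gradings\<close>

datatype step = East | North

definition dyck_path :: "nat \<Rightarrow> nat \<Rightarrow> step list \<Rightarrow> bool" where
  "dyck_path m n w \<longleftrightarrow>
     count_list w East = m \<and> count_list w North = n \<and>
     (\<forall>k\<le>length w. m * count_list (take k w) North \<le> n * count_list (take k w) East)"

text \<open>
  After k steps all these paths are on the same antidiagonal, where being closer to the diagonal
  means having made more north steps. The maximal path is closest after every number of steps.
\<close>

definition max_dyck_path :: "nat \<Rightarrow> nat \<Rightarrow> step list" where
  "max_dyck_path m n =
     (THE w. dyck_path m n w \<and>
        (\<forall>w'. dyck_path m n w' \<longrightarrow>
           (\<forall>k. count_list (take k w') North \<le> count_list (take k w) North)))"

text \<open>Edges are represented by their positions 0, ..., m + n - 1 along the path.\<close>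

definition horiz_edges :: "nat \<Rightarrow> nat \<Rightarrow> nat set" where
  "horiz_edges m n = {i. i < m + n \<and> max_dyck_path m n ! i = East}"

definition vert_edges :: "nat \<Rightarrow> nat \<Rightarrow> nat set" where
  "vert_edges m n = {i. i < m + n \<and> max_dyck_path m n ! i = North}"

text \<open>The cyclic subpath from edge \<open>e\<close> to edge \<open>f\<close>, both included, on a closed path of \<open>N\<close> edges.\<close>

definition subpath :: "nat \<Rightarrow> nat \<Rightarrow> nat \<Rightarrow> nat set" where
  "subpath N e f = (if e \<le> f then {e..f} else {e..<N} \<union> {..f})"

definition compatible :: "nat \<Rightarrow> nat \<Rightarrow> (nat \<Rightarrow> nat) \<Rightarrow> bool" where
  "compatible m n \<omega> \<longleftrightarrow>
     (\<forall>u\<in>horiz_edges m n. \<forall>v\<in>vert_edges m n. \<exists>e\<in>subpath (m + n) u v.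
        (e \<noteq> v \<and> card (subpath (m + n) u e \<inter> vert_edges m n)
                  = (\<Sum>h\<in>subpath (m + n) u e \<inter> horiz_edges m n. \<omega> h)) \<or>
        (e \<noteq> u \<and> card (subpath (m + n) e v \<inter> horiz_edges m n)
                  = (\<Sum>h\<in>subpath (m + n) e v \<inter> vert_edges m n. \<omega> h)))"

text \<open>The coefficient of z^j in P_i, which has degree \<open>l\<close>.\<close>

definition pcoef :: "nat \<Rightarrow> nat \<Rightarrow> nat \<Rightarrow> 'k::field_char_0 laurent fract" where
  "pcoef i l j = (if j = 0 then 1 else if j \<le> l then pvar i j else 0)"

definition grading_weight ::
  "nat \<Rightarrow> nat \<Rightarrow> nat \<Rightarrow> nat \<Rightarrow> (nat \<Rightarrow> nat) \<Rightarrow> 'k::field_char_0 laurent fract" where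
  "grading_weight l1 l2 m n \<omega> =
     (\<Prod>u\<in>horiz_edges m n. pcoef 2 l2 (\<omega> u)) * (\<Prod>v\<in>vert_edges m n. pcoef 1 l1 (\<omega> v))"

text \<open>
  There may be infinitely many compatible gradings, but only finitely many of nonzero weight; the
  sum in the greedy element ranges over the latter. Gradings are functions on the set of edges,
  made unique by being undefined elsewhere.
\<close>

definition weighted_gradings ::
  "'k::field_char_0 itself \<Rightarrow> nat \<Rightarrow> nat \<Rightarrow> nat \<Rightarrow> nat \<Rightarrow> (nat \<Rightarrow> nat) set" where
  "weighted_gradings K l1 l2 m n =
     {\<omega> \<in> {..<m + n} \<rightarrow>\<^sub>E UNIV. compatible m n \<omega> \<and>
        grading_weight l1 l2 m n \<omega> \<noteq> (0 :: 'k laurent fract)}"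

definition greedy :: "nat \<Rightarrow> nat \<Rightarrow> int \<Rightarrow> int \<Rightarrow> 'k::field_char_0 laurent fract" where
  "greedy l1 l2 a1 a2 =
     (let m = nat (max a1 0); n = nat (max a2 0) in
      xvar 1 powi (- a1) * xvar 2 powi (- a2) *
      (\<Sum>\<omega>\<in>weighted_gradings TYPE('k) l1 l2 m n.
         grading_weight l1 l2 m n \<omega> *
         xvar 1 ^ (\<Sum>v\<in>vert_edges m n. \<omega> v) * xvar 2 ^ (\<Sum>u\<in>horiz_edges m n. \<omega> u)))"

end

theory Submission
  imports Defs
begin

text \<open>
  Let R be the polynomial ring of coefficients. Reversing polynomials shows that each cluster
  variable is polynomial in the preceding four, and following the lowest terms shows that no
  division by leading coefficients is needed; hence the cluster algebra is R[x_0, x_1, x_2, x_3].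
  It is spanned by the standard monomials, those in which neither x_0 x_2 nor x_1 x_3 occurs. Both
  the standard monomials and the greedy elements have lowest term x_1^{-a_1} x_2^{-a_2}, and they
  coincide unless a_1, a_2 > 0. So it suffices that the greedy elements lie in the cluster algebra.

  A grading of the horizontal edges of total weight w leaves at least n - w of the n vertical edges
  free: any value there is compatible (by a cycle lemma, which needs nothing about the
  shape of the path). Summation over these values yields as many factors P_1(x_1) = x_0 x_2, so that
  a greedy element lies in R[x_1^{-1}, x_0, x_1, x_2]; symmetrically, it lies in
  R[x_2^{-1}, x_1, x_2, x_3]. The intersection of these two rings is R[x_0, x_1, x_2, x_3].
\<close>

text \<open>The reversed polynomials have p_{i,l_i} in their denominators, so polynomiality in the
  four preceding variables is proved with all Laurent polynomials in the p_{i,j} as coefficients,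
  the case \<open>lower_alg UNIV\<close>. Descending to R is a separate matter. Dividing by a
  Laurent polynomial with a unique lowest term of coefficient 1 never leaves R, as the quotient is
  determined from its lowest degree upwards. So it suffices that each exchange relation, rewritten
  for normalized variables, has coefficients in R on its right-hand side, which is a question about
  integer exponents alone: how often the leading coefficients of P_1 and P_2 occur in the lowest
  term of x_k. Inequalities for these exponents are needed for every k; they come from periodicity
  if l_1 l_2 < 4 and from an invariant of a linear recursion otherwise. An element with coefficients
  in R that is polynomial in x_0, ..., x_3 over the larger ring is polynomial over R, because
  standard monomials have distinct lowest terms with coefficient 1, so that their coefficients can
  be read off one after the other.\<close>

type_synonym mono = "nat \<Rightarrow>\<^sub>0 int"

abbreviation (input) coef :: "('a \<Rightarrow>\<^sub>0 'b::zero) \<Rightarrow> 'a \<Rightarrow> 'b" where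
  "coef \<equiv> Poly_Mapping.lookup"

abbreviation (input) supp :: "('a \<Rightarrow>\<^sub>0 'b::zero) \<Rightarrow> 'a set" where
  "supp \<equiv> Poly_Mapping.keys"

abbreviation (input) sgl :: "'a \<Rightarrow> 'b \<Rightarrow> ('a \<Rightarrow>\<^sub>0 'b::zero)" where
  "sgl \<equiv> Poly_Mapping.single"

subsection \<open>Subrings and linear combinations\<close>

locale csubring =
  fixes C :: "'a::comm_ring_1 set"
  assumes one_closed [simp, intro]: "1 \<in> C"
    and diff_closed [simp, intro]: "a \<in> C \<Longrightarrow> b \<in> C \<Longrightarrow> a - b \<in> C"
    and mult_closed [simp, intro]: "a \<in> C \<Longrightarrow> b \<in> C \<Longrightarrow> a * b \<in> C"
begin

lemma zero_closed [simp, intro]: "0 \<in> C"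
  using diff_closed[OF one_closed one_closed] by simp

lemma uminus_closed [simp, intro]: "a \<in> C \<Longrightarrow> - a \<in> C"
  using diff_closed[OF zero_closed] by simp

lemma add_closed [simp, intro]: "a \<in> C \<Longrightarrow> b \<in> C \<Longrightarrow> a + b \<in> C"
  using diff_closed[of a "- b"] by simp

lemma power_closed [simp, intro]: "a \<in> C \<Longrightarrow> a ^ n \<in> C"
  by (induction n) auto

lemma sum_closed [intro]: "(\<And>i. i \<in> S \<Longrightarrow> f i \<in> C) \<Longrightarrow> sum f S \<in> C"
  by (induction S rule: infinite_finite_induct) auto

lemma prod_closed [intro]: "(\<And>i. i \<in> S \<Longrightarrow> f i \<in> C) \<Longrightarrow> prod f S \<in> C"
  by (induction S rule: infinite_finite_induct) auto

lemma subring_gen_least: "S \<subseteq> C \<Longrightarrow> subring_gen S \<subseteq> C"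
proof
  fix x assume "S \<subseteq> C" "x \<in> subring_gen S"
  from this(2,1) show "x \<in> C" by (induction) auto
qed

end

lemma csubring_subring_gen [intro, simp]: "csubring (subring_gen S)"
  by unfold_locales (auto intro: subring_gen.intros)

lemma csubring_UNIV [intro, simp]: "csubring UNIV"
  by unfold_locales auto

lemma subring_gen_mono: "S \<subseteq> T \<Longrightarrow> subring_gen S \<subseteq> subring_gen T"
  by (rule csubring.subring_gen_least[OF csubring_subring_gen]) (blast intro: subring_gen.gen)

text \<open>Allows the algebras to be studied among Laurent polynomials and carried to the field of
  fractions by \<open>to_fract\<close> only at the end.\<close>

lemma subring_gen_image:
  fixes h :: "'a::comm_ring_1 \<Rightarrow> 'b::comm_ring_1"
  assumes h1: "h 1 = 1" and hd: "\<And>a b. h (a - b) = h a - h b" and hm: "\<And>a b. h (a * b) = h a * h b"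
  shows "subring_gen (h ` S) = h ` subring_gen S"
proof
  show "subring_gen (h ` S) \<subseteq> h ` subring_gen S"
  proof
    fix x assume "x \<in> subring_gen (h ` S)"
    then show "x \<in> h ` subring_gen S"
    proof (induction rule: subring_gen.induct)
      case one
      show ?case by (rule image_eqI[of _ _ 1]) (simp_all add: h1 subring_gen.one)
    next
      case (gen a)
      then obtain b where "b \<in> S" "a = h b" by blast
      then show ?case by (intro image_eqI[of _ _ b]) (simp_all add: subring_gen.gen)
    next
      case (diff a b)
      then obtain c d where "c \<in> subring_gen S" "d \<in> subring_gen S" "a = h c" "b = h d" by blast
      then show ?case by (intro image_eqI[of _ _ "c - d"]) (simp_all add: hd subring_gen.diff)
    next
      case (mult a b)
      then obtain c d where "c \<in> subring_gen S" "d \<in> subring_gen S" "a = h c" "b = h d" by blast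
      then show ?case by (intro image_eqI[of _ _ "c * d"]) (simp_all add: hm subring_gen.mult)
    qed
  qed
  show "h ` subring_gen S \<subseteq> subring_gen (h ` S)"
  proof
    fix x assume "x \<in> h ` subring_gen S"
    then obtain y where "y \<in> subring_gen S" "x = h y" by auto
    from this(1) have "h y \<in> subring_gen (h ` S)"
      by (induction rule: subring_gen.induct) (simp_all add: h1 hd hm subring_gen.intros)
    then show "x \<in> subring_gen (h ` S)" using \<open>x = h y\<close> by simp
  qed
qed

text \<open>The span in \<open>module_basis\<close>; having it apart from independence allows the
  spans of two families to be compared.\<close>

definition lincomb :: "'a::comm_ring_1 set \<Rightarrow> ('i \<Rightarrow> 'a) \<Rightarrow> 'a set" where
  "lincomb R g = {\<Sum>i\<in>S. c i * g i | S c. finite S \<and> (\<forall>i\<in>S. c i \<in> R)}"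

context csubring
begin

lemma lincomb_base: "g i \<in> lincomb C g"
  unfolding lincomb_def by (rule CollectI, rule exI[of _ "{i}"], rule exI[of _ "\<lambda>_. 1"]) simp

lemma lincomb_zero: "0 \<in> lincomb C g"
  unfolding lincomb_def by (rule CollectI, rule exI[of _ "{}"]) simp

lemma lincomb_scale: "c \<in> C \<Longrightarrow> f \<in> lincomb C g \<Longrightarrow> c * f \<in> lincomb C g"
proof -
  assume c: "c \<in> C" and "f \<in> lincomb C g"
  then obtain S d where f: "f = (\<Sum>i\<in>S. d i * g i)" and S: "finite S" "\<forall>i\<in>S. d i \<in> C"
    unfolding lincomb_def by blast
  have "c * f = (\<Sum>i\<in>S. (c * d i) * g i)"
    unfolding f by (simp add: sum_distrib_left mult.assoc)
  then show ?thesis unfolding lincomb_def using S c by (intro CollectI exI[of _ S] exI[of _ "\<lambda>i. c * d i"]) auto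
qed

lemma lincomb_add: "f \<in> lincomb C g \<Longrightarrow> f' \<in> lincomb C g \<Longrightarrow> f + f' \<in> lincomb C g"
proof -
  assume "f \<in> lincomb C g" "f' \<in> lincomb C g"
  then obtain S d S' d' where f: "f = (\<Sum>i\<in>S. d i * g i)" and S: "finite S" "\<forall>i\<in>S. d i \<in> C"
    and f': "f' = (\<Sum>i\<in>S'. d' i * g i)" and S': "finite S'" "\<forall>i\<in>S'. d' i \<in> C"
    unfolding lincomb_def by blast
  have 1: "f = (\<Sum>i\<in>S \<union> S'. (if i \<in> S then d i else 0) * g i)"
    unfolding f using S S' by (intro sum.mono_neutral_cong_left) auto
  have 2: "f' = (\<Sum>i\<in>S \<union> S'. (if i \<in> S' then d' i else 0) * g i)"
    unfolding f' using S S' by (intro sum.mono_neutral_cong_left) auto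
  have "f + f' = (\<Sum>i\<in>S \<union> S'. ((if i \<in> S then d i else 0) + (if i \<in> S' then d' i else 0)) * g i)"
    unfolding 1 2 by (simp add: sum.distrib distrib_right)
  then show ?thesis unfolding lincomb_def using S S'
    by (intro CollectI exI[of _ "S \<union> S'"] exI[of _ "\<lambda>i. (if i \<in> S then d i else 0) + (if i \<in> S' then d' i else 0)"]) auto
qed

lemma lincomb_sum: "(\<And>i. i \<in> S \<Longrightarrow> f i \<in> lincomb C g) \<Longrightarrow> sum f S \<in> lincomb C g"
  by (induction S rule: infinite_finite_induct) (auto intro: lincomb_add lincomb_zero)

lemma lincomb_diff: "f \<in> lincomb C g \<Longrightarrow> f' \<in> lincomb C g \<Longrightarrow> f - f' \<in> lincomb C g"
  using lincomb_add[of f g "- 1 * f'"] lincomb_scale[of "- 1" f' g] by (simp add: uminus_closed)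

lemma lincomb_least:
  assumes "\<And>i. g i \<in> lincomb C g'"
  shows "lincomb C g \<subseteq> lincomb C g'"
proof
  fix x assume "x \<in> lincomb C g"
  then obtain S d where f: "x = (\<Sum>i\<in>S. d i * g i)" and S: "finite S" "\<forall>i\<in>S. d i \<in> C"
    unfolding lincomb_def by blast
  show "x \<in> lincomb C g'" unfolding f using assms S by (intro lincomb_sum lincomb_scale) auto
qed

end

subsection \<open>Laurent polynomials with a unique lowest term\<close>

lemma total_degree_superset:
  assumes "finite A" "supp m \<subseteq> A"
  shows "total_degree m = (\<Sum>i\<in>A. coef m i)"
  unfolding total_degree_def
  using assms by (intro sum.mono_neutral_left) (auto simp: in_keys_iff)

lemma total_degree_add [simp]: "total_degree (m + n) = total_degree m + total_degree n"
proof -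
  let ?A = "supp m \<union> supp n"
  have "supp (m + n) \<subseteq> ?A" by (rule keys_add)
  then show ?thesis
    by (simp add: total_degree_superset[of ?A] lookup_add sum.distrib)
qed

lemma total_degree_0 [simp]: "total_degree 0 = 0"
  by (simp add: total_degree_def)

lemma total_degree_uminus [simp]: "total_degree (- m) = - total_degree m"
  using total_degree_add[of m "- m"] by simp

lemma total_degree_diff [simp]: "total_degree (m - n) = total_degree m - total_degree n"
  using total_degree_add[of m "- n"] by simp

lemma total_degree_single [simp]: "total_degree (sgl i a) = a"
  by (simp add: total_degree_def)

lemma lookup_mult_single:
  fixes f :: "'a::ab_group_add \<Rightarrow>\<^sub>0 'b::semiring_0"
  shows "coef (f * sgl n c) m = coef f (m - n) * c"
proof -
  have "coef (f * sgl n c) m =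
     (\<Sum>l. coef f l * (\<Sum>q. (c when n = q) when m = l + q))"
    by (simp add: lookup_mult lookup_single)
  also have "\<dots> = (\<Sum>l. coef f l * (c when m = l + n))"
  proof -
    have "(\<Sum>q. (c when n = q) when m = l + q) = (\<Sum>q. (c when m = l + q) when q = n)" for l
      by (intro Sum_any.cong) (auto simp: when_def)
    then show ?thesis by simp
  qed
  also have "\<dots> = (\<Sum>l. (coef f l * c) when l = m - n)"
    by (intro Sum_any.cong) (auto simp: when_def algebra_simps)
  also have "\<dots> = coef f (m - n) * c" by simp
  finally show ?thesis .
qed

lemma lookup_single_mult:
  fixes f :: "'a::ab_group_add \<Rightarrow>\<^sub>0 'b::comm_semiring_0"
  shows "coef (sgl n c * f) m = c * coef f (m - n)"
  using lookup_mult_single[of f n c m] by (simp add: mult.commute)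

definition deg_ge :: "'k::field_char_0 laurent \<Rightarrow> int \<Rightarrow> bool" where
  "deg_ge f d \<longleftrightarrow> (\<forall>m\<in>supp f. d \<le> total_degree m)"

lemma deg_ge_0 [simp, intro]: "deg_ge 0 d" by (simp add: deg_ge_def)

lemma deg_ge_add [intro]: "deg_ge f d \<Longrightarrow> deg_ge g d \<Longrightarrow> deg_ge (f + g) d"
  using keys_add[of f g] unfolding deg_ge_def by blast

lemma deg_ge_diff [intro]: "deg_ge f d \<Longrightarrow> deg_ge g d \<Longrightarrow> deg_ge (f - g) d"
  using keys_diff[of f g] unfolding deg_ge_def by blast

lemma deg_ge_sum [intro]: "(\<And>i. i \<in> S \<Longrightarrow> deg_ge (f i) d) \<Longrightarrow> deg_ge (sum f S) d"
  by (induction S rule: infinite_finite_induct) auto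

lemma deg_ge_mult [intro]: "deg_ge f d \<Longrightarrow> deg_ge g e \<Longrightarrow> deg_ge (f * g) (d + e)"
  using keys_mult[of f g] unfolding deg_ge_def by (fastforce simp: add_mono)

lemma deg_ge_mono: "deg_ge f d \<Longrightarrow> e \<le> d \<Longrightarrow> deg_ge f e"
  unfolding deg_ge_def by fastforce

lemma deg_ge_single [simp]: "d \<le> total_degree m \<Longrightarrow> deg_ge (sgl m c) d"
  by (simp add: deg_ge_def)

lemma deg_ge_lookup: "deg_ge f d \<Longrightarrow> total_degree m < d \<Longrightarrow> coef f m = 0"
  unfolding deg_ge_def by (metis in_keys_iff not_less)

text \<open>A unique lowest term with coefficient 1, put as one degree bound on the rest. In this
  form sums and products are handled by \<open>deg_ge\<close> alone.\<close>

definition pointed :: "'k::field_char_0 laurent \<Rightarrow> mono \<Rightarrow> bool" where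
  "pointed f m \<longleftrightarrow> deg_ge (f - sgl m 1) (total_degree m + 1)"

lemma pointed_lookup: "pointed f m \<Longrightarrow> coef f m = 1"
  unfolding pointed_def using deg_ge_lookup[of "f - sgl m 1" "total_degree m + 1" m]
  by (simp add: lookup_minus)

lemma pointed_nonzero: "pointed f m \<Longrightarrow> f \<noteq> 0"
  using pointed_lookup by fastforce

lemma pointed_single [simp]: "pointed (sgl m 1) m" by (simp add: pointed_def)

lemma pointed_deg_ge: "pointed f m \<Longrightarrow> deg_ge f (total_degree m)"
  using deg_ge_add[of "f - sgl m 1" "total_degree m" "sgl m 1"]
  unfolding pointed_def by (simp add: deg_ge_mono)

lemma pointed_add_deg_ge: "pointed f m \<Longrightarrow> deg_ge g (total_degree m + 1) \<Longrightarrow> pointed (f + g) m"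
  unfolding pointed_def using deg_ge_add[of "f - sgl m 1" _ g] by (simp add: algebra_simps)

lemma pointed_mult:
  assumes "pointed f m" "pointed g n"
  shows "pointed (f * g) (m + n)"
proof -
  let ?s = "sgl m 1 :: 'a laurent" and ?t = "sgl n 1 :: 'a laurent"
  have "f * g - sgl (m + n) 1 = ?s * (g - ?t) + (f - ?s) * g"
    by (simp add: algebra_simps mult_single)
  moreover have "deg_ge (?s * (g - ?t)) (total_degree m + (total_degree n + 1))"
    using assms by (intro deg_ge_mult) (auto simp: pointed_def)
  moreover have "deg_ge ((f - ?s) * g) ((total_degree m + 1) + total_degree n)"
    using assms by (intro deg_ge_mult pointed_deg_ge) (auto simp: pointed_def)
  ultimately show ?thesis unfolding pointed_def by (simp add: add.assoc add.commute add.left_commute deg_ge_add)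
qed

lemma pointed_1 [simp]: "pointed 1 0"
  using pointed_single[of 0] by simp

lemma pointed_keys:
  "pointed f m \<Longrightarrow> m' \<in> supp f \<Longrightarrow> m' \<noteq> m \<Longrightarrow> total_degree m < total_degree m'"
proof -
  assume "pointed f m" "m' \<in> supp f" "m' \<noteq> m"
  then have "m' \<in> supp (f - sgl m 1)"
    by (simp add: in_keys_iff lookup_minus lookup_single)
  with \<open>pointed f m\<close> have "total_degree m + 1 \<le> total_degree m'" unfolding pointed_def deg_ge_def by blast
  then show ?thesis by simp
qed

lemma ptdI:
  assumes "coef f m = 1"
    and "\<And>m'. m' \<in> supp f \<Longrightarrow> m' \<noteq> m \<Longrightarrow> total_degree m < total_degree m'"
  shows "pointed f m"
  unfolding pointed_def deg_ge_def
proof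
  fix k assume "k \<in> supp (f - sgl m 1)"
  then have "coef f k - (1 when m = k) \<noteq> 0"
    by (simp add: in_keys_iff lookup_minus lookup_single)
  then have "k \<noteq> m" "k \<in> supp f" using assms(1) by (auto simp: in_keys_iff when_def split: if_splits)
  then show "total_degree m + 1 \<le> total_degree k" using assms(2) by force
qed

lemma unit_lowest_term_iff: "unit_lowest_term f \<longleftrightarrow> (\<exists>m. pointed f m)"
proof
  show "unit_lowest_term f \<Longrightarrow> \<exists>m. pointed f m"
    unfolding unit_lowest_term_def by (auto intro: ptdI)
  show "\<exists>m. pointed f m \<Longrightarrow> unit_lowest_term f"
    unfolding unit_lowest_term_def by (metis pointed_keys pointed_lookup in_keys_iff zero_neq_one)
qed

text \<open>In the lowest possible degree of the product only lowest terms of both factors meet, and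
  \<open>g\<close> has a single one. So the coefficients of \<open>f\<close> in degree
  \<open>d\<close> are copied unchanged, even if \<open>f\<close> has several terms there.\<close>

lemma lookup_mult_pointed:
  assumes "deg_ge f d" "pointed g n" "total_degree m = d"
  shows "coef (f * g) (m + n) = coef f m"
proof -
  let ?t = "sgl n 1 :: 'a laurent"
  have "f * g = f * ?t + f * (g - ?t)" by (simp add: algebra_simps)
  moreover have "deg_ge (f * (g - ?t)) (d + (total_degree n + 1))"
    using assms by (intro deg_ge_mult) (auto simp: pointed_def)
  then have "coef (f * (g - ?t)) (m + n) = 0"
    using assms by (intro deg_ge_lookup) auto
  ultimately show ?thesis by (simp add: lookup_add lookup_mult_single)
qed

text \<open>Every lowest monomial of \<open>f\<close>, shifted by \<open>n\<close>, survives in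
  \<open>h\<close> by \<open>lookup_mult_pointed\<close>. As \<open>h\<close> has only the lowest
  monomial \<open>r\<close>, there is just one, namely \<open>r - n\<close>.\<close>

lemma pointed_quotient:
  assumes "f * g = h" "pointed g n" "pointed h r"
  shows "pointed f (r - n)"
proof -
  have "f \<noteq> 0" using assms pointed_nonzero by force
  then have ne: "supp f \<noteq> {}" by simp
  define d where "d = Min (total_degree ` supp f)"
  have lf: "deg_ge f d" unfolding deg_ge_def d_def by simp
  have "d \<in> total_degree ` supp f" unfolding d_def using ne by (intro Min_in) auto
  then obtain m0 where m0: "m0 \<in> supp f" "total_degree m0 = d" by auto
  have key: "m + n = r" if "m \<in> supp f" "total_degree m = d" for m
  proof (rule ccontr)
    assume ne: "m + n \<noteq> r"
    have nz: "coef h (m + n) \<noteq> 0"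
      using lookup_mult_pointed[OF lf assms(2) that(2)] that(1) assms(1) by (simp add: in_keys_iff)
    then have "total_degree r < total_degree (m + n)"
      using pointed_keys[OF assms(3), of "m + n"] ne by (simp add: in_keys_iff)
    then have "total_degree r < d + total_degree n" using that by simp
    moreover have "deg_ge h (d + total_degree n)" using lf pointed_deg_ge[OF assms(2)] assms(1) by auto
    ultimately have "coef h r = 0" by (rule deg_ge_lookup[rotated])
    then show False using pointed_lookup[OF assms(3)] by simp
  qed
  have mr: "m0 = r - n" using key[OF m0] by (simp add: algebra_simps)
  show ?thesis
  proof (rule ptdI)
    show "coef f (r - n) = 1"
      using lookup_mult_pointed[OF lf assms(2) m0(2)] key[OF m0] pointed_lookup[OF assms(3)] assms(1) mr by simp
    fix m' assume m': "m' \<in> supp f" "m' \<noteq> r - n"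
    then have "total_degree m' \<noteq> d" using key[OF m'(1)] by (auto simp: algebra_simps)
    moreover have "d \<le> total_degree m'" using lf m' unfolding deg_ge_def by auto
    ultimately show "total_degree (r - n) < total_degree m'" using m0 mr by simp
  qed
qed

section \<open>Laurent polynomials with coefficients in a subring\<close>

definition laurent_over :: "'k pcoeff set \<Rightarrow> 'k::field_char_0 laurent set" where
  "laurent_over C = {f. \<forall>m. coef f m \<in> C}"

lemma laurent_over_lookup: "f \<in> laurent_over C \<Longrightarrow> coef f m \<in> C" by (simp add: laurent_over_def)

lemma poly_mapping_expand: "f = (\<Sum>m\<in>supp f. sgl m (coef f m))"
proof (rule poly_mapping_eqI)
  fix k
  show "coef f k = coef (\<Sum>m\<in>supp f. sgl m (coef f m)) k"
    by (simp add: lookup_sum lookup_single when_def in_keys_iff)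
qed

lemma laurent_over_single: "c \<in> C \<Longrightarrow> 0 \<in> C \<Longrightarrow> sgl m c \<in> laurent_over C"
  by (simp add: laurent_over_def lookup_single when_def)

lemma csubring_laurent_over: assumes "csubring C" shows "csubring (laurent_over C)"
proof -
  interpret csubring C by fact
  have add: "f + g \<in> laurent_over C" if "f \<in> laurent_over C" "g \<in> laurent_over C" for f g using that by (simp add: laurent_over_def lookup_add)
  have s: "sum f S \<in> laurent_over C" if "\<And>i. i \<in> S \<Longrightarrow> f i \<in> laurent_over C" for f and S :: "mono set"
    using that
  proof (induction S rule: infinite_finite_induct)
    case (insert x F)
    then show ?case using add[of "f x" "sum f F"] by simp
  qed (simp_all add: laurent_over_def)
  show ?thesis
  proof
    show "1 \<in> laurent_over C" by (simp add: laurent_over_def lookup_one when_def)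
    show "f - g \<in> laurent_over C" if "f \<in> laurent_over C" "g \<in> laurent_over C" for f g using that by (simp add: laurent_over_def lookup_minus)
    fix f g assume fg: "f \<in> laurent_over C" "g \<in> laurent_over C"
    have "f * g = (\<Sum>m\<in>supp f. sgl m (coef f m)) *
        (\<Sum>n\<in>supp g. sgl n (coef g n))"
      by (rule arg_cong2[of _ _ _ _ "(*)"]) (rule poly_mapping_expand)+
    also have "\<dots> = (\<Sum>m\<in>supp f. \<Sum>n\<in>supp g.
        sgl (m + n) (coef f m * coef g n))"
      by (simp add: sum_product mult_single)
    also have "\<dots> \<in> laurent_over C" using fg by (intro s laurent_over_single) (auto simp: laurent_over_def)
    finally show "f * g \<in> laurent_over C" .
  qed
qed

text \<open>Division by a pointed element never divides coefficients. If some coefficient of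
  \<open>f\<close> were outside \<open>C\<close>, take one of lowest degree; once the part of
  smaller degree is subtracted, the lowest term of \<open>g\<close> copies it into a Laurent
  polynomial over \<open>C\<close>.\<close>

lemma laurent_over_quotient:
  assumes "csubring C" "f * g = h" "pointed g n" "g \<in> laurent_over C" "h \<in> laurent_over C"
  shows "f \<in> laurent_over C"
proof (rule ccontr)
  interpret csubring C by fact
  interpret L: csubring "laurent_over C" by (rule csubring_laurent_over) fact
  assume "f \<notin> laurent_over C"
  define B where "B = {m. coef f m \<notin> C}"
  have "B \<subseteq> supp f" unfolding B_def by (auto simp: in_keys_iff)
  then have fB: "finite B" by (rule finite_subset) simp
  have "B \<noteq> {}" using \<open>f \<notin> laurent_over C\<close> by (auto simp: laurent_over_def B_def)
  define d where "d = Min (total_degree ` B)"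
  have "d \<in> total_degree ` B" unfolding d_def using fB \<open>B \<noteq> {}\<close> by (intro Min_in) auto
  then obtain m where m: "m \<in> B" "total_degree m = d" by auto
  have dB: "d \<le> total_degree m'" if "m' \<in> B" for m' unfolding d_def using fB that by simp
  define f1 where "f1 = (\<Sum>k\<in>{k\<in>supp f. total_degree k < d}. sgl k (coef f k))"
  have l1: "coef f1 k = (if total_degree k < d then coef f k else 0)" for k
  proof -
    have "coef f1 k = (\<Sum>j\<in>{j\<in>supp f. total_degree j < d}. if k = j then coef f j else 0)"
      unfolding f1_def lookup_sum by (intro sum.cong) (auto simp: lookup_single when_def)
    also have "\<dots> = (if total_degree k < d then coef f k else 0)"
      by (subst sum.delta') (auto simp: in_keys_iff)
    finally show ?thesis .
  qed
  have "f1 \<in> laurent_over C" unfolding laurent_over_def using dB by (force simp: l1 B_def)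
  moreover have "(f - f1) * g = h - f1 * g" using assms(2) by (simp add: algebra_simps)
  ultimately have "(f - f1) * g \<in> laurent_over C" using assms by auto
  moreover have "deg_ge (f - f1) d" unfolding deg_ge_def by (auto simp: in_keys_iff lookup_minus l1 split: if_splits)
  then have "coef ((f - f1) * g) (m + n) = coef (f - f1) m"
    using m assms(3) by (intro lookup_mult_pointed)
  moreover have "coef (f - f1) m = coef f m" using m by (simp add: lookup_minus l1)
  ultimately show False using m by (metis B_def laurent_over_lookup mem_Collect_eq)
qed

lemma (in csubring) csubring_lincomb:
  assumes "1 \<in> lincomb C g" and "\<And>i j. g i * g j \<in> lincomb C g"
  shows "csubring (lincomb C g)"
proof
  fix x y assume "x \<in> lincomb C g" "y \<in> lincomb C g"
  then obtain S d T e where x: "x = (\<Sum>i\<in>S. d i * g i)" and S: "\<forall>i\<in>S. d i \<in> C"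
    and y: "y = (\<Sum>i\<in>T. e i * g i)" and T: "\<forall>i\<in>T. e i \<in> C"
    unfolding lincomb_def by blast
  have "x * y = (\<Sum>i\<in>S. \<Sum>j\<in>T. (d i * e j) * (g i * g j))"
    unfolding x y sum_product by (simp add: mult_ac)
  also have "\<dots> \<in> lincomb C g"
  proof (intro lincomb_sum)
    fix i j assume "i \<in> S" "j \<in> T"
    then have "d i * e j \<in> C" using S T by auto
    then show "(d i * e j) * (g i * g j) \<in> lincomb C g" using assms(2) by (rule lincomb_scale)
  qed
  finally show "x * y \<in> lincomb C g" .
qed (use assms lincomb_diff in auto)

lemma (in csubring) subring_gen_insert_subset:
  "subring_gen (insert v C) \<subseteq> lincomb C (\<lambda>j::nat. v ^ j)"
proof (rule csubring.subring_gen_least)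
  have one: "1 \<in> lincomb C (\<lambda>j::nat. v ^ j)" using lincomb_base[of "\<lambda>j::nat. v ^ j" 0] by simp
  show "csubring (lincomb C (\<lambda>j::nat. v ^ j))"
    by (rule csubring_lincomb[OF one])
      (use lincomb_base[of "\<lambda>j::nat. v ^ j"] in \<open>simp add: power_add[symmetric]\<close>)
  show "insert v C \<subseteq> lincomb C (\<lambda>j::nat. v ^ j)"
    using lincomb_base[of "\<lambda>j::nat. v ^ j" 1] lincomb_scale[OF _ one] by force
qed

text \<open>Elements congruent to 1 modulo \<open>v\<close> are closed under powers. The
  applications are v = x_i, for powers of P_i(x_i), and v = \<open>t2\<close> in
  \<open>lower_alg_step\<close>.\<close>

lemma (in csubring) one_plus_mult_power:
  assumes "v \<in> C" "w \<in> C"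
  shows "\<exists>w'\<in>C. (1 + v * w) ^ n = 1 + v * w'"
proof (induction n)
  case 0
  show ?case by (rule bexI[of _ 0]) auto
next
  case (Suc n)
  then obtain w' where w': "w' \<in> C" "(1 + v * w) ^ n = 1 + v * w'" by blast
  have "(1 + v * w) ^ Suc n = 1 + v * (w + w' + v * (w * w'))"
    by (simp add: w'(2) algebra_simps)
  then show ?case using assms w' by (intro bexI[of _ "w + w' + v * (w * w')"]) auto
qed

subsection \<open>The initial seed and its neighbours\<close>

definition scal :: "'k pcoeff \<Rightarrow> 'k::field_char_0 laurent" where
  "scal c = sgl 0 c"

definition xpow :: "nat \<Rightarrow> int \<Rightarrow> 'k::field_char_0 laurent" where
  "xpow i k = sgl (sgl i k) 1"

definition pgen :: "nat \<Rightarrow> nat \<Rightarrow> 'k::field_char_0 pcoeff" where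
  "pgen i j = sgl (sgl (prod_encode (i, j)) 1) 1"

text \<open>The exponent vector of x_1^{-a_1} x_2^{-a_2}. A larger weight a_1 + a_2 means a lower
  degree, which is why the triangularity arguments below start at maximal weight.\<close>

definition neg_mon :: "int \<times> int \<Rightarrow> mono" where
  "neg_mon a = sgl 1 (- fst a) + sgl 2 (- snd a)"

lemma scal_1 [simp]: "scal 1 = 1" by (simp add: scal_def)
lemma scal_0 [simp]: "scal 0 = 0" by (simp add: scal_def)
lemma scal_diff: "scal (a - b) = scal a - scal b" by (simp add: scal_def single_diff)
lemma scal_mult: "scal (a * b) = scal a * scal b" by (simp add: scal_def mult_single)
lemma scal_power: "scal (a ^ n) = scal a ^ n" by (induction n) (simp_all add: scal_mult)

lemma csubring_scal: "csubring C \<Longrightarrow> csubring (scal ` C)"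
proof -
  assume "csubring C"
  then interpret csubring C .
  show ?thesis
  proof
    show "1 \<in> scal ` C" by (rule image_eqI[of _ _ 1]) auto
  qed (auto simp: scal_diff[symmetric] scal_mult[symmetric])
qed

lemma lookup_scal_mult [simp]: "coef (scal c * f) m = c * coef f m"
  by (simp add: scal_def lookup_single_mult)

lemma deg_ge_scal [simp]: "deg_ge (scal c) 0" by (simp add: scal_def)

lemma deg_ge_scal_mult [intro]: "deg_ge f d \<Longrightarrow> deg_ge (scal c * f) d"
  using deg_ge_mult[OF deg_ge_scal, of f d c] by simp

lemma xpow_0 [simp]: "xpow i 0 = 1" by (simp add: xpow_def)
lemma xpow_add: "xpow i (a + b) = xpow i a * xpow i b" by (simp add: xpow_def mult_single single_add)
lemma xpow_cancel [simp]: "xpow i a * xpow i (- a) = 1" "xpow i (- a) * xpow i a = 1"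
  by (simp_all add: xpow_add[symmetric])
lemma xpow_power: "xpow i a ^ n = xpow i (int n * a)"
  by (induction n) (simp_all add: xpow_add[symmetric] algebra_simps)
lemma pointed_xpow [simp]: "pointed (xpow i a) (sgl i a)" by (simp add: xpow_def)
lemma xpow_nonzero [simp]: "xpow i a \<noteq> 0" using pointed_nonzero[OF pointed_xpow] .

lemma total_degree_neg_mon [simp]: "total_degree (neg_mon a) = - (fst a + snd a)"
  by (simp add: neg_mon_def)

lemma lookup_neg_mon: "coef (neg_mon a) 1 = - fst a" "coef (neg_mon a) 2 = - snd a"
  by (simp_all add: neg_mon_def lookup_add lookup_single)

lemma neg_mon_inj: "neg_mon a = neg_mon b \<longleftrightarrow> a = b"
  using lookup_neg_mon[of a] lookup_neg_mon[of b] by (metis neg_equal_iff_equal prod_eqI)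

text \<open>No member reaches below its own lowest degree, which is at least that of
  \<open>neg_mon a\<close>; in that degree it can have only its own lowest monomial, and this
  differs from \<open>neg_mon a\<close> unless the member is \<open>g a\<close>.\<close>

lemma lookup_lincomb_lead:
  assumes "finite S" "a \<in> S" "\<And>b. b \<in> S \<Longrightarrow> fst b + snd b \<le> fst a + snd a"
    and "\<And>b. b \<in> S \<Longrightarrow> pointed (g b) (neg_mon b)"
  shows "coef (\<Sum>b\<in>S. scal (c b) * g b) (neg_mon a) = c a"
proof -
  have "coef (g b) (neg_mon a) = (if b = a then 1 else 0)" if "b \<in> S" for b
  proof (cases "b = a")
    case True
    then show ?thesis using assms(2,4) by (simp add: pointed_lookup)
  next
    case False
    then have "neg_mon a \<noteq> neg_mon b" by (simp add: neg_mon_inj)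
    moreover have "\<not> total_degree (neg_mon b) < total_degree (neg_mon a)" using assms(3)[OF that] by simp
    ultimately show ?thesis using pointed_keys[OF assms(4)[OF that], of "neg_mon a"] False
      by (auto simp: in_keys_iff)
  qed
  then have "coef (\<Sum>b\<in>S. scal (c b) * g b) (neg_mon a) = (\<Sum>b\<in>S. if b = a then c b else 0)"
    unfolding lookup_sum lookup_scal_mult by (intro sum.cong) auto
  then show ?thesis using assms by simp
qed

lemma ex_max_weight:
  assumes "finite S" "S \<noteq> {}"
  obtains a :: "int \<times> int" where "a \<in> S" "\<And>b. b \<in> S \<Longrightarrow> fst b + snd b \<le> fst a + snd a"
proof -
  let ?f = "\<lambda>a::int \<times> int. fst a + snd a"
  have "Max (?f ` S) \<in> ?f ` S" using assms by (intro Max_in) auto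
  then obtain a where "a \<in> S" "?f a = Max (?f ` S)" by auto
  then show ?thesis using assms by (intro that[of a]) auto
qed

lemma lincomb_independent:
  assumes "finite S" "\<And>b. b \<in> S \<Longrightarrow> pointed (g b) (neg_mon b)" "(\<Sum>b\<in>S. scal (c b) * g b) = 0" "a \<in> S"
  shows "c a = 0"
proof (rule ccontr)
  define T where "T = {b \<in> S. c b \<noteq> 0}"
  assume "c a \<noteq> 0"
  then have "a \<in> T" "finite T" using assms by (auto simp: T_def)
  then have "T \<noteq> {}" by blast
  with \<open>finite T\<close> obtain b where b: "b \<in> T" "\<And>b'. b' \<in> T \<Longrightarrow> fst b' + snd b' \<le> fst b + snd b"
    using ex_max_weight by metis
  have "(\<Sum>b\<in>S. scal (c b) * g b) = (\<Sum>b\<in>T. scal (c b) * g b)"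
    unfolding T_def using assms(1) by (intro sum.mono_neutral_right) auto
  moreover have "coef (\<Sum>b\<in>T. scal (c b) * g b) (neg_mon b) = c b"
    using b \<open>finite T\<close> assms(2) by (intro lookup_lincomb_lead) (auto simp: T_def)
  ultimately show False using assms(3) b by (simp add: T_def)
qed

text \<open>Unitriangularity: the coefficient at maximal weight is a Laurent coefficient of the sum,
  hence in \<open>C\<close>. Its summand can be subtracted without leaving
  \<open>laurent_over C\<close>, and induction applies to the rest.\<close>

lemma lincomb_coeffs_in:
  assumes "csubring C" "finite S" "\<And>b. b \<in> S \<Longrightarrow> pointed (g b) (neg_mon b)" "\<And>b. b \<in> S \<Longrightarrow> g b \<in> laurent_over C"
    and "(\<Sum>b\<in>S. scal (c b) * g b) \<in> laurent_over C"
  shows "\<forall>a\<in>S. c a \<in> C"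
  using assms(2-)
proof (induction "card S" arbitrary: S)
  case 0
  then show ?case by simp
next
  case (Suc n)
  interpret L: csubring "laurent_over C" by (rule csubring_laurent_over) fact
  interpret csubring C by fact
  have "S \<noteq> {}" using Suc by auto
  then obtain a where a: "a \<in> S" "\<And>b. b \<in> S \<Longrightarrow> fst b + snd b \<le> fst a + snd a"
    using ex_max_weight[OF Suc.prems(1)] by metis
  have "coef (\<Sum>b\<in>S. scal (c b) * g b) (neg_mon a) = c a"
    using a Suc.prems by (intro lookup_lincomb_lead) auto
  then have ca: "c a \<in> C" using laurent_over_lookup[OF Suc.prems(4), of "neg_mon a"] by simp
  then have "scal (c a) \<in> laurent_over C" unfolding scal_def by (intro laurent_over_single) auto
  have "(\<Sum>b\<in>S - {a}. scal (c b) * g b) = (\<Sum>b\<in>S. scal (c b) * g b) - scal (c a) * g a"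
    using a Suc.prems(1) by (simp add: sum_diff1)
  also have "\<dots> \<in> laurent_over C" using Suc.prems a \<open>scal (c a) \<in> laurent_over C\<close> by auto
  finally have "(\<Sum>b\<in>S - {a}. scal (c b) * g b) \<in> laurent_over C" .
  moreover have "n = card (S - {a})" using Suc a by simp
  ultimately have "\<forall>b\<in>S - {a}. c b \<in> C" using Suc.prems by (intro Suc.hyps(1)) auto
  then show ?case using ca by auto
qed

lemma lincomb_scal_cases:
  assumes "f \<in> lincomb (scal ` C) g"
  obtains S c where "finite S" "\<And>i. i \<in> S \<Longrightarrow> c i \<in> C" "f = (\<Sum>i\<in>S. scal (c i) * g i)"
proof -
  obtain S d where f: "f = (\<Sum>i\<in>S. d i * g i)" and S: "finite S" "\<forall>i\<in>S. d i \<in> scal ` C"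
    using assms unfolding lincomb_def by blast
  from S(2) have "\<forall>i\<in>S. \<exists>e. e \<in> C \<and> d i = scal e" by blast
  from bchoice[OF this] obtain c where c: "\<forall>i\<in>S. c i \<in> C \<and> d i = scal (c i)" by blast
  show ?thesis by (rule that[of S c]) (use S c f in \<open>auto intro: sum.cong\<close>)
qed

text \<open>Degrees are a function of the index so that the symmetry between x_1 and x_2, which
  replaces \<open>i\<close> by \<open>3 - i\<close>, serves both variables with one proof.
  \<open>K\<close> fixes the type of the ground field.\<close>

locale exchange =
  fixes ll :: "nat \<Rightarrow> nat" and K :: "'k::field_char_0 itself"
  assumes ll_pos: "ll i \<ge> 1"
begin

definition pcf :: "nat \<Rightarrow> nat \<Rightarrow> 'k pcoeff" where
  "pcf i s = (if s = 0 then 1 else if s \<le> ll i then pgen i s else 0)"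

definition pring :: "'k pcoeff set" where
  "pring = subring_gen (range (sgl 0) \<union> {pgen i j | i j. (i = 1 \<or> i = 2) \<and> 1 \<le> j \<and> j \<le> ll i})"

text \<open>\<open>Pval i\<close> is P_i(x_i), and \<open>nbr 1\<close>, \<open>nbr 2\<close> are x_0, x_3.\<close>

definition Pval :: "nat \<Rightarrow> 'k laurent" where
  "Pval i = (\<Sum>s\<le>ll i. scal (pcf i s) * xpow i 1 ^ s)"

definition nbr :: "nat \<Rightarrow> 'k laurent" where
  "nbr i = Pval i * xpow (3 - i) (- 1)"

text \<open>For positive exponents the substitute for x_i^{-1} is \<open>nbr (3 - i)\<close>, that
  is x_3 for i = 1 and x_0 for i = 2: it is the neighbour with x_i in the denominator, so that the
  lowest term is x_i^{-a} for both signs.\<close>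

definition std_factor :: "nat \<Rightarrow> int \<Rightarrow> 'k laurent" where
  "std_factor i a = (if a \<ge> 0 then nbr (3 - i) ^ nat a else xpow i (- a))"

definition std_mon :: "int \<times> int \<Rightarrow> 'k laurent" where
  "std_mon a = std_factor 1 (fst a) * std_factor 2 (snd a)"

text \<open>The algebra C[x_0, x_1, x_2, x_3]. It is used for \<open>pring\<close> and, as long as
  leading coefficients may stand in denominators, for \<open>UNIV\<close>.\<close>

definition lower_alg :: "'k pcoeff set \<Rightarrow> 'k laurent set" where
  "lower_alg C = subring_gen (scal ` C \<union> {xpow i 1 | i. i = 1 \<or> i = 2} \<union> {nbr i | i. i = 1 \<or> i = 2})"

lemma csubring_pring [simp, intro]: "csubring pring" by (simp add: pring_def)

sublocale pring: csubring "pring :: 'k pcoeff set" by simp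

lemma pcf_0 [simp]: "pcf i 0 = 1" by (simp add: pcf_def)

lemma pcf_in_pring [simp, intro]: assumes "i = 1 \<or> i = 2" shows "pcf i s \<in> pring"
proof -
  consider "s = 0" | "s > ll i" | "1 \<le> s" "s \<le> ll i" by linarith
  then show ?thesis
  proof cases
    case 3
    then have "pgen i s \<in> pring" unfolding pring_def using assms by (intro subring_gen.gen) blast
    then show ?thesis using 3 by (simp add: pcf_def)
  qed (simp_all add: pcf_def)
qed

lemma deg_ge_xpow_power [simp]: "deg_ge (xpow i 1 ^ s) (int s)"
  by (simp add: xpow_power) (simp add: xpow_def)

lemma pointed_Pval: "pointed (Pval i) 0"
proof -
  have eq: "Pval i = 1 + (\<Sum>s\<in>{1..ll i}. scal (pcf i s) * xpow i 1 ^ s)"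
  proof -
    have "{..ll i} = insert 0 {1..ll i}" by auto
    then show ?thesis by (simp add: Pval_def)
  qed
  show ?thesis unfolding eq
  proof (rule pointed_add_deg_ge[OF pointed_1])
    show "deg_ge (\<Sum>s\<in>{1..ll i}. scal (pcf i s) * xpow i 1 ^ s) (total_degree 0 + 1)"
      by (intro deg_ge_sum deg_ge_scal_mult) (auto intro: deg_ge_mono[OF deg_ge_xpow_power])
  qed
qed

lemma nbr_xpow: "i = 1 \<or> i = 2 \<Longrightarrow> nbr i * xpow (3 - i) 1 = Pval i"
  by (simp add: nbr_def mult.assoc xpow_add[symmetric])

lemma pointed_nbr: "pointed (nbr i) (sgl (3 - i) (- 1))"
  using pointed_mult[OF pointed_Pval pointed_xpow] by (simp add: nbr_def)

lemma pointed_std_factor: assumes "i = 1 \<or> i = 2" shows "pointed (std_factor i a) (sgl i (- a))"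
proof (cases "a \<ge> 0")
  case True
  have "pointed (nbr (3 - i) ^ n) (sgl i (- int n))" for n
  proof (induction n)
    case (Suc n)
    have "3 - (3 - i) = i" using assms by auto
    then have "pointed (nbr (3 - i) * nbr (3 - i) ^ n) (sgl i (- 1) + sgl i (- int n))"
      using pointed_mult[OF pointed_nbr[of "3 - i"] Suc] by (simp only:)
    then show ?case by (simp add: single_add[symmetric])
  qed simp
  from this[of "nat a"] show ?thesis using True by (simp add: std_factor_def)
next
  case False
  then show ?thesis by (simp add: std_factor_def)
qed

lemma pointed_std_mon: "pointed (std_mon a) (neg_mon a)"
  unfolding std_mon_def neg_mon_def by (intro pointed_mult pointed_std_factor) auto

lemma lower_alg_gens:
  "i = 1 \<or> i = 2 \<Longrightarrow> xpow i 1 \<in> lower_alg C" "i = 1 \<or> i = 2 \<Longrightarrow> nbr i \<in> lower_alg C" "c \<in> C \<Longrightarrow> scal c \<in> lower_alg C"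
  by (auto simp: lower_alg_def intro: subring_gen.gen)

lemma csubring_lower_alg [simp, intro]: "csubring (lower_alg C)" by (simp add: lower_alg_def)

section \<open>Straightening into standard monomials\<close>

definition mon4 :: "nat \<Rightarrow> nat \<Rightarrow> nat \<Rightarrow> nat \<Rightarrow> 'k laurent" where
  "mon4 a b c d = nbr 1 ^ a * xpow 1 1 ^ b * xpow 2 1 ^ c * nbr 2 ^ d"

lemma mon4_std_mon:
  assumes "a = 0 \<or> c = 0" "b = 0 \<or> d = 0"
  shows "mon4 a b c d = std_mon (int d - int b, int a - int c)"
  using assms by (auto simp: mon4_def std_mon_def std_factor_def xpow_power)

lemma std_mon_mon4: "\<exists>a' b c d. std_mon a = mon4 a' b c d"
proof -
  have "mon4 (nat (snd a)) (nat (- fst a)) (nat (- snd a)) (nat (fst a))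
      = std_mon (int (nat (fst a)) - int (nat (- fst a)), int (nat (snd a)) - int (nat (- snd a)))"
    by (rule mon4_std_mon) auto
  also have "(int (nat (fst a)) - int (nat (- fst a)), int (nat (snd a)) - int (nat (- snd a))) = a"
    by (cases a) auto
  finally have "std_mon a = mon4 (nat (snd a)) (nat (- fst a)) (nat (- snd a)) (nat (fst a))" ..
  then show ?thesis by blast
qed

lemma mon4_mult: "mon4 a b c d * mon4 a' b' c' d' = mon4 (a + a') (b + b') (c + c') (d + d')"
  by (simp add: mon4_def power_add mult_ac)

text \<open>The relations x_0 x_2 = P_1(x_1) and x_1 x_3 = P_2(x_2) as rewriting rules; the
  arguments of \<open>mon4\<close> are the exponents of x_0, x_1, x_2, x_3 in this order.\<close>

lemma mon4_reduce:
  "mon4 (Suc a) b (Suc c) d = (\<Sum>s\<le>ll 1. scal (pcf 1 s) * mon4 a (b + s) c d)"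
  "mon4 a (Suc b) c (Suc d) = (\<Sum>s\<le>ll 2. scal (pcf 2 s) * mon4 a b (c + s) d)"
proof -
  have "mon4 (Suc a) b (Suc c) d = nbr 1 ^ a * xpow 1 1 ^ b * xpow 2 1 ^ c * nbr 2 ^ d * (nbr 1 * xpow (3 - 1) 1)"
    by (simp add: mon4_def mult_ac)
  also have "nbr 1 * xpow (3 - 1) 1 = Pval 1" by (rule nbr_xpow) simp
  finally show "mon4 (Suc a) b (Suc c) d = (\<Sum>s\<le>ll 1. scal (pcf 1 s) * mon4 a (b + s) c d)"
    unfolding Pval_def sum_distrib_left by (simp add: mon4_def power_add mult_ac)
  have "mon4 a (Suc b) c (Suc d) = nbr 1 ^ a * xpow 1 1 ^ b * xpow 2 1 ^ c * nbr 2 ^ d * (nbr 2 * xpow (3 - 2) 1)"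
    by (simp add: mon4_def mult_ac)
  also have "nbr 2 * xpow (3 - 2) 1 = Pval 2" by (rule nbr_xpow) simp
  finally show "mon4 a (Suc b) c (Suc d) = (\<Sum>s\<le>ll 2. scal (pcf 2 s) * mon4 a b (c + s) d)"
    unfolding Pval_def sum_distrib_left by (simp add: mon4_def power_add mult_ac)
qed

context
  fixes C :: "'k pcoeff set"
  assumes C: "csubring C" and pring_C: "pring \<subseteq> C"
begin

interpretation C: csubring C by (rule C)
interpretation cC: csubring "scal ` C" by (rule csubring_scal) (rule C)

lemma mon4_in_lincomb: "mon4 a b c d \<in> lincomb (scal ` C) std_mon"
\<comment> \<open>Both rewriting rules lower the joint exponent of x_0 and x_3 by one, while the
  exponents of x_1 and x_2 may grow.\<close>
proof (induction "a + d" arbitrary: a b c d)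
  case 0
  then show ?case using mon4_std_mon[of a c b d] cC.lincomb_base[of std_mon] by simp
next
  case (Suc n)
  have pc1: "scal (pcf 1 s) \<in> scal ` C" and pc2: "scal (pcf 2 s) \<in> scal ` C" for s
    using pring_C pcf_in_pring[of 1 s] pcf_in_pring[of 2 s] by blast+
  consider "a = 0 \<or> c = 0" "b = 0 \<or> d = 0" | a' c' where "a = Suc a'" "c = Suc c'"
    | b' d' where "b = Suc b'" "d = Suc d'"
    by (metis not0_implies_Suc)
  then show ?case
  proof cases
    case 1
    then show ?thesis using mon4_std_mon[of a c b d] cC.lincomb_base[of std_mon] by simp
  next
    case 2
    show ?thesis unfolding 2 mon4_reduce
      using Suc 2 pc1 by (intro cC.lincomb_sum cC.lincomb_scale) auto
  next
    case 3
    show ?thesis unfolding 3 mon4_reduce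
      using Suc 3 pc2 by (intro cC.lincomb_sum cC.lincomb_scale) auto
  qed
qed

text \<open>The span of the standard monomials is closed under products, because a product of two of
  them is again some \<open>mon4\<close>.\<close>

lemma lower_alg_eq_lincomb: "lower_alg C = lincomb (scal ` C) std_mon"
proof
  have m1: "mon4 0 0 0 0 = 1" "mon4 1 0 0 0 = nbr 1" "mon4 0 1 0 0 = xpow 1 1" "mon4 0 0 1 0 = xpow 2 1"
    "mon4 0 0 0 1 = nbr 2" by (simp_all add: mon4_def)
  have one: "1 \<in> lincomb (scal ` C) std_mon" using mon4_in_lincomb[of 0 0 0 0] m1 by simp
  show "lower_alg C \<subseteq> lincomb (scal ` C) std_mon"
    unfolding lower_alg_def
  proof (rule csubring.subring_gen_least)
    show "csubring (lincomb (scal ` C) std_mon)"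
    proof (rule cC.csubring_lincomb[OF one])
      fix a b show "std_mon a * std_mon b \<in> lincomb (scal ` C) std_mon"
        using std_mon_mon4[of a] std_mon_mon4[of b] mon4_in_lincomb mon4_mult by metis
    qed
    have "scal c \<in> lincomb (scal ` C) std_mon" if "c \<in> C" for c using cC.lincomb_scale[OF _ one, of "scal c"] that by simp
    moreover have "nbr i \<in> lincomb (scal ` C) std_mon \<and> xpow i 1 \<in> lincomb (scal ` C) std_mon" if "i = 1 \<or> i = 2" for i
      using that mon4_in_lincomb m1 by metis
    ultimately show "scal ` C \<union> {xpow i 1 |i. i = 1 \<or> i = 2} \<union> {nbr i |i. i = 1 \<or> i = 2} \<subseteq> lincomb (scal ` C) std_mon"
      by blast
  qed
  interpret A: csubring "lower_alg C" by simp
  have m4: "mon4 a b c d \<in> lower_alg C" for a b c d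
    unfolding mon4_def by (intro A.mult_closed A.power_closed lower_alg_gens) auto
  then have "std_mon a \<in> lower_alg C" for a using std_mon_mon4[of a] by metis
  then show "lincomb (scal ` C) std_mon \<subseteq> lower_alg C"
    unfolding lincomb_def using lower_alg_gens(3) by (auto intro!: A.sum_closed)
qed

end

lemma xpow_in_laurent_over: "csubring C \<Longrightarrow> xpow i k \<in> laurent_over C"
  unfolding xpow_def by (intro laurent_over_single csubring.zero_closed csubring.one_closed)

lemma scal_in_laurent_over: "csubring C \<Longrightarrow> c \<in> C \<Longrightarrow> scal c \<in> laurent_over C"
  unfolding scal_def by (intro laurent_over_single csubring.zero_closed)

lemma Pval_in_subring:
  assumes "csubring T" "\<And>c. c \<in> pring \<Longrightarrow> scal c \<in> T" "xpow i 1 \<in> T" "i = 1 \<or> i = 2"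
  shows "Pval i \<in> T"
proof -
  interpret T: csubring T by fact
  show ?thesis unfolding Pval_def using assms by (intro T.sum_closed T.mult_closed T.power_closed) auto
qed

lemma lower_alg_pring_laurent_over: "lower_alg pring \<subseteq> laurent_over pring"
  unfolding lower_alg_def
proof (rule csubring.subring_gen_least)
  show L: "csubring (laurent_over pring)" by (simp add: csubring_laurent_over)
  interpret L: csubring "laurent_over pring" by (rule L)
  have "nbr i \<in> laurent_over pring" if "i = 1 \<or> i = 2" for i
    unfolding nbr_def using that by (intro L.mult_closed xpow_in_laurent_over Pval_in_subring[OF L] scal_in_laurent_over) auto
  then show "scal ` pring \<union> {xpow i 1 |i. i = 1 \<or> i = 2} \<union> {nbr i |i. i = 1 \<or> i = 2} \<subseteq> laurent_over pring"
    by (auto intro: scal_in_laurent_over xpow_in_laurent_over)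
qed

lemma std_mon_in_lower_alg: "std_mon a \<in> lower_alg pring"
  unfolding lower_alg_eq_lincomb[OF csubring_pring order_refl]
  by (rule csubring.lincomb_base[OF csubring_scal[OF csubring_pring]])

text \<open>This is how denominators in the p_{i,j} disappear: the expansion of \<open>f\<close> in
  standard monomials exists over the large coefficient ring, and \<open>lincomb_coeffs_in\<close>
  forces its coefficients into \<open>pring\<close>.\<close>

lemma lower_alg_saturated:
  assumes "f \<in> lower_alg UNIV" "f \<in> laurent_over pring"
  shows "f \<in> lower_alg pring"
proof -
  have "f \<in> lincomb (scal ` UNIV) std_mon" using assms(1) lower_alg_eq_lincomb[OF csubring_UNIV] by simp
  then obtain S c where S: "finite S" and f: "f = (\<Sum>i\<in>S. scal (c i) * std_mon i)"
    by (rule lincomb_scal_cases) blast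
  have "\<forall>a\<in>S. c a \<in> pring"
    by (rule lincomb_coeffs_in[where g = std_mon])
      (use S f assms pointed_std_mon std_mon_in_lower_alg lower_alg_pring_laurent_over in auto)
  interpret A: csubring "lower_alg pring" by simp
  show ?thesis unfolding f using \<open>\<forall>a\<in>S. c a \<in> pring\<close> lower_alg_gens(3) std_mon_in_lower_alg by (intro A.sum_closed A.mult_closed) auto
qed

end

section \<open>Two half-plane rings and the intersection argument\<close>

context exchange
begin

text \<open>The ring R[x_i, x_i^{-1}, x_{3-i}]; the restriction on \<open>supp m\<close> excludes
  the further variables that the type provides.\<close>

definition half_laurent :: "nat \<Rightarrow> 'k laurent set" where
  "half_laurent i = {f \<in> laurent_over pring. \<forall>m\<in>supp f. supp m \<subseteq> {1, 2} \<and> 0 \<le> coef m (3 - i)}"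

lemma csubring_half_laurent: "csubring (half_laurent i)"
proof -
  interpret L: csubring "laurent_over pring" by (simp add: csubring_laurent_over)
  show ?thesis
  proof
    show "1 \<in> half_laurent i" by (simp add: half_laurent_def)
    fix f g assume fg: "f \<in> half_laurent i" "g \<in> half_laurent i"
    show "f - g \<in> half_laurent i" using fg keys_diff[of f g] by (auto simp: half_laurent_def)
    have "supp m \<subseteq> {1, 2} \<and> 0 \<le> coef m (3 - i)"
      if "m \<in> supp (f * g)" for m
    proof -
      obtain a b where m: "m = a + b" "a \<in> supp f" "b \<in> supp g"
        using keys_mult[of f g] \<open>m \<in> supp (f * g)\<close> by blast
      then show ?thesis using fg keys_add[of a b] by (auto simp: half_laurent_def lookup_add)
    qed
    then show "f * g \<in> half_laurent i" using fg by (auto simp: half_laurent_def)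
  qed
qed

lemma scal_in_half_laurent: "c \<in> pring \<Longrightarrow> scal c \<in> half_laurent i"
  using scal_in_laurent_over[of pring c] by (auto simp: half_laurent_def) (auto simp: scal_def split: if_splits)

lemma xpow_in_half_laurent: "i = 1 \<or> i = 2 \<Longrightarrow> j = 1 \<or> j = 2 \<Longrightarrow> j = i \<or> k \<ge> 0 \<Longrightarrow> xpow j k \<in> half_laurent i"
  using xpow_in_laurent_over[of pring j k] by (auto simp: half_laurent_def xpow_def lookup_single when_def)

lemma half_laurent_inter: "f \<in> half_laurent 1 \<Longrightarrow> f \<in> half_laurent 2 \<Longrightarrow> f \<in> lower_alg pring"
proof -
  assume f: "f \<in> half_laurent 1" "f \<in> half_laurent 2"
  interpret A: csubring "lower_alg pring" by simp
  have "sgl m (coef f m) \<in> lower_alg pring" if "m \<in> supp f" for m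
  proof -
    have m: "supp m \<subseteq> {1, 2}" "coef m 1 \<ge> 0" "coef m 2 \<ge> 0"
      using f that by (auto simp: half_laurent_def)
    let ?a = "coef m 1" and ?b = "coef m 2"
    have "m = sgl 1 ?a + sgl 2 ?b"
    proof (rule poly_mapping_eqI)
      fix k :: nat
      consider "k = 1" | "k = 2" | "k \<noteq> 1" "k \<noteq> 2" by blast
      then show "coef m k = coef (sgl 1 ?a + sgl 2 ?b) k"
      proof cases
        case 3
        then have "k \<notin> supp m" using m(1) by blast
        then show ?thesis using 3 by (simp add: lookup_add lookup_single in_keys_iff)
      qed (simp_all add: lookup_add lookup_single)
    qed
    then have "sgl m (coef f m)
        = scal (coef f m) * (sgl (sgl 1 ?a + sgl 2 ?b) 1)"
      by (simp add: scal_def mult_single)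
    also have "sgl (sgl 1 ?a + sgl 2 ?b) 1 = (xpow 1 ?a * xpow 2 ?b :: 'k laurent)"
      by (simp add: xpow_def mult_single)
    also have "xpow 1 ?a = (xpow 1 1 :: 'k laurent) ^ nat ?a" using m by (simp add: xpow_power)
    also have "xpow 2 ?b = (xpow 2 1 :: 'k laurent) ^ nat ?b" using m by (simp add: xpow_power)
    also have "scal (coef f m) * (xpow 1 1 ^ nat ?a * xpow 2 1 ^ nat ?b) \<in> lower_alg pring"
      using f by (intro A.mult_closed A.power_closed lower_alg_gens) (auto simp: half_laurent_def laurent_over_def)
    finally show ?thesis .
  qed
  then have "(\<Sum>m\<in>supp f. sgl m (coef f m)) \<in> lower_alg pring"
    by (rule A.sum_closed)
  then show ?thesis using poly_mapping_expand[of f] by simp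
qed

text \<open>
  This contains all monomials in x_i^{-1}, x_i, x_{3-i} and \<open>nbr i\<close>: powers of P_{3-i}(x_{3-i}), which
  is \<open>nbr (3 - i) * x_i\<close>, trade negative powers of x_i for powers of \<open>nbr (3 - i)\<close>.
\<close>

definition alg_plus_half :: "nat \<Rightarrow> 'k laurent set" where
  "alg_plus_half i = {g + h | g h. g \<in> lower_alg pring \<and> h \<in> half_laurent i}"

lemma alg_plus_half_add: "f \<in> alg_plus_half i \<Longrightarrow> g \<in> alg_plus_half i \<Longrightarrow> f + g \<in> alg_plus_half i"
proof -
  interpret A: csubring "lower_alg pring" by simp
  interpret M: csubring "half_laurent i" by (rule csubring_half_laurent)
  assume "f \<in> alg_plus_half i" "g \<in> alg_plus_half i"
  then obtain a b c d where "f = a + b" "g = c + d" "a \<in> lower_alg pring" "c \<in> lower_alg pring" "b \<in> half_laurent i" "d \<in> half_laurent i"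
    unfolding alg_plus_half_def by blast
  then have "f + g = (a + c) + (b + d)" "a + c \<in> lower_alg pring" "b + d \<in> half_laurent i" by auto
  then show ?thesis unfolding alg_plus_half_def by blast
qed

lemma alg_plus_half_scale: "f \<in> alg_plus_half i \<Longrightarrow> c \<in> pring \<Longrightarrow> scal c * f \<in> alg_plus_half i"
proof -
  interpret A: csubring "lower_alg pring" by simp
  interpret M: csubring "half_laurent i" by (rule csubring_half_laurent)
  assume "f \<in> alg_plus_half i" "c \<in> pring"
  then obtain a b where "f = a + b" "a \<in> lower_alg pring" "b \<in> half_laurent i"
    unfolding alg_plus_half_def by blast
  moreover have "scal c \<in> lower_alg pring" "scal c \<in> half_laurent i" using \<open>c \<in> pring\<close> by (simp_all add: lower_alg_gens scal_in_half_laurent)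
  ultimately have "scal c * f = scal c * a + scal c * b" "scal c * a \<in> lower_alg pring" "scal c * b \<in> half_laurent i"
    by (auto simp: algebra_simps)
  then show ?thesis unfolding alg_plus_half_def by blast
qed

lemma lower_alg_in_alg_plus_half: "f \<in> lower_alg pring \<Longrightarrow> f \<in> alg_plus_half i"
  unfolding alg_plus_half_def using csubring.zero_closed[OF csubring_half_laurent[of i]] by force

lemma half_laurent_in_alg_plus_half: "f \<in> half_laurent i \<Longrightarrow> f \<in> alg_plus_half i"
  unfolding alg_plus_half_def using csubring.zero_closed[OF csubring_lower_alg[of pring]] by force

lemma alg_plus_half_sum: "(\<And>x. x \<in> S \<Longrightarrow> f x \<in> alg_plus_half i) \<Longrightarrow> sum f S \<in> alg_plus_half i"
proof (induction S rule: infinite_finite_induct)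
  case (insert x F)
  then show ?case using alg_plus_half_add[of "f x" i "sum f F"] by simp
qed (auto intro: lower_alg_in_alg_plus_half csubring.zero_closed[OF csubring_lower_alg])

text \<open>The constant term 1 is what matters: it allows a monomial to be expressed by its product
  with a power of P_i(x_i) and by multiples of x_i.\<close>

lemma Pval_power_expand:
  assumes "i = 1 \<or> i = 2"
  obtains S q where "finite S" "\<And>j. j \<in> S \<Longrightarrow> q j \<in> pring"
    "Pval i ^ n = 1 + (\<Sum>j\<in>S. scal (q j) * xpow i 1 ^ Suc j)"
proof -
  let ?v = "xpow i 1 :: 'k laurent"
  interpret cR: csubring "scal ` pring" by (simp add: csubring_scal)
  interpret B: csubring "subring_gen (insert ?v (scal ` pring))" by simp
  define w where "w = (\<Sum>s<ll i. scal (pcf i (Suc s)) * ?v ^ s)"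
  have v: "?v \<in> subring_gen (insert ?v (scal ` pring))" by (auto intro: subring_gen.gen)
  have "scal c \<in> subring_gen (insert ?v (scal ` pring))" if "c \<in> pring" for c
    using that by (auto intro: subring_gen.gen)
  then have w: "w \<in> subring_gen (insert ?v (scal ` pring))"
    unfolding w_def using v assms by (intro B.sum_closed B.mult_closed B.power_closed) auto
  have "Pval i = (\<Sum>s<Suc (ll i). scal (pcf i s) * ?v ^ s)"
    unfolding Pval_def by (simp add: lessThan_Suc_atMost)
  also have "\<dots> = 1 + ?v * w"
    unfolding sum.lessThan_Suc_shift w_def sum_distrib_left by (simp add: mult_ac)
  finally have "Pval i = 1 + ?v * w" .
  then obtain w' where w': "w' \<in> subring_gen (insert ?v (scal ` pring))" "Pval i ^ n = 1 + ?v * w'"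
    using B.one_plus_mult_power[OF v w, of n] by auto
  then have "w' \<in> lincomb (scal ` pring) (\<lambda>j::nat. ?v ^ j)"
    using cR.subring_gen_insert_subset by blast
  then obtain S q where S: "finite S" "\<And>j. j \<in> S \<Longrightarrow> q j \<in> pring" "w' = (\<Sum>j\<in>S. scal (q j) * ?v ^ j)"
    by (rule lincomb_scal_cases) blast
  have "Pval i ^ n = 1 + (\<Sum>j\<in>S. scal (q j) * ?v ^ Suc j)"
    unfolding w'(2) S(3) sum_distrib_left
    by (intro arg_cong2[of _ _ _ _ "(+)"] sum.cong refl) (simp add: mult_ac)
  with S(1,2) show ?thesis by (rule that)
qed

text \<open>Induction on the exponent of \<open>nbr i\<close>. A factor x_{3-i} turns one
  \<open>nbr i\<close> into P_i(x_i). Without such a factor and with a < 0, the product of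
  \<open>nbr (3 - i) ^ nat (- a)\<close> and the power of \<open>nbr i\<close> lies in the algebra;
  expanding the power of P_{3-i}(x_{3-i}) in it gives the monomial in question plus multiples of
  x_{3-i}, which are covered already.\<close>

lemma monomial_in_alg_plus_half:
  assumes i: "i = 1 \<or> i = 2"
  shows "xpow i a * nbr i ^ b * xpow (3 - i) 1 ^ j \<in> alg_plus_half i"
proof (induction b arbitrary: a j)
  case 0
  interpret M: csubring "half_laurent i" by (rule csubring_half_laurent)
  have "xpow i a * xpow (3 - i) 1 ^ j \<in> half_laurent i"
    using i by (intro M.mult_closed M.power_closed xpow_in_half_laurent) auto
  then show ?case by (simp add: half_laurent_in_alg_plus_half)
next
  case (Suc b)
  have pos: "xpow i a * nbr i ^ Suc b * xpow (3 - i) 1 ^ Suc j \<in> alg_plus_half i" for a j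
  proof -
    have "xpow i a * nbr i ^ Suc b * xpow (3 - i) 1 ^ Suc j
      = (nbr i * xpow (3 - i) 1) * (xpow i a * nbr i ^ b * xpow (3 - i) 1 ^ j)" by (simp add: mult_ac)
    also have "\<dots> = (\<Sum>s\<le>ll i. scal (pcf i s) * (xpow i (int s + a) * nbr i ^ b * xpow (3 - i) 1 ^ j))"
      unfolding nbr_xpow[OF i] Pval_def sum_distrib_right by (simp add: xpow_power xpow_add mult_ac)
    also have "\<dots> \<in> alg_plus_half i" using i Suc by (intro alg_plus_half_sum alg_plus_half_scale) auto
    finally show ?thesis .
  qed
  show ?case
  proof (cases j)
    case (Suc j')
    then show ?thesis using pos by simp
  next
    case 0
    show ?thesis
    proof (cases "a \<ge> 0")
      case True
      interpret A: csubring "lower_alg pring" by simp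
      have i3: "3 - i = 1 \<or> 3 - i = 2" using i by auto
      have "xpow i a = xpow i 1 ^ nat a" using True by (simp add: xpow_power)
      then have "xpow i a * nbr i ^ Suc b * xpow (3 - i) 1 ^ j \<in> lower_alg pring"
        using i by (metis A.mult_closed A.power_closed lower_alg_gens(1,2) i3)
      then show ?thesis by (rule lower_alg_in_alg_plus_half)
    next
      case False
      define n where "n = nat (- a)"
      have i': "3 - i = 1 \<or> 3 - i = 2" "3 - (3 - i) = i" using i by auto
      obtain S q where S: "finite S" "\<And>j. j \<in> S \<Longrightarrow> q j \<in> pring"
        "Pval (3 - i) ^ n = 1 + (\<Sum>j\<in>S. scal (q j) * xpow (3 - i) 1 ^ Suc j)"
        by (rule Pval_power_expand[OF i'(1), of n]) blast
      interpret A: csubring "lower_alg pring" by simp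
      have "nbr (3 - i) ^ n * nbr i ^ Suc b \<in> lower_alg pring"
        using i i' by (intro A.mult_closed A.power_closed lower_alg_gens) auto
      moreover have "nbr (3 - i) ^ n * nbr i ^ Suc b = Pval (3 - i) ^ n * (xpow i a * nbr i ^ Suc b)"
        using False by (simp add: nbr_def[of "3 - i"] i' power_mult_distrib xpow_power n_def mult_ac)
      moreover have "\<dots> = xpow i a * nbr i ^ Suc b + (\<Sum>j\<in>S. scal (q j) * (xpow i a * nbr i ^ Suc b * xpow (3 - i) 1 ^ Suc j))"
        unfolding S(3) distrib_right sum_distrib_right by (simp add: mult_ac)
      ultimately have "xpow i a * nbr i ^ Suc b + (\<Sum>j\<in>S. scal (q j) * (xpow i a * nbr i ^ Suc b * xpow (3 - i) 1 ^ Suc j)) \<in> alg_plus_half i"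
        using lower_alg_in_alg_plus_half by metis
      moreover have "(\<Sum>j\<in>S. scal (- q j) * (xpow i a * nbr i ^ Suc b * xpow (3 - i) 1 ^ Suc j)) \<in> alg_plus_half i"
        using S(2) pos by (intro alg_plus_half_sum alg_plus_half_scale) auto
      ultimately have "(xpow i a * nbr i ^ Suc b + (\<Sum>j\<in>S. scal (q j) * (xpow i a * nbr i ^ Suc b * xpow (3 - i) 1 ^ Suc j)))
        + (\<Sum>j\<in>S. scal (- q j) * (xpow i a * nbr i ^ Suc b * xpow (3 - i) 1 ^ Suc j)) \<in> alg_plus_half i"
        by (rule alg_plus_half_add)
      moreover have "scal (- c) = - scal c" for c :: "'k pcoeff" using scal_diff[of 0 c] by simp
      ultimately show ?thesis using 0 by (simp add: sum_negf)
    qed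
  qed
qed

text \<open>For a_2 \<le> 0 the standard monomial involves x_1, x_2, x_3 only, none of which has x_2
  in a denominator; symmetrically for a_1 \<le> 0.\<close>

lemma std_mon_in_half_laurent:
  "snd a \<le> 0 \<Longrightarrow> std_mon a \<in> half_laurent 1" "fst a \<le> 0 \<Longrightarrow> std_mon a \<in> half_laurent 2"
proof -
  have nbM: "nbr (3 - i) \<in> half_laurent i" if i: "i = 1 \<or> i = 2" for i
  proof -
    interpret M: csubring "half_laurent i" by (rule csubring_half_laurent)
    have "3 - (3 - i) = i" using i by auto
    then show ?thesis unfolding nbr_def using i
      by (intro M.mult_closed Pval_in_subring[OF csubring_half_laurent] xpow_in_half_laurent scal_in_half_laurent) auto
  qed
  interpret M1: csubring "half_laurent 1" by (rule csubring_half_laurent)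
  interpret M2: csubring "half_laurent 2" by (rule csubring_half_laurent)
  have 1: "std_factor 1 b \<in> half_laurent 1" for b
    unfolding std_factor_def using M1.power_closed[OF nbM[of 1]] xpow_in_half_laurent[of 1 1 "- b"] by simp
  have 2: "std_factor 2 b \<in> half_laurent 2" for b
    unfolding std_factor_def using M2.power_closed[OF nbM[of 2]] xpow_in_half_laurent[of 2 2 "- b"] by simp
  have 3: "std_factor j b = xpow j (- b)" if "b \<le> 0" for j b using that by (auto simp: std_factor_def)
  show "std_mon a \<in> half_laurent 1" if "snd a \<le> 0"
    unfolding std_mon_def 3[OF that] using 1 that by (intro M1.mult_closed xpow_in_half_laurent) auto
  show "std_mon a \<in> half_laurent 2" if "fst a \<le> 0"
    unfolding std_mon_def 3[OF that] using 2 that by (intro M2.mult_closed xpow_in_half_laurent) auto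
qed

lemma half_laurent_lookup_neg_mon:
  "f \<in> half_laurent 1 \<Longrightarrow> snd a > 0 \<Longrightarrow> coef f (neg_mon a) = 0"
  "f \<in> half_laurent 2 \<Longrightarrow> fst a > 0 \<Longrightarrow> coef f (neg_mon a) = 0"
proof -
  show "coef f (neg_mon a) = 0" if "f \<in> half_laurent 1" "snd a > 0"
  proof (rule ccontr)
    assume "coef f (neg_mon a) \<noteq> 0"
    then have "coef (neg_mon a) (3 - 1) \<ge> 0" using that by (simp add: half_laurent_def in_keys_iff)
    then show False using lookup_neg_mon(2)[of a] that by simp
  qed
  show "coef f (neg_mon a) = 0" if "f \<in> half_laurent 2" "fst a > 0"
  proof (rule ccontr)
    assume "coef f (neg_mon a) \<noteq> 0"
    then have "coef (neg_mon a) (3 - 2) \<ge> 0" using that by (simp add: half_laurent_def in_keys_iff)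
    then show False using lookup_neg_mon(1)[of a] that by simp
  qed
qed

text \<open>For two representations \<open>g1 + h1\<close> and \<open>g2 + h2\<close> the difference
  of the half-plane parts is a combination of standard monomials. Those with a_2 \<le> 0 are moved
  to \<open>h1\<close>, those with a_2 > 0 and a_1 \<le> 0 to \<open>h2\<close>. In what remains
  both entries of the index are positive, so the lowest monomial of a member of maximal weight has
  two negative exponents and occurs in neither half plane. Hence nothing remains, and the corrected
  parts agree in R[x_1, x_2].\<close>

lemma alg_plus_half_inter:
  assumes "f \<in> alg_plus_half 1" "f \<in> alg_plus_half 2"
  shows "f \<in> lower_alg pring"
proof -
  interpret A: csubring "lower_alg pring" by simp
  interpret M1: csubring "half_laurent 1" by (rule csubring_half_laurent)
  interpret M2: csubring "half_laurent 2" by (rule csubring_half_laurent)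
  obtain g1 h1 where 1: "f = g1 + h1" "g1 \<in> lower_alg pring" "h1 \<in> half_laurent 1" using assms(1) by (auto simp: alg_plus_half_def)
  obtain g2 h2 where 2: "f = g2 + h2" "g2 \<in> lower_alg pring" "h2 \<in> half_laurent 2" using assms(2) by (auto simp: alg_plus_half_def)
  have "h1 - h2 = g2 - g1" using 1 2 by (simp add: algebra_simps)
  then have "h1 - h2 \<in> lincomb (scal ` pring) std_mon"
    using 1 2 lower_alg_eq_lincomb[OF csubring_pring order_refl] by auto
  then obtain S c where S: "finite S" "\<And>i. i \<in> S \<Longrightarrow> c i \<in> pring" and eq: "h1 - h2 = (\<Sum>i\<in>S. scal (c i) * std_mon i)"
    by (rule lincomb_scal_cases) blast
  define Q where "Q = {a \<in> S. snd a \<le> 0}"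
  define T where "T = {a \<in> S. snd a > 0 \<and> fst a \<le> 0}"
  define P where "P = {a \<in> S. snd a > 0 \<and> fst a > 0}"
  have split: "(\<Sum>i\<in>S. g i) = (\<Sum>i\<in>Q. g i) + ((\<Sum>i\<in>T. g i) + (\<Sum>i\<in>P. g i))"
    for g :: "int \<times> int \<Rightarrow> 'k laurent"
  proof -
    have "S = Q \<union> (T \<union> P)" "Q \<inter> (T \<union> P) = {}" "T \<inter> P = {}" "finite Q" "finite T" "finite P"
      using S(1) by (auto simp: Q_def T_def P_def)
    then show ?thesis by (simp add: sum.union_disjoint)
  qed
  define k1 where "k1 = h1 - (\<Sum>i\<in>Q. scal (c i) * std_mon i)"
  define k2 where "k2 = h2 + (\<Sum>i\<in>T. scal (c i) * std_mon i)"
  have k1: "k1 \<in> half_laurent 1" unfolding k1_def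
    using 1 S(2) by (intro M1.diff_closed M1.sum_closed M1.mult_closed scal_in_half_laurent std_mon_in_half_laurent) (auto simp: Q_def)
  have k2: "k2 \<in> half_laurent 2" unfolding k2_def
    using 2 S(2) by (intro M2.add_closed M2.sum_closed M2.mult_closed scal_in_half_laurent std_mon_in_half_laurent) (auto simp: T_def)
  have k12: "k1 - k2 = (\<Sum>i\<in>P. scal (c i) * std_mon i)"
    using eq unfolding split k1_def k2_def by (simp add: algebra_simps)
  have "c a = 0" if "a \<in> P" for a
  proof (rule ccontr)
    define P' where "P' = {a \<in> P. c a \<noteq> 0}"
    assume "c a \<noteq> 0"
    then have "a \<in> P'" "finite P'" using that S(1) by (auto simp: P'_def P_def)
    then have "P' \<noteq> {}" by blast
    with \<open>finite P'\<close> obtain b where b: "b \<in> P'" "\<And>b'. b' \<in> P' \<Longrightarrow> fst b' + snd b' \<le> fst b + snd b"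
      using ex_max_weight by metis
    have "(\<Sum>b\<in>P. scal (c b) * std_mon b) = (\<Sum>b\<in>P'. scal (c b) * std_mon b)"
      unfolding P'_def using S(1) by (intro sum.mono_neutral_right) (auto simp: P_def)
    moreover have "coef (\<Sum>b\<in>P'. scal (c b) * std_mon b) (neg_mon b) = c b"
      using b \<open>finite P'\<close> pointed_std_mon by (intro lookup_lincomb_lead) auto
    ultimately have "coef (k1 - k2) (neg_mon b) = c b" using k12 by simp
    moreover have "coef (k1 - k2) (neg_mon b) = 0"
      using half_laurent_lookup_neg_mon(1)[OF k1, of b] half_laurent_lookup_neg_mon(2)[OF k2, of b] b
      by (simp add: P'_def P_def lookup_minus)
    ultimately show False using b by (simp add: P'_def)
  qed
  then have "k1 = k2" using k12 by simp
  then have "k1 \<in> lower_alg pring" using half_laurent_inter k1 k2 by simp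
  moreover have "f = g1 + (k1 + (\<Sum>i\<in>Q. scal (c i) * std_mon i))" using 1 by (simp add: k1_def)
  moreover have "(\<Sum>i\<in>Q. scal (c i) * std_mon i) \<in> lower_alg pring"
    using S(2) by (intro A.sum_closed A.mult_closed lower_alg_gens std_mon_in_lower_alg) (auto simp: Q_def)
  ultimately show ?thesis using 1 by auto
qed

end

subsection \<open>Maximal Dyck paths\<close>

lemma count_list_East_North: "count_list w East + count_list w North = length w"
proof (induction w)
  case (Cons a w)
  then show ?case by (cases a) auto
qed simp

lemma dyck_path_length: "dyck_path m n w \<Longrightarrow> length w = m + n"
  using count_list_East_North[of w] by (simp add: dyck_path_def)

lemma list_eq_by_North_counts:
  assumes "length w = length w'"
    and "\<And>k. count_list (take k w) North = count_list (take k w') North"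
  shows "w = w'"
proof (rule nth_equalityI[OF assms(1)])
  fix i assume i: "i < length w"
  have "count_list (take (Suc i) v) North = count_list (take i v) North + (if v ! i = North then 1 else 0)"
    if "i < length v" for v using that by (simp add: take_Suc_conv_app_nth)
  from this[of w] this[of w'] have "(w ! i = North) = (w' ! i = North)"
    using i assms(1) assms(2)[of i] assms(2)[of "Suc i"] by (simp split: if_splits)
  then show "w ! i = w' ! i" by (cases "w ! i"; cases "w' ! i") auto
qed

text \<open>Staying below the diagonal means that at most \<open>h k\<close>, the floor of n k / (m
  + n), of the first k steps are north. These floors grow by 0 or 1 at a time, so one path attains
  all of them. It is the unique maximum, which makes the description in \<open>max_dyck_path\<close>
  meaningful.\<close>

lemma dyck_path_max_dyck_path: "dyck_path m n (max_dyck_path m n)"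
proof -
  define h where "h k = n * k div (m + n)" for k
  define w where "w = map (\<lambda>k. if h k < h (Suc k) then North else East) [0..<m + n]"
  have len: "length w = m + n" by (simp add: w_def)
  have h_Suc: "h k \<le> h (Suc k)" "h (Suc k) \<le> Suc (h k)" for k
  proof -
    show "h k \<le> h (Suc k)" by (auto simp: h_def intro: div_le_mono)
    show "h (Suc k) \<le> Suc (h k)"
    proof (cases "m + n = 0")
      case False
      have "n * Suc k div (m + n) \<le> (n * k + (m + n)) div (m + n)" by (intro div_le_mono) simp
      also have "\<dots> = Suc (h k)" using False by (simp add: h_def)
      finally show ?thesis by (simp add: h_def)
    qed (simp add: h_def)
  qed
  have cnt: "count_list (take k w) North = h k" if "k \<le> m + n" for k
    using that
  proof (induction k)
    case (Suc k)
    then have "w ! k = (if h k < h (Suc k) then North else East)" by (simp add: w_def)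
    then show ?case using Suc h_Suc[of k] by (auto simp: take_Suc_conv_app_nth len)
  qed (simp add: h_def)
  have hmn: "h (m + n) = n" by (cases "m + n = 0") (auto simp: h_def)
  have E: "count_list (take k w) East = k - h k" if "k \<le> m + n" for k
    using count_list_East_North[of "take k w"] cnt[OF that] that len by simp
  have bound: "count_list (take k v) North \<le> h k" if "dyck_path m n v" "k \<le> m + n" "m + n \<noteq> 0" for k v
  proof -
    let ?c = "count_list (take k v) North" and ?d = "count_list (take k v) East"
    have "?d + ?c = k" using count_list_East_North[of "take k v"] that dyck_path_length[OF that(1)] by simp
    moreover have "m * ?c \<le> n * ?d" using that dyck_path_length[OF that(1)] by (simp add: dyck_path_def)
    moreover have "(m + n) * ?c = m * ?c + n * ?c" by (rule distrib_right)
    moreover have "n * (?d + ?c) = n * ?d + n * ?c" by (rule distrib_left)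
    ultimately have "(m + n) * ?c \<le> n * k" by simp
    then show ?thesis unfolding h_def using that(3) by (simp add: less_eq_div_iff_mult_less_eq mult.commute)
  qed
  have dw: "dyck_path m n w"
    unfolding dyck_path_def
  proof (intro conjI allI impI)
    show "count_list w North = n" using cnt[of "m + n"] hmn len by simp
    show "count_list w East = m" using E[of "m + n"] hmn len by simp
    fix k assume k: "k \<le> length w"
    have "(m + n) * h k \<le> n * k" unfolding h_def by (rule times_div_less_eq_dividend)
    then have "m * h k \<le> n * k - n * h k" by (simp add: distrib_right)
    then show "m * count_list (take k w) North \<le> n * count_list (take k w) East"
      using k cnt[of k] E[of k] len by (simp add: diff_mult_distrib2)
  qed
  have mw: "count_list (take k v) North \<le> count_list (take k w) North" if v: "dyck_path m n v" for v k
  proof (cases "k \<le> m + n \<and> m + n \<noteq> 0")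
    case True
    then show ?thesis using bound[OF v] cnt by simp
  next
    case False
    then have "take k v = v" "take k w = w" using dyck_path_length[OF v] len by auto
    then show ?thesis using v dw by (simp add: dyck_path_def)
  qed
  have "dyck_path m n (max_dyck_path m n) \<and>
    (\<forall>w'. dyck_path m n w' \<longrightarrow> (\<forall>k. count_list (take k w') North \<le> count_list (take k (max_dyck_path m n)) North))"
    unfolding max_dyck_path_def
  proof (rule theI[of _ w])
    fix v assume v: "dyck_path m n v \<and> (\<forall>w'. dyck_path m n w' \<longrightarrow> (\<forall>k. count_list (take k w') North \<le> count_list (take k v) North))"
    show "v = w"
      using v dw mw dyck_path_length len by (intro list_eq_by_North_counts antisym) auto
  qed (use dw mw in auto)
  then show ?thesis by blast
qed

lemma horiz_vert_edges:
  "card (horiz_edges m n) = m" "card (vert_edges m n) = n"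
  "horiz_edges m n \<union> vert_edges m n = {..<m + n}" "horiz_edges m n \<inter> vert_edges m n = {}"
proof -
  let ?w = "max_dyck_path m n"
  have w: "dyck_path m n ?w" "length ?w = m + n"
    using dyck_path_max_dyck_path dyck_path_length by auto
  have "count_list ?w s = card {i. i < m + n \<and> ?w ! i = s}" for s
    using w(2) by (simp add: count_list_eq_length_filter length_filter_conv_card eq_commute)
  then show "card (horiz_edges m n) = m" "card (vert_edges m n) = n"
    using w by (simp_all add: horiz_edges_def vert_edges_def dyck_path_def)
  show "horiz_edges m n \<union> vert_edges m n = {..<m + n}"
    using step.exhaust by (auto simp: horiz_edges_def vert_edges_def)
  show "horiz_edges m n \<inter> vert_edges m n = {}" by (auto simp: horiz_edges_def vert_edges_def)
qed

subsection \<open>Compatible gradings on an arbitrary cyclic path\<close>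

text \<open>\<open>compatible\<close> for arbitrary sets of positions, so that reversal of the cycle
  applies without describing the reversed Dyck path.\<close>

definition compat :: "nat \<Rightarrow> nat set \<Rightarrow> nat set \<Rightarrow> (nat \<Rightarrow> nat) \<Rightarrow> bool" where
  "compat N H V \<omega> \<longleftrightarrow> (\<forall>u\<in>H. \<forall>v\<in>V. \<exists>e\<in>subpath N u v.
     (e \<noteq> v \<and> card (subpath N u e \<inter> V) = (\<Sum>h\<in>subpath N u e \<inter> H. \<omega> h)) \<or>
     (e \<noteq> u \<and> card (subpath N e v \<inter> H) = (\<Sum>h\<in>subpath N e v \<inter> V. \<omega> h)))"

lemma compatible_eq_compat: "compatible m n = compat (m + n) (horiz_edges m n) (vert_edges m n)"
  by (simp add: fun_eq_iff compatible_def compat_def)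

lemma subpath_prefix: "v' \<in> subpath N u v \<Longrightarrow> subpath N u v' \<subseteq> subpath N u v"
  by (auto simp: subpath_def split: if_splits)

lemma subpath_suffix: "e \<in> subpath N u v \<Longrightarrow> v < N \<Longrightarrow> subpath N e v \<subseteq> subpath N u v"
  by (auto simp: subpath_def split: if_splits)

lemma subpath_antisym: "v \<in> subpath N u v' \<Longrightarrow> v' \<in> subpath N u v \<Longrightarrow> v = v'"
  by (auto simp: subpath_def split: if_splits)

lemma subpath_bound: "u < N \<Longrightarrow> v < N \<Longrightarrow> subpath N u v \<subseteq> {..<N}"
  by (auto simp: subpath_def split: if_splits)

text \<open>Given the values on \<open>H\<close>, compatibility does not depend on the values on these edges.\<close>

definition free_edges :: "nat \<Rightarrow> nat set \<Rightarrow> nat set \<Rightarrow> (nat \<Rightarrow> nat) \<Rightarrow> nat set" where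
  "free_edges N H V \<alpha> = {v\<in>V. \<forall>u\<in>H. \<exists>e\<in>subpath N u v.
     e \<noteq> v \<and> card (subpath N u e \<inter> V) = (\<Sum>h\<in>subpath N u e \<inter> H. \<alpha> h)}"

lemma free_edges_cong: "(\<And>h. h \<in> H \<Longrightarrow> \<alpha> h = \<beta> h) \<Longrightarrow> free_edges N H V \<alpha> = free_edges N H V \<beta>"
proof -
  assume "\<And>h. h \<in> H \<Longrightarrow> \<alpha> h = \<beta> h"
  then have "(\<Sum>h\<in>X \<inter> H. \<alpha> h) = (\<Sum>h\<in>X \<inter> H. \<beta> h)" for X by (intro sum.cong) auto
  then show ?thesis by (simp add: free_edges_def)
qed

text \<open>If the subpath from \<open>u\<close> to \<open>v\<close> contains a free edge
  \<open>v'\<close>, the edge that makes \<open>v'\<close> free precedes it and works for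
  \<open>v\<close> too, and it refers to values on \<open>H\<close> only. If there are no free edges
  on the subpath, both gradings have the same sums there.\<close>

lemma compat_cong_free:
  assumes H: "\<And>h. h \<in> H \<Longrightarrow> \<alpha> h = \<beta> h" and V: "\<And>v. v \<in> V - free_edges N H V \<alpha> \<Longrightarrow> \<alpha> v = \<beta> v"
    and VN: "V \<subseteq> {..<N}" and c: "compat N H V \<alpha>"
  shows "compat N H V \<beta>"
  unfolding compat_def
proof (intro ballI)
  fix u v assume u: "u \<in> H" and v: "v \<in> V"
  have sumH: "(\<Sum>h\<in>X \<inter> H. \<alpha> h) = (\<Sum>h\<in>X \<inter> H. \<beta> h)" for X using H by (intro sum.cong) auto
  show "\<exists>e\<in>subpath N u v.
     (e \<noteq> v \<and> card (subpath N u e \<inter> V) = (\<Sum>h\<in>subpath N u e \<inter> H. \<beta> h)) \<or>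
     (e \<noteq> u \<and> card (subpath N e v \<inter> H) = (\<Sum>h\<in>subpath N e v \<inter> V. \<beta> h))"
  proof (cases "subpath N u v \<inter> free_edges N H V \<alpha> = {}")
    case True
    obtain e where e: "e \<in> subpath N u v"
      "(e \<noteq> v \<and> card (subpath N u e \<inter> V) = (\<Sum>h\<in>subpath N u e \<inter> H. \<alpha> h)) \<or>
       (e \<noteq> u \<and> card (subpath N e v \<inter> H) = (\<Sum>h\<in>subpath N e v \<inter> V. \<alpha> h))"
      using c u v unfolding compat_def by blast
    have "(\<Sum>h\<in>subpath N e v \<inter> V. \<alpha> h) = (\<Sum>h\<in>subpath N e v \<inter> V. \<beta> h)"
      using subpath_suffix[OF e(1)] True v VN by (intro sum.cong V) auto
    then show ?thesis using e sumH by auto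
  next
    case False
    then obtain v' where v': "v' \<in> subpath N u v" "v' \<in> free_edges N H V \<alpha>" by blast
    then obtain e where e: "e \<in> subpath N u v'" "e \<noteq> v'"
      "card (subpath N u e \<inter> V) = (\<Sum>h\<in>subpath N u e \<inter> H. \<alpha> h)"
      using u unfolding free_edges_def by blast
    have "e \<in> subpath N u v" using e(1) subpath_prefix[OF v'(1)] by blast
    moreover have "e \<noteq> v" using subpath_antisym[of v N u v'] e v' by blast
    ultimately show ?thesis using e sumH by auto
  qed
qed

text \<open>Unrolls the cycle: subpaths become intervals of at most \<open>N\<close> consecutive
  integers, on which heights of a walk can be compared.\<close>

lemma bij_betw_mod_subpath:
  fixes N :: nat
  assumes "s \<le> e" "e < s + N"
  shows "bij_betw (\<lambda>i. i mod N) {s..e} (subpath N (s mod N) (e mod N))"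
proof -
  have N: "N > 0" using assms by linarith
  have inj: "inj_on (\<lambda>i. i mod N) {s..e}"
  proof (rule inj_onI)
    fix x y assume xy: "x \<in> {s..e}" "y \<in> {s..e}" "x mod N = y mod N"
    have *: "a = b" if "a \<le> b" "b - a < N" "a mod N = b mod N" for a b :: nat
    proof -
      have "N dvd b - a" using mod_eq_dvd_iff_nat[of a b N] that by simp
      then have "b - a = 0" using that(2) by (metis dvd_imp_le leD neq0_conv)
      then show ?thesis using that(1) by simp
    qed
    show "x = y"
    proof (cases "x \<le> y")
      case True
      show ?thesis by (rule *) (use True xy assms in auto)
    next
      case False
      have "y = x" by (rule *) (use False xy assms in auto)
      then show ?thesis ..
    qed
  qed
  define q where "q = s div N"
  define a where "a = s mod N"
  define d where "d = e - s"
  have s: "s = q * N + a" "a < N" using N by (simp_all add: q_def a_def)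
  have e: "e = q * N + a + d" "d < N" using assms s by (auto simp: d_def)
  have img: "(\<lambda>i. i mod N) ` {s..e} = subpath N a (e mod N)"
  proof (cases "a + d < N")
    case True
    have "(\<lambda>i. i mod N) ` {s..e} = {a..a + d}"
    proof (intro equalityI subsetI)
      fix x assume "x \<in> (\<lambda>i. i mod N) ` {s..e}"
      then obtain i where i: "i \<in> {s..e}" "x = i mod N" by blast
      then have "i = q * N + (i - q * N)" "i - q * N < N" using s e True by auto
      then have "x = i - q * N" using i(2) by (metis mod_less mod_mult_self3)
      then show "x \<in> {a..a + d}" using i s e by auto
    next
      fix x assume x: "x \<in> {a..a + d}"
      show "x \<in> (\<lambda>i. i mod N) ` {s..e}"
        by (rule image_eqI[of _ _ "q * N + x"]) (use x s e True in auto)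
    qed
    moreover have "e mod N = a + d" using True by (simp add: e add.assoc)
    ultimately show ?thesis by (simp add: subpath_def)
  next
    case False
    have em: "e mod N = a + d - N"
    proof -
      have "e = (q + 1) * N + (a + d - N)" using False by (simp add: e)
      then have "e mod N = (a + d - N) mod N" by (simp only: mod_mult_self3)
      then show ?thesis using s e by simp
    qed
    have "(\<lambda>i. i mod N) ` {s..e} = {a..<N} \<union> {..a + d - N}"
    proof (intro equalityI subsetI)
      fix x assume "x \<in> (\<lambda>i. i mod N) ` {s..e}"
      then obtain i where i: "i \<in> {s..e}" "x = i mod N" by blast
      show "x \<in> {a..<N} \<union> {..a + d - N}"
      proof (cases "i < q * N + N")
        case True
        then have "i = q * N + (i - q * N)" "i - q * N < N" using i s by auto
        then have "x = i - q * N" using i(2) by (metis mod_less mod_mult_self3)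
        then show ?thesis using i s e True by auto
      next
        case False
        then have "i = (q + 1) * N + (i - (q + 1) * N)" "i - (q + 1) * N < N" using i s e by auto
        then have "x = i - (q + 1) * N" using i(2) by (metis mod_less mod_mult_self3)
        then show ?thesis using i s e False by auto
      qed
    next
      fix x assume "x \<in> {a..<N} \<union> {..a + d - N}"
      then consider "x \<in> {a..<N}" | "x \<le> a + d - N" by auto
      then show "x \<in> (\<lambda>i. i mod N) ` {s..e}"
      proof cases
        case 1
        show ?thesis by (rule image_eqI[of _ _ "q * N + x"]) (use 1 s e False in auto)
      next
        case 2
        have "x < N" using 2 s e by auto
        then have "x = ((q + 1) * N + x) mod N" by (simp only: mod_mult_self3 mod_less)
        then show ?thesis
          by (rule image_eqI[of _ _ "(q + 1) * N + x"]) (use 2 s e False in auto)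
      qed
    qed
    moreover have "\<not> a \<le> a + d - N" using False e by linarith
    ultimately show ?thesis by (simp add: subpath_def em)
  qed
  show ?thesis unfolding bij_betw_def using inj img by (simp add: a_def)
qed

text \<open>
  The height function of the infinite periodic walk that goes up by \<open>\<alpha> h\<close> at \<open>h \<in> H\<close> and down
  by 1 at \<open>v \<in> V\<close>. The edges at which it first reaches a new minimum are free.
\<close>

lemma card_free_edges:
  assumes part: "H \<union> V = {..<N}" "H \<inter> V = {}"
  shows "card V \<le> card (free_edges N H V \<alpha>) + (\<Sum>h\<in>H. \<alpha> h)"
proof (cases "card V \<le> (\<Sum>h\<in>H. \<alpha> h)")
  case False
  have fin: "finite H" "finite V" using part by (metis finite_Un finite_lessThan)+
  have N: "N > 0" using False part by (cases "N = 0") auto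
  define f where "f i = (if i \<in> H then int (\<alpha> i) else - 1)" for i
  define S where "S t = (\<Sum>i<t. f (i mod N))" for t
  \<comment> \<open>The net descent over one period; this many free edges are to be found.\<close>
  define D where "D = card V - (\<Sum>h\<in>H. \<alpha> h)"
  have sumf: "(\<Sum>i\<in>X. f i) = int (\<Sum>h\<in>X \<inter> H. \<alpha> h) - int (card (X \<inter> V))" if "X \<subseteq> {..<N}" for X
  proof -
    have X: "X = (X \<inter> H) \<union> (X \<inter> V)" using that part by auto
    have "(\<Sum>i\<in>X. f i) = (\<Sum>i\<in>X \<inter> H. f i) + (\<Sum>i\<in>X \<inter> V. f i)"
      using part fin by (subst X, intro sum.union_disjoint) auto
    also have "(\<Sum>i\<in>X \<inter> H. f i) = (\<Sum>i\<in>X \<inter> H. int (\<alpha> i))" by (intro sum.cong) (auto simp: f_def)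
    also have "(\<Sum>i\<in>X \<inter> V. f i) = (\<Sum>i\<in>X \<inter> V. - 1)" using part by (intro sum.cong) (auto simp: f_def)
    finally show ?thesis by simp
  qed
  have S_diff: "S (Suc e) - S s = (\<Sum>i\<in>{s..e}. f (i mod N))" if "s \<le> e" for s e
  proof -
    have "{..<Suc e} = {..<s} \<union> {s..e}" using that by auto
    then have "S (Suc e) = (\<Sum>i\<in>{..<s} \<union> {s..e}. f (i mod N))" by (simp only: S_def)
    also have "\<dots> = S s + (\<Sum>i\<in>{s..e}. f (i mod N))" unfolding S_def by (intro sum.union_disjoint) auto
    finally show ?thesis by simp
  qed
  have S_path: "S (Suc e) - S s = int (\<Sum>h\<in>subpath N (s mod N) (e mod N) \<inter> H. \<alpha> h)
      - int (card (subpath N (s mod N) (e mod N) \<inter> V))" if "s \<le> e" "e < s + N" for s e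
  proof -
    have "(\<Sum>i\<in>{s..e}. f (i mod N)) = (\<Sum>i\<in>subpath N (s mod N) (e mod N). f i)"
      by (rule sum.reindex_bij_betw[OF bij_betw_mod_subpath[OF that]])
    then show ?thesis using S_diff[OF that(1)] sumf[OF subpath_bound] N by simp
  qed
  have S_period: "S (t + N) = S t - int D" for t
  proof (induction t)
    case 0
    have "S N = (\<Sum>i<N. f i)" unfolding S_def by (intro sum.cong) auto
    also have "\<dots> = int (\<Sum>h\<in>H. \<alpha> h) - int (card V)"
    proof -
      have "{..<N} \<inter> H = H" "{..<N} \<inter> V = V" using part by auto
      then show ?thesis using sumf[of "{..<N}"] by simp
    qed
    finally show ?case using False by (simp add: D_def S_def of_nat_diff)
  next
    case (Suc t)
    then show ?case by (simp add: S_def)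
  qed
  have S_Suc: "S (Suc t) = S t + f (t mod N)" for t by (simp add: S_def)
  have S_step: "S (Suc t) \<ge> S t - 1" for t by (simp add: S_Suc f_def)
  define M where "M = Min (S ` {..<N})"
  have "M \<in> S ` {..<N}" unfolding M_def using N by (intro Min_in) auto
  then obtain t0 where t0: "t0 < N" "S t0 = M" by auto
  have M_le: "M \<le> S t" if "t < N" for t unfolding M_def using that by (intro Min_le) auto
  \<comment> \<open>First time at depth \<open>j\<close> below the minimum \<open>M\<close> of the
    first period. Time \<open>t0 + N\<close> is deep enough, so this happens in the second period.
    The edge just before, at position \<open>\<tau> j - 1\<close>, goes down.\<close>
  define \<tau> where "\<tau> j = (LEAST t. S t \<le> M - int j)" for j :: nat
  have \<tau>: "S (\<tau> j) \<le> M - int j" "\<And>t. t < \<tau> j \<Longrightarrow> S t > M - int j" "\<tau> j < 2 * N" "\<tau> j \<ge> N"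
    if j: "j \<in> {1..D}" for j
  proof -
    have ex: "S (t0 + N) \<le> M - int j" using S_period[of t0] t0 j by simp
    then show *: "S (\<tau> j) \<le> M - int j" unfolding \<tau>_def by (rule LeastI)
    show "S t > M - int j" if "t < \<tau> j" for t
      using not_less_Least[of t "\<lambda>t. S t \<le> M - int j"] that unfolding \<tau>_def by simp
    have "\<tau> j \<le> t0 + N" unfolding \<tau>_def using ex by (rule Least_le)
    then show "\<tau> j < 2 * N" using t0 by simp
    show "\<tau> j \<ge> N" using * M_le[of "\<tau> j"] j by (rule_tac ccontr) simp
  qed
  have Spred: "S (\<tau> j - 1) = M - int j + 1" "(\<tau> j - 1) mod N \<in> V" "S (\<tau> j) = M - int j"
    if j: "j \<in> {1..D}" for j
  proof -
    have pos: "\<tau> j > 0" using \<tau>(4)[OF j] N by simp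
    then have eq: "S (\<tau> j) = S (\<tau> j - 1) + f ((\<tau> j - 1) mod N)" using S_Suc[of "\<tau> j - 1"] by simp
    have gt: "S (\<tau> j - 1) > M - int j" using \<tau>(2)[OF j, of "\<tau> j - 1"] pos by simp
    then have neg: "f ((\<tau> j - 1) mod N) < 0" using eq \<tau>(1)[OF j] by simp
    then have "(\<tau> j - 1) mod N \<notin> H" by (auto simp: f_def)
    moreover have "(\<tau> j - 1) mod N \<in> {..<N}" using N by simp
    ultimately show "(\<tau> j - 1) mod N \<in> V" unfolding part(1)[symmetric] by blast
    from neg have "f ((\<tau> j - 1) mod N) = - 1" by (simp add: f_def split: if_splits)
    then show "S (\<tau> j - 1) = M - int j + 1" "S (\<tau> j) = M - int j" using eq gt \<tau>(1)[OF j] by auto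
  qed
  have "(\<tau> j - 1) mod N \<in> free_edges N H V \<alpha>" if j: "j \<in> {1..D}" for j
    unfolding free_edges_def
  proof (intro CollectI conjI ballI Spred(2)[OF j])
    fix u assume u: "u \<in> H"
    have uN: "u < N" using u part by auto
    define p where "p = \<tau> j - 1"
    \<comment> \<open>The last occurrence of \<open>u\<close> before position \<open>p\<close> on
      the unrolled path; it may lie in the preceding period.\<close>
    define s where "s = (if u \<le> p mod N then p div N * N + u else (p div N - 1) * N + u)"
    have pN: "p mod N < N" "p = p div N * N + p mod N" using N by simp_all
    have neq: "u \<noteq> p mod N" using u Spred(2)[OF j] part by (auto simp: p_def)
    have pge: "p div N \<ge> 1" if "\<not> u \<le> p mod N"
    proof -
      have "p \<ge> N - 1" using \<tau>(4)[OF j] by (simp add: p_def)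
      show ?thesis
      proof (rule ccontr)
        assume "\<not> p div N \<ge> 1"
        then have "p div N = 0" by simp
        then have "p < N" using N by (simp add: div_eq_0_iff)
        then have "p mod N = p" by simp
        then show False using \<open>p \<ge> N - 1\<close> that uN by simp
      qed
    qed
    have s: "s mod N = u" "s < p" "p < s + N"
    proof -
      show "s mod N = u" using uN by (simp add: s_def)
      have "s < p \<and> p < s + N"
      proof (cases "u \<le> p mod N")
        case True
        then have "s = p div N * N + u" by (simp add: s_def)
        moreover have "u < p mod N" using True neq by simp
        ultimately show ?thesis using pN by linarith
      next
        case False
        then obtain k where k: "p div N = Suc k" using pge by (metis Suc_le_D One_nat_def)
        then have "s = k * N + u" "p = k * N + N + p mod N" using False pN by (simp_all add: s_def)
        then show ?thesis using pN False uN by linarith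
      qed
      then show "s < p" "p < s + N" by auto
    qed
    have "s < \<tau> j" using s by (simp add: p_def)
    then have Ss: "S s \<ge> S p"
      using \<tau>(2)[OF j, of s] s Spred(1)[OF j] by (simp add: p_def)
    \<comment> \<open>The walk is at least as high at \<open>s\<close> as at \<open>p\<close>,
      because \<open>\<tau> j\<close> is a first passage. So it returns to the height
      \<open>S s\<close> by time \<open>p\<close>, and exactly, since it falls by at most 1 per step
      and does not fall at \<open>u\<close>. The edge before the first return is the required
      witness.\<close>
    define t where "t = (LEAST t. s < t \<and> S t \<le> S s)"
    have t: "s < t" "S t \<le> S s" "t \<le> p"
      using LeastI[of "\<lambda>t. s < t \<and> S t \<le> S s" p] Least_le[of "\<lambda>t. s < t \<and> S t \<le> S s" p] s Ss
      by (auto simp: t_def)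
    have "S t = S s"
    proof (cases "t = Suc s")
      case True
      then show ?thesis using t S_Suc[of s] s u by (simp add: f_def)
    next
      case False
      then have "\<not> (s < t - 1 \<and> S (t - 1) \<le> S s)" using not_less_Least[of "t - 1" "\<lambda>t. s < t \<and> S t \<le> S s"] t
        by (simp add: t_def[symmetric])
      then have "S (t - 1) > S s" using False t by auto
      then show ?thesis using S_step[of "t - 1"] t by simp
    qed
    then have 0: "S (Suc (t - 1)) - S s = 0" using t by simp
    let ?e = "(t - 1) mod N"
    have path: "card (subpath N u ?e \<inter> V) = (\<Sum>h\<in>subpath N u ?e \<inter> H. \<alpha> h)"
    proof -
      have "s \<le> t - 1" "t - 1 < s + N" using t s by auto
      from S_path[OF this] show ?thesis using 0 unfolding s(1) by linarith
    qed
    have inj: "inj_on (\<lambda>i. i mod N) {s..p}" "(\<lambda>i. i mod N) ` {s..p} = subpath N u (p mod N)"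
      using bij_betw_mod_subpath[of s p N] s by (auto simp: bij_betw_def)
    have "?e \<in> subpath N u (p mod N)" unfolding inj(2)[symmetric] using t s by (intro imageI) auto
    moreover have "?e \<noteq> p mod N"
    proof
      assume eq: "?e = p mod N"
      have "t - 1 = p" by (rule inj_onD[OF inj(1) eq]) (use t s in auto)
      then show False using t s by linarith
    qed
    ultimately show "\<exists>e\<in>subpath N u ((\<tau> j - 1) mod N). e \<noteq> (\<tau> j - 1) mod N
        \<and> card (subpath N u e \<inter> V) = (\<Sum>h\<in>subpath N u e \<inter> H. \<alpha> h)"
      using path unfolding p_def by blast
  qed
  then have sub: "(\<lambda>j. (\<tau> j - 1) mod N) ` {1..D} \<subseteq> free_edges N H V \<alpha>" by blast
  have inj: "inj_on (\<lambda>j. (\<tau> j - 1) mod N) {1..D}"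
  proof (rule inj_onI)
    fix j k assume jk: "j \<in> {1..D}" "k \<in> {1..D}" "(\<tau> j - 1) mod N = (\<tau> k - 1) mod N"
    \<comment> \<open>All positions \<open>\<tau> j - 1\<close> lie in this window of
      \<open>N\<close> integers, so equal residues mean equal positions.\<close>
    have "inj_on (\<lambda>i. i mod N) {N - 1..2 * N - 2}"
      using bij_betw_mod_subpath[of "N - 1" "2 * N - 2" N] N by (auto simp: bij_betw_def)
    then have "\<tau> j - 1 = \<tau> k - 1"
      using jk \<tau>(3,4)[OF jk(1)] \<tau>(3,4)[OF jk(2)] by (elim inj_onD) auto
    then have "S (\<tau> j - 1) = S (\<tau> k - 1)" by simp
    then show "j = k" using Spred(1)[OF jk(1)] Spred(1)[OF jk(2)] by simp
  qed
  have "finite (free_edges N H V \<alpha>)" using fin by (auto simp: free_edges_def)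
  then have "D \<le> card (free_edges N H V \<alpha>)" using card_mono[OF _ sub] card_image[OF inj] by simp
  then show ?thesis by (simp add: D_def)
qed simp

lemma subpath_reverse:
  assumes "e < N" "f < N"
  shows "subpath N (N - 1 - f) (N - 1 - e) = (\<lambda>i. N - 1 - i) ` subpath N e f"
proof -
  have inv: "x \<in> (\<lambda>i. N - 1 - i) ` X \<longleftrightarrow> N - 1 - x \<in> X" if "X \<subseteq> {..<N}" "x < N" for x X
    using that by (force intro: image_eqI[of _ _ "N - 1 - x"])
  show ?thesis
  proof (rule set_eqI)
    fix x
    show "x \<in> subpath N (N - 1 - f) (N - 1 - e) \<longleftrightarrow> x \<in> (\<lambda>i. N - 1 - i) ` subpath N e f"
    proof (cases "x < N")
      case True
      show ?thesis unfolding inv[OF subpath_bound[OF assms] True]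
        using assms True by (auto simp: subpath_def)
    next
      case False
      then show ?thesis using assms subpath_bound[OF assms] subpath_bound[of "N - 1 - f" N "N - 1 - e"] by fastforce
    qed
  qed
qed

text \<open>Reversal with \<open>H\<close> and \<open>V\<close> exchanged swaps the two alternatives
  in the definition, so what is proved by summing over free vertical edges also serves horizontal
  ones.\<close>

lemma compat_reverse:
  assumes HN: "H \<subseteq> {..<N}" and VN: "V \<subseteq> {..<N}"
  defines "r \<equiv> \<lambda>i. N - 1 - i"
  shows "compat N (r ` V) (r ` H) (\<lambda>i. \<omega> (r i)) \<longleftrightarrow> compat N H V \<omega>"
proof -
  have inj: "inj_on r {..<N}" by (auto simp: r_def inj_on_def)
  have rr: "r (r i) = i" if "i < N" for i using that by (auto simp: r_def)
  have req: "r i = r j \<longleftrightarrow> i = j" if "i < N" "j < N" for i j using that inj by (auto simp: inj_on_def)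
  have rs: "subpath N (r f) (r e) = r ` subpath N e f" if "e < N" "f < N" for e f
    unfolding r_def by (rule subpath_reverse[OF that])
  have int: "r ` A \<inter> r ` B = r ` (A \<inter> B)" if "A \<subseteq> {..<N}" "B \<subseteq> {..<N}" for A B
    using inj_on_image_Int[OF inj that] by simp
  have crd: "card (r ` A) = card A" if "A \<subseteq> {..<N}" for A
    using inj_on_subset[OF inj that] by (rule card_image)
  have sm: "(\<Sum>h\<in>r ` A. \<omega> (r h)) = (\<Sum>h\<in>A. \<omega> h)" if "A \<subseteq> {..<N}" for A
    using inj_on_subset[OF inj that] that by (subst sum.reindex) (auto intro!: sum.cong simp: rr subset_iff)
  have *: "(\<exists>e\<in>subpath N (r v) (r u).
       (e \<noteq> r u \<and> card (subpath N (r v) e \<inter> r ` H) = (\<Sum>h\<in>subpath N (r v) e \<inter> r ` V. \<omega> (r h))) \<or>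
       (e \<noteq> r v \<and> card (subpath N e (r u) \<inter> r ` V) = (\<Sum>h\<in>subpath N e (r u) \<inter> r ` H. \<omega> (r h)))) \<longleftrightarrow>
    (\<exists>e\<in>subpath N u v.
       (e \<noteq> v \<and> card (subpath N u e \<inter> V) = (\<Sum>h\<in>subpath N u e \<inter> H. \<omega> h)) \<or>
       (e \<noteq> u \<and> card (subpath N e v \<inter> H) = (\<Sum>h\<in>subpath N e v \<inter> V. \<omega> h)))"
    if "u \<in> H" "v \<in> V" for u v
  proof -
    have uv: "u < N" "v < N" using that HN VN by auto
    have e: "(r e \<noteq> r u \<and> card (subpath N (r v) (r e) \<inter> r ` H) = (\<Sum>h\<in>subpath N (r v) (r e) \<inter> r ` V. \<omega> (r h))) \<or>
       (r e \<noteq> r v \<and> card (subpath N (r e) (r u) \<inter> r ` V) = (\<Sum>h\<in>subpath N (r e) (r u) \<inter> r ` H. \<omega> (r h))) \<longleftrightarrow>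
       (e \<noteq> v \<and> card (subpath N u e \<inter> V) = (\<Sum>h\<in>subpath N u e \<inter> H. \<omega> h)) \<or>
       (e \<noteq> u \<and> card (subpath N e v \<inter> H) = (\<Sum>h\<in>subpath N e v \<inter> V. \<omega> h))"
      if "e \<in> subpath N u v" for e
    proof -
      have eN: "e < N" using that subpath_bound[OF uv] by auto
      have sb: "subpath N e v \<inter> X \<subseteq> {..<N}" "subpath N u e \<inter> X \<subseteq> {..<N}" for X
        using subpath_bound eN uv by blast+
      show ?thesis
        unfolding rs[OF eN uv(2)] rs[OF uv(1) eN] req[OF eN uv(1)] req[OF eN uv(2)]
          int[OF subpath_bound[OF eN uv(2)] HN] int[OF subpath_bound[OF eN uv(2)] VN]
          int[OF subpath_bound[OF uv(1) eN] HN] int[OF subpath_bound[OF uv(1) eN] VN]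
          crd[OF sb(1)] crd[OF sb(2)] sm[OF sb(1)] sm[OF sb(2)]
        by blast
    qed
    show ?thesis unfolding rs[OF uv] bex_simps using e by (intro bex_cong refl) auto
  qed
  show ?thesis unfolding compat_def ball_simps using * by blast
qed

section \<open>Weighted sums over compatible gradings\<close>

definition merge :: "nat set \<Rightarrow> (nat \<Rightarrow> nat) \<Rightarrow> (nat \<Rightarrow> nat) \<Rightarrow> nat \<Rightarrow> nat" where
  "merge A \<alpha> \<beta> i = (if i \<in> A then \<alpha> i else \<beta> i)"

lemma sum_PiE_Un:
  assumes "A \<inter> B = {}"
  shows "(\<Sum>\<omega>\<in>PiE (A \<union> B) S. F \<omega>) = (\<Sum>\<alpha>\<in>PiE A S. \<Sum>\<beta>\<in>PiE B S. F (merge A \<alpha> \<beta>))"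
proof -
  have "bij_betw (\<lambda>(\<alpha>, \<beta>). merge A \<alpha> \<beta>) (PiE A S \<times> PiE B S) (PiE (A \<union> B) S)"
  proof (rule bij_betwI[where g = "\<lambda>\<omega>. (restrict \<omega> A, restrict \<omega> B)"])
    show "(\<lambda>(\<alpha>, \<beta>). merge A \<alpha> \<beta>) \<in> PiE A S \<times> PiE B S \<rightarrow> PiE (A \<union> B) S"
      by (auto simp: merge_def PiE_iff extensional_def)
    show "(\<lambda>\<omega>. (restrict \<omega> A, restrict \<omega> B)) \<in> PiE (A \<union> B) S \<rightarrow> PiE A S \<times> PiE B S" by auto
    show "(\<lambda>\<omega>. (restrict \<omega> A, restrict \<omega> B)) ((\<lambda>(\<alpha>, \<beta>). merge A \<alpha> \<beta>) x) = x" if "x \<in> PiE A S \<times> PiE B S" for x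
      using that assms by (auto simp: merge_def fun_eq_iff restrict_def PiE_iff extensional_def)
    show "(\<lambda>(\<alpha>, \<beta>). merge A \<alpha> \<beta>) ((\<lambda>\<omega>. (restrict \<omega> A, restrict \<omega> B)) y) = y" if "y \<in> PiE (A \<union> B) S" for y
      using that by (auto simp: merge_def fun_eq_iff restrict_def PiE_iff extensional_def)
  qed
  then have "(\<Sum>\<omega>\<in>PiE (A \<union> B) S. F \<omega>) = (\<Sum>x\<in>PiE A S \<times> PiE B S. F ((\<lambda>(\<alpha>, \<beta>). merge A \<alpha> \<beta>) x))"
    by (rule sum.reindex_bij_betw[symmetric])
  also have "\<dots> = (\<Sum>\<alpha>\<in>PiE A S. \<Sum>\<beta>\<in>PiE B S. F (merge A \<alpha> \<beta>))"
    unfolding sum.cartesian_product by (rule sum.cong) auto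
  finally show ?thesis .
qed

text \<open>The coefficient p_{i,s} and the power of a variable that an edge contributes are joined
  in one local factor \<open>\<phi>\<close>; the bounds \<open>d\<close> make the set of gradings
  finite.\<close>

definition grading_sum ::
  "nat \<Rightarrow> nat set \<Rightarrow> nat set \<Rightarrow> (nat \<Rightarrow> nat) \<Rightarrow> (nat \<Rightarrow> nat \<Rightarrow> 'a::comm_ring_1) \<Rightarrow> 'a" where
  "grading_sum N H V d \<phi> =
     (\<Sum>\<omega>\<in>{\<omega> \<in> PiE {..<N} (\<lambda>i. {..d i}). compat N H V \<omega>}. \<Prod>i<N. \<phi> i (\<omega> i))"

lemma grading_sum_reverse:
  assumes "H \<subseteq> {..<N}" "V \<subseteq> {..<N}"
  defines "r \<equiv> \<lambda>i. N - 1 - i"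
  shows "grading_sum N (r ` V) (r ` H) (\<lambda>i. d (r i)) (\<lambda>i. \<phi> (r i)) = grading_sum N H V d \<phi>"
proof -
  have rr: "r (r i) = i" "r i < N" if "i < N" for i using that by (auto simp: r_def)
  define R where "R \<omega> = restrict (\<lambda>i. \<omega> (r i)) {..<N}" for \<omega> :: "nat \<Rightarrow> nat"
  have R_R: "R (R \<omega>) = \<omega>" if "\<omega> \<in> PiE {..<N} X" for \<omega> X
    using that by (auto simp: R_def fun_eq_iff rr PiE_iff extensional_def)
  have R_PiE: "R \<omega> \<in> PiE {..<N} (\<lambda>i. {..d (r i)})" if w: "\<omega> \<in> PiE {..<N} (\<lambda>i. {..d i})" for \<omega>
  proof -
    have "R \<omega> i \<le> d (r i)" if "i < N" for i
      using PiE_mem[OF w, of "r i"] rr[OF that] that by (simp add: R_def)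
    then show ?thesis by (simp add: PiE_iff) (simp add: R_def)
  qed
  have R_PiE': "R \<omega> \<in> PiE {..<N} (\<lambda>i. {..d i})" if w: "\<omega> \<in> PiE {..<N} (\<lambda>i. {..d (r i)})" for \<omega>
  proof -
    have "R \<omega> i \<le> d i" if "i < N" for i
      using PiE_mem[OF w, of "r i"] rr[OF that] that by (simp add: R_def)
    then show ?thesis by (simp add: PiE_iff) (simp add: R_def)
  qed
  have cong: "compat N H' V' \<omega> = compat N H' V' \<omega>'"
    if "\<And>i. i < N \<Longrightarrow> \<omega> i = \<omega>' i" "H' \<subseteq> {..<N}" "V' \<subseteq> {..<N}" for H' V' \<omega> \<omega>'
  proof -
    have "(\<Sum>h\<in>X \<inter> H'. \<omega> h) = (\<Sum>h\<in>X \<inter> H'. \<omega>' h)" "(\<Sum>h\<in>X \<inter> V'. \<omega> h) = (\<Sum>h\<in>X \<inter> V'. \<omega>' h)" for X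
      using that by (auto intro!: sum.cong)
    then show ?thesis by (simp add: compat_def)
  qed
  have R_compat: "compat N (r ` V) (r ` H) (R \<omega>) = compat N H V \<omega>" for \<omega>
  proof -
    have "compat N (r ` V) (r ` H) (R \<omega>) = compat N (r ` V) (r ` H) (\<lambda>i. \<omega> (r i))"
      using assms(1,2) by (intro cong) (auto simp: R_def r_def)
    also have "\<dots> = compat N H V \<omega>" unfolding r_def by (rule compat_reverse[OF assms(1,2)])
    finally show ?thesis .
  qed
  have bij: "bij_betw R {\<omega> \<in> PiE {..<N} (\<lambda>i. {..d i}). compat N H V \<omega>}
      {\<omega> \<in> PiE {..<N} (\<lambda>i. {..d (r i)}). compat N (r ` V) (r ` H) \<omega>}"
  proof (rule bij_betwI[where g = R])
    show "R \<in> {\<omega> \<in> PiE {..<N} (\<lambda>i. {..d i}). compat N H V \<omega>} \<rightarrow> {\<omega> \<in> PiE {..<N} (\<lambda>i. {..d (r i)}). compat N (r ` V) (r ` H) \<omega>}"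
      using R_PiE R_compat by blast
    show "R \<in> {\<omega> \<in> PiE {..<N} (\<lambda>i. {..d (r i)}). compat N (r ` V) (r ` H) \<omega>} \<rightarrow> {\<omega> \<in> PiE {..<N} (\<lambda>i. {..d i}). compat N H V \<omega>}"
    proof
      fix \<omega> assume "\<omega> \<in> {\<omega> \<in> PiE {..<N} (\<lambda>i. {..d (r i)}). compat N (r ` V) (r ` H) \<omega>}"
      then have 1: "\<omega> \<in> PiE {..<N} (\<lambda>i. {..d (r i)})" "compat N (r ` V) (r ` H) \<omega>" by auto
      then have "compat N H V (R \<omega>)" using R_compat[of "R \<omega>"] R_R[OF 1(1)] by simp
      then show "R \<omega> \<in> {\<omega> \<in> PiE {..<N} (\<lambda>i. {..d i}). compat N H V \<omega>}" using R_PiE'[OF 1(1)] by blast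
    qed
  qed (use R_R in auto)
  have brN: "bij_betw r {..<N} {..<N}"
    by (rule bij_betwI[where g = r]) (auto simp: rr)
  have "grading_sum N (r ` V) (r ` H) (\<lambda>i. d (r i)) (\<lambda>i. \<phi> (r i))
      = (\<Sum>\<omega>\<in>{\<omega> \<in> PiE {..<N} (\<lambda>i. {..d i}). compat N H V \<omega>}. \<Prod>i<N. \<phi> (r i) (R \<omega> i))"
    unfolding grading_sum_def by (rule sum.reindex_bij_betw[OF bij, symmetric])
  also have "\<dots> = grading_sum N H V d \<phi>"
    unfolding grading_sum_def
  proof (rule sum.cong[OF refl])
    fix \<omega>
    have "(\<Prod>i<N. \<phi> (r i) (R \<omega> i)) = (\<Prod>i<N. \<phi> (r i) (\<omega> (r i)))"
      by (intro prod.cong) (auto simp: R_def)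
    also have "\<dots> = (\<Prod>i<N. \<phi> i (\<omega> i))" by (rule prod.reindex_bij_betw[OF brN])
    finally show "(\<Prod>i<N. \<phi> (r i) (R \<omega> i)) = (\<Prod>i<N. \<phi> i (\<omega> i))" .
  qed
  finally show ?thesis .
qed

text \<open>For fixed values on \<open>H\<close> the values on free edges do not affect
  compatibility, so they can be summed independently, each edge giving a factor \<open>P\<close>.
  The other edges of \<open>V\<close> make up \<open>R \<alpha>\<close>.\<close>

lemma grading_sum_factor:
  fixes \<phi> :: "nat \<Rightarrow> nat \<Rightarrow> 'a::comm_ring_1"
  assumes part: "H \<union> V = {..<N}" "H \<inter> V = {}"
    and P: "\<And>v. v \<in> V \<Longrightarrow> (\<Sum>s\<le>d v. \<phi> v s) = P"
    and T: "csubring T" "\<And>v s. v \<in> V \<Longrightarrow> \<phi> v s \<in> T"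
  obtains R where "\<And>\<alpha>. R \<alpha> \<in> T"
    "grading_sum N H V d \<phi> = (\<Sum>\<alpha>\<in>PiE H (\<lambda>i. {..d i}). (\<Prod>h\<in>H. \<phi> h (\<alpha> h)) * (R \<alpha> * P ^ card (free_edges N H V \<alpha>)))"
proof -
  interpret T: csubring T by fact
  let ?S = "\<lambda>i. {..d i}"
  have fin: "finite H" "finite V" using part by (metis finite_Un finite_lessThan)+
  define U where "U \<alpha> = free_edges N H V \<alpha>" for \<alpha>
  have U: "U \<alpha> \<subseteq> V" for \<alpha> by (auto simp: U_def free_edges_def)
  have finU: "finite (U \<alpha>)" for \<alpha> using finite_subset[OF U fin(2)] .
  define R where "R \<alpha> = (\<Sum>\<gamma>\<in>PiE (V - U \<alpha>) ?S. if compat N H V (merge H \<alpha> \<gamma>) then \<Prod>v\<in>V - U \<alpha>. \<phi> v (\<gamma> v) else 0)" for \<alpha>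
  have R_T: "R \<alpha> \<in> T" for \<alpha>
    unfolding R_def using T by (intro T.sum_closed) (auto intro!: T.prod_closed)
  have inner: "(\<Sum>\<beta>\<in>PiE V ?S. if compat N H V (merge H \<alpha> \<beta>) then \<Prod>v\<in>V. \<phi> v (\<beta> v) else 0)
      = R \<alpha> * P ^ card (U \<alpha>)" for \<alpha>
  proof -
    have V_eq: "V = (V - U \<alpha>) \<union> U \<alpha>" using U by blast
    have "(\<Sum>\<beta>\<in>PiE V ?S. if compat N H V (merge H \<alpha> \<beta>) then \<Prod>v\<in>V. \<phi> v (\<beta> v) else 0)
      = (\<Sum>\<gamma>\<in>PiE (V - U \<alpha>) ?S. \<Sum>\<delta>\<in>PiE (U \<alpha>) ?S.
          if compat N H V (merge H \<alpha> (merge (V - U \<alpha>) \<gamma> \<delta>)) then \<Prod>v\<in>V. \<phi> v (merge (V - U \<alpha>) \<gamma> \<delta> v) else 0)"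
      by (subst V_eq, subst sum_PiE_Un) (auto simp flip: V_eq)
    also have "\<dots> = (\<Sum>\<gamma>\<in>PiE (V - U \<alpha>) ?S. \<Sum>\<delta>\<in>PiE (U \<alpha>) ?S.
          (if compat N H V (merge H \<alpha> \<gamma>) then \<Prod>v\<in>V - U \<alpha>. \<phi> v (\<gamma> v) else 0) * (\<Prod>v\<in>U \<alpha>. \<phi> v (\<delta> v)))"
    proof (intro sum.cong refl)
      fix \<gamma> \<delta>
      let ?m = "merge (V - U \<alpha>) \<gamma> \<delta>"
      \<comment> \<open>Only the values on \<open>H\<close> decide which edges are free, so the set
        is common to all completions of \<open>\<alpha>\<close>.\<close>
      have fe: "free_edges N H V (merge H \<alpha> \<beta>) = U \<alpha>" for \<beta>
        unfolding U_def by (rule free_edges_cong) (auto simp: merge_def)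
      have "compat N H V (merge H \<alpha> ?m) = compat N H V (merge H \<alpha> \<gamma>)"
      proof
        show "compat N H V (merge H \<alpha> \<gamma>)" if "compat N H V (merge H \<alpha> ?m)"
          by (rule compat_cong_free[OF _ _ _ that]) (use part in \<open>auto simp: merge_def fe\<close>)
        show "compat N H V (merge H \<alpha> ?m)" if "compat N H V (merge H \<alpha> \<gamma>)"
          by (rule compat_cong_free[OF _ _ _ that]) (use part in \<open>auto simp: merge_def fe\<close>)
      qed
      moreover have "(\<Prod>v\<in>V. \<phi> v (?m v)) = (\<Prod>v\<in>V - U \<alpha>. \<phi> v (\<gamma> v)) * (\<Prod>v\<in>U \<alpha>. \<phi> v (\<delta> v))"
      proof -
        have "(\<Prod>v\<in>V. \<phi> v (?m v)) = (\<Prod>v\<in>V - U \<alpha>. \<phi> v (?m v)) * (\<Prod>v\<in>U \<alpha>. \<phi> v (?m v))"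
          using prod.subset_diff[OF U fin(2)] .
        also have "(\<Prod>v\<in>V - U \<alpha>. \<phi> v (?m v)) = (\<Prod>v\<in>V - U \<alpha>. \<phi> v (\<gamma> v))" by (intro prod.cong) (auto simp: merge_def)
        also have "(\<Prod>v\<in>U \<alpha>. \<phi> v (?m v)) = (\<Prod>v\<in>U \<alpha>. \<phi> v (\<delta> v))" by (intro prod.cong) (auto simp: merge_def)
        finally show ?thesis .
      qed
      ultimately show "(if compat N H V (merge H \<alpha> ?m) then \<Prod>v\<in>V. \<phi> v (?m v) else 0)
        = (if compat N H V (merge H \<alpha> \<gamma>) then \<Prod>v\<in>V - U \<alpha>. \<phi> v (\<gamma> v) else 0) * (\<Prod>v\<in>U \<alpha>. \<phi> v (\<delta> v))" by simp
    qed
    also have "\<dots> = R \<alpha> * (\<Sum>\<delta>\<in>PiE (U \<alpha>) ?S. \<Prod>v\<in>U \<alpha>. \<phi> v (\<delta> v))"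
      unfolding R_def sum_product ..
    also have "(\<Sum>\<delta>\<in>PiE (U \<alpha>) ?S. \<Prod>v\<in>U \<alpha>. \<phi> v (\<delta> v)) = (\<Prod>v\<in>U \<alpha>. \<Sum>s\<le>d v. \<phi> v s)"
      using finU by (intro prod_sum_PiE[symmetric]) auto
    also have "\<dots> = (\<Prod>v\<in>U \<alpha>. P)" using U P by (intro prod.cong) auto
    finally show ?thesis by simp
  qed
  have "grading_sum N H V d \<phi> = (\<Sum>\<omega>\<in>PiE (H \<union> V) ?S. if compat N H V \<omega> then \<Prod>i\<in>H \<union> V. \<phi> i (\<omega> i) else 0)"
    unfolding grading_sum_def part by (rule sum.inter_filter) (simp add: finite_PiE)
  also have "\<dots> = (\<Sum>\<alpha>\<in>PiE H ?S. \<Sum>\<beta>\<in>PiE V ?S. if compat N H V (merge H \<alpha> \<beta>) then \<Prod>i\<in>H \<union> V. \<phi> i (merge H \<alpha> \<beta> i) else 0)"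
    by (rule sum_PiE_Un[OF part(2)])
  also have "\<dots> = (\<Sum>\<alpha>\<in>PiE H ?S. (\<Prod>h\<in>H. \<phi> h (\<alpha> h)) * (\<Sum>\<beta>\<in>PiE V ?S. if compat N H V (merge H \<alpha> \<beta>) then \<Prod>v\<in>V. \<phi> v (\<beta> v) else 0))"
    unfolding sum_distrib_left
  proof (intro sum.cong refl)
    fix \<alpha> \<beta>
    have "(\<Prod>i\<in>H \<union> V. \<phi> i (merge H \<alpha> \<beta> i)) = (\<Prod>i\<in>H. \<phi> i (merge H \<alpha> \<beta> i)) * (\<Prod>i\<in>V. \<phi> i (merge H \<alpha> \<beta> i))"
      using fin part by (intro prod.union_disjoint) auto
    also have "(\<Prod>i\<in>H. \<phi> i (merge H \<alpha> \<beta> i)) = (\<Prod>i\<in>H. \<phi> i (\<alpha> i))" by (intro prod.cong) (auto simp: merge_def)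
    also have "(\<Prod>i\<in>V. \<phi> i (merge H \<alpha> \<beta> i)) = (\<Prod>i\<in>V. \<phi> i (\<beta> i))" using part by (intro prod.cong) (auto simp: merge_def)
    finally show "(if compat N H V (merge H \<alpha> \<beta>) then \<Prod>i\<in>H \<union> V. \<phi> i (merge H \<alpha> \<beta> i) else 0)
      = (\<Prod>h\<in>H. \<phi> h (\<alpha> h)) * (if compat N H V (merge H \<alpha> \<beta>) then \<Prod>v\<in>V. \<phi> v (\<beta> v) else 0)" by simp
  qed
  also have "\<dots> = (\<Sum>\<alpha>\<in>PiE H ?S. (\<Prod>h\<in>H. \<phi> h (\<alpha> h)) * (R \<alpha> * P ^ card (U \<alpha>)))"
    by (simp only: inner)
  finally show ?thesis unfolding U_def by (rule that[OF R_T])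
qed

subsection \<open>Greedy elements\<close>

context exchange
begin

lemma polynomial_monomial_in_alg_plus_half:
  assumes i: "i = 1 \<or> i = 2" and Y: "Y \<in> subring_gen (insert (xpow i 1) (scal ` pring))"
  shows "xpow i a * Y * nbr i ^ b * xpow (3 - i) 1 ^ j \<in> alg_plus_half i"
proof -
  interpret cR: csubring "scal ` pring" by (simp add: csubring_scal)
  have "Y \<in> lincomb (scal ` pring) (\<lambda>j::nat. xpow i 1 ^ j)"
    using Y cR.subring_gen_insert_subset by blast
  then obtain S q where S: "finite S" "\<And>j. j \<in> S \<Longrightarrow> q j \<in> pring" "Y = (\<Sum>j\<in>S. scal (q j) * xpow i 1 ^ j)"
    by (rule lincomb_scal_cases) blast
  have "xpow i a * Y * nbr i ^ b * xpow (3 - i) 1 ^ j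
      = (\<Sum>k\<in>S. scal (q k) * (xpow i (a + int k) * nbr i ^ b * xpow (3 - i) 1 ^ j))"
    unfolding S(3) sum_distrib_left sum_distrib_right
    by (intro sum.cong refl) (simp add: xpow_add xpow_power mult_ac)
  also have "\<dots> \<in> alg_plus_half i" using S(2) monomial_in_alg_plus_half[OF i] by (intro alg_plus_half_sum alg_plus_half_scale) auto
  finally show ?thesis .
qed

lemma scal_prod: "scal (\<Prod>i\<in>S. f i) = (\<Prod>i\<in>S. scal (f i))"
  by (induction S rule: infinite_finite_induct) (auto simp: scal_mult)

text \<open>A grading of \<open>H\<close> of total value t contributes x_{3-i}^{t-n}, where n =
  \<open>card V\<close>, and by \<open>card_free_edges\<close> at least n - t factors P_i(x_i). Each
  of these is \<open>nbr i\<close> times x_{3-i} and can cancel one factor of the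
  denominator.\<close>

lemma grading_sum_in_alg_plus_half:
  assumes i: "i = 1 \<or> i = 2" and part: "H \<union> V = {..<N}" "H \<inter> V = {}"
    and V: "\<And>v. v \<in> V \<Longrightarrow> d v = ll i" "\<And>v s. v \<in> V \<Longrightarrow> \<phi> v s = scal (pcf i s) * xpow i 1 ^ s"
    and H: "\<And>h s. h \<in> H \<Longrightarrow> \<phi> h s = scal (pcf (3 - i) s) * xpow (3 - i) 1 ^ s"
  shows "xpow i a * xpow (3 - i) (- int (card V)) * grading_sum N H V d \<phi> \<in> alg_plus_half i"
proof -
  let ?T = "subring_gen (insert (xpow i 1) (scal ` pring)) :: 'k laurent set"
  interpret T: csubring ?T by simp
  have ccT: "scal c \<in> ?T" if "c \<in> pring" for c using that by (auto intro: subring_gen.gen)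
  have vT: "xpow i 1 \<in> ?T" by (auto intro: subring_gen.gen)
  have phiT: "\<phi> v s \<in> ?T" if "v \<in> V" for v s
    unfolding V(2)[OF that] using i vT by (intro T.mult_closed T.power_closed ccT) auto
  have P: "(\<Sum>s\<le>d v. \<phi> v s) = Pval i" if "v \<in> V" for v using that V by (simp add: Pval_def)
  obtain R where R: "\<And>\<alpha>. R \<alpha> \<in> ?T" and eq:
    "grading_sum N H V d \<phi> = (\<Sum>\<alpha>\<in>PiE H (\<lambda>i. {..d i}). (\<Prod>h\<in>H. \<phi> h (\<alpha> h)) * (R \<alpha> * Pval i ^ card (free_edges N H V \<alpha>)))"
    by (rule grading_sum_factor[where H = H and V = V and N = N and d = d and \<phi> = \<phi> and P = "Pval i" and T = ?T])
      (use part P phiT in auto)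
  show ?thesis
    unfolding eq sum_distrib_left
  proof (rule alg_plus_half_sum)
    fix \<alpha> assume "\<alpha> \<in> PiE H (\<lambda>i. {..d i})"
    define t where "t = (\<Sum>h\<in>H. \<alpha> h)"
    define u where "u = card (free_edges N H V \<alpha>)"
    define n where "n = card V"
    define c where "c = (\<Prod>h\<in>H. pcf (3 - i) (\<alpha> h))"
    have nut: "n \<le> u + t" unfolding n_def u_def t_def by (rule card_free_edges[OF part])
    have i3: "3 - i = 1 \<or> 3 - i = 2" using i by auto
    have c: "c \<in> pring" unfolding c_def using i3 by (intro pring.prod_closed) auto
    have "(\<Prod>h\<in>H. \<phi> h (\<alpha> h)) = (\<Prod>h\<in>H. scal (pcf (3 - i) (\<alpha> h)) * xpow (3 - i) 1 ^ \<alpha> h)"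
      using H by (intro prod.cong) auto
    also have "\<dots> = scal c * xpow (3 - i) 1 ^ t"
      unfolding prod.distrib c_def t_def by (simp add: scal_prod power_sum)
    finally have HH: "(\<Prod>h\<in>H. \<phi> h (\<alpha> h)) = scal c * xpow (3 - i) 1 ^ t" .
    \<comment> \<open>Truncated subtraction treats two cases at once: at most one of
      \<open>n - t\<close> and \<open>t - n\<close> is nonzero.\<close>
    have key: "xpow (3 - i) (- int n) * xpow (3 - i) 1 ^ t * Pval i ^ u
      = Pval i ^ (u - (n - t)) * nbr i ^ (n - t) * xpow (3 - i) 1 ^ (t - n)"
    proof (cases "n \<le> t")
      case True
      then have "xpow (3 - i) (- int n) * xpow (3 - i) 1 ^ t = (xpow (3 - i) 1 ^ (t - n) :: 'k laurent)"
        by (simp add: xpow_power xpow_add[symmetric] of_nat_diff algebra_simps)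
      then show ?thesis using True by (simp add: mult_ac)
    next
      case False
      then have "Pval i ^ u = Pval i ^ (u - (n - t)) * (nbr i * xpow (3 - i) 1) ^ (n - t)"
        using nut unfolding nbr_xpow[OF i] by (simp flip: power_add)
      moreover have "xpow (3 - i) (- int n) * xpow (3 - i) 1 ^ t * xpow (3 - i) 1 ^ (n - t) = (1 :: 'k laurent)"
        using False by (simp add: xpow_power xpow_add[symmetric] of_nat_diff)
      ultimately show ?thesis using False by (simp add: power_mult_distrib mult_ac)
    qed
    have "xpow i a * xpow (3 - i) (- int (card V)) * ((\<Prod>h\<in>H. \<phi> h (\<alpha> h)) * (R \<alpha> * Pval i ^ card (free_edges N H V \<alpha>)))
      = scal c * (xpow i a * R \<alpha> * (xpow (3 - i) (- int n) * xpow (3 - i) 1 ^ t * Pval i ^ u))"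
      unfolding HH u_def[symmetric] n_def[symmetric] by (simp add: mult_ac)
    also have "\<dots> = scal c * (xpow i a * (R \<alpha> * Pval i ^ (u - (n - t))) * nbr i ^ (n - t) * xpow (3 - i) 1 ^ (t - n))"
      unfolding key by (simp add: mult_ac)
    also have "\<dots> \<in> alg_plus_half i"
    proof (intro alg_plus_half_scale[OF polynomial_monomial_in_alg_plus_half[OF i] c] T.mult_closed R T.power_closed)
      show "Pval i \<in> ?T" using ccT vT i by (intro Pval_in_subring) auto
    qed
    finally show "xpow i a * xpow (3 - i) (- int (card V)) * ((\<Prod>h\<in>H. \<phi> h (\<alpha> h)) * (R \<alpha> * Pval i ^ card (free_edges N H V \<alpha>))) \<in> alg_plus_half i" .
  qed
qed

definition grade_bound :: "nat \<Rightarrow> nat \<Rightarrow> nat \<Rightarrow> nat" where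
  "grade_bound m n i = (if i \<in> horiz_edges m n then ll 2 else ll 1)"

definition edge_term :: "nat \<Rightarrow> nat \<Rightarrow> nat \<Rightarrow> nat \<Rightarrow> 'k laurent" where
  "edge_term m n i s = (if i \<in> horiz_edges m n then scal (pcf 2 s) * xpow 2 1 ^ s else scal (pcf 1 s) * xpow 1 1 ^ s)"

definition greedy_sum :: "nat \<Rightarrow> nat \<Rightarrow> 'k laurent" where
  "greedy_sum m n = grading_sum (m + n) (horiz_edges m n) (vert_edges m n) (grade_bound m n) (edge_term m n)"

definition greedy_laurent :: "int \<times> int \<Rightarrow> 'k laurent" where
  "greedy_laurent a = xpow 1 (- fst a) * xpow 2 (- snd a) * greedy_sum (nat (max (fst a) 0)) (nat (max (snd a) 0))"

text \<open>For the second claim the cycle is reversed, so that vertical and horizontal edges change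
  roles.\<close>

lemma greedy_sum_in_alg_plus_half:
  "xpow 1 (- int m) * xpow 2 (- int n) * greedy_sum m n \<in> alg_plus_half 1"
  "xpow 1 (- int m) * xpow 2 (- int n) * greedy_sum m n \<in> alg_plus_half 2"
proof -
  note hv = horiz_vert_edges[of m n]
  let ?N = "m + n"
  let ?H = "horiz_edges m n" and ?V = "vert_edges m n"
  have "xpow 1 (- int m) * xpow (3 - 1) (- int (card ?V)) * greedy_sum m n \<in> alg_plus_half 1"
    unfolding greedy_sum_def
    by (rule grading_sum_in_alg_plus_half) (use hv in \<open>auto simp: grade_bound_def edge_term_def\<close>)
  then show "xpow 1 (- int m) * xpow 2 (- int n) * greedy_sum m n \<in> alg_plus_half 1" using hv(2) by simp
  define r where "r i = ?N - 1 - i" for i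
  have sub: "?H \<subseteq> {..<?N}" "?V \<subseteq> {..<?N}" using hv(3) by auto
  have inj: "inj_on r {..<?N}" by (auto simp: r_def inj_on_def)
  have rr: "r (r i) = i" if "i \<in> ?H \<union> ?V" for i using that unfolding hv(3) by (auto simp: r_def)
  have rN: "r ` {..<?N} = {..<?N}"
    by (rule card_seteq) (use card_image[OF inj] in \<open>auto simp: r_def\<close>)
  have part: "r ` ?V \<union> r ` ?H = {..<?N}" "r ` ?V \<inter> r ` ?H = {}"
    using rN hv(3) inj_on_image_Int[OF inj sub(2,1)] hv(4) by (auto simp: image_Un[symmetric] Un_commute Int_commute)
  have notH: "v \<notin> ?H" if "v \<in> ?V" for v using that hv(4) by auto
  have "xpow 2 (- int n) * xpow (3 - 2) (- int (card (r ` ?H)))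
      * grading_sum ?N (r ` ?V) (r ` ?H) (\<lambda>i. grade_bound m n (r i)) (\<lambda>i. edge_term m n (r i)) \<in> alg_plus_half 2"
  proof (rule grading_sum_in_alg_plus_half[OF _ part])
    show "grade_bound m n (r v) = ll 2" if "v \<in> r ` ?H" for v
      using that rr by (auto simp: grade_bound_def)
    show "edge_term m n (r v) s = scal (pcf 2 s) * xpow 2 1 ^ s" if "v \<in> r ` ?H" for v s
      using that rr by (auto simp: edge_term_def)
    show "edge_term m n (r v) s = scal (pcf (3 - 2) s) * xpow (3 - 2) 1 ^ s" if "v \<in> r ` ?V" for v s
      using that rr notH by (auto simp: edge_term_def)
  qed simp
  also have "grading_sum ?N (r ` ?V) (r ` ?H) (\<lambda>i. grade_bound m n (r i)) (\<lambda>i. edge_term m n (r i)) = greedy_sum m n"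
    unfolding greedy_sum_def r_def by (rule grading_sum_reverse[OF sub])
  also have "card (r ` ?H) = m" using card_image[OF inj_on_subset[OF inj sub(1)]] hv(1) by simp
  finally show "xpow 1 (- int m) * xpow 2 (- int n) * greedy_sum m n \<in> alg_plus_half 2" by (simp add: mult_ac)
qed

lemma greedy_laurent_in_lower_alg_pos: "fst a > 0 \<Longrightarrow> snd a > 0 \<Longrightarrow> greedy_laurent a \<in> lower_alg pring"
  using greedy_sum_in_alg_plus_half[of "nat (fst a)" "nat (snd a)"] by (intro alg_plus_half_inter) (simp_all add: greedy_laurent_def max_def)

lemma prod_sum_grading:
  assumes "\<And>\<omega>. compat N H V \<omega>"
  shows "grading_sum N H V d \<phi> = (\<Prod>i<N. \<Sum>s\<le>d i. \<phi> i s)"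
  unfolding grading_sum_def using assms by (simp add: prod_sum_PiE)

text \<open>With one kind of edges missing, compatibility is vacuous and the sum becomes a product
  over the edges.\<close>

lemma greedy_sum_0: "greedy_sum m 0 = Pval 2 ^ m" "greedy_sum 0 n = Pval 1 ^ n"
proof -
  have fin: "finite (horiz_edges m n)" "finite (vert_edges m n)" for m n
    by (simp_all add: horiz_edges_def vert_edges_def)
  have v: "vert_edges m 0 = {}" using horiz_vert_edges(2)[of m 0] fin by simp
  have h: "horiz_edges 0 n = {}" using horiz_vert_edges(1)[of 0 n] fin by simp
  have h': "horiz_edges m 0 = {..<m}" using horiz_vert_edges(3)[of m 0] v by simp
  show "greedy_sum m 0 = Pval 2 ^ m"
    unfolding greedy_sum_def by (subst prod_sum_grading) (simp_all add: compat_def v h' grade_bound_def edge_term_def Pval_def)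
  show "greedy_sum 0 n = Pval 1 ^ n"
    unfolding greedy_sum_def by (subst prod_sum_grading) (simp_all add: compat_def h grade_bound_def edge_term_def Pval_def)
qed

lemma nbr_power: "nbr (3 - 1) ^ n = Pval 2 ^ n * xpow 1 (- int n)" "nbr (3 - 2) ^ n = Pval 1 ^ n * xpow 2 (- int n)"
  by (simp_all add: nbr_def power_mult_distrib xpow_power)

lemma greedy_laurent_eq_std_mon:
  assumes "fst a \<le> 0 \<or> snd a \<le> 0"
  shows "greedy_laurent a = std_mon a"
proof -
  have std_factor_neg: "std_factor j b = xpow j (- b)" if "b \<le> 0" for j b using that by (auto simp: std_factor_def)
  have w1: "std_factor 1 b = Pval 2 ^ nat b * xpow 1 (- b)" if "b > 0" for b
    using that nbr_power(1)[of "nat b"] by (simp add: std_factor_def)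
  have w2: "std_factor 2 b = Pval 1 ^ nat b * xpow 2 (- b)" if "b > 0" for b
    using that nbr_power(2)[of "nat b"] by (simp add: std_factor_def)
  have g00: "greedy_sum 0 0 = 1" using greedy_sum_0(1)[of 0] by simp
  consider "fst a \<le> 0" "snd a \<le> 0" | "fst a > 0" "snd a \<le> 0" | "fst a \<le> 0" "snd a > 0"
    using assms by linarith
  then show ?thesis
  proof cases
    case 1
    then show ?thesis by (simp add: greedy_laurent_def std_mon_def std_factor_neg g00 max_def)
  next
    case 2
    then show ?thesis by (simp add: greedy_laurent_def std_mon_def std_factor_neg w1 greedy_sum_0 max_def mult_ac del: One_nat_def)
  next
    case 3
    then show ?thesis by (simp add: greedy_laurent_def std_mon_def std_factor_neg w2 greedy_sum_0 max_def mult_ac)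
  qed
qed

lemma deg_ge_prod: "finite S \<Longrightarrow> (\<And>i. i \<in> S \<Longrightarrow> deg_ge (f i) (e i)) \<Longrightarrow> deg_ge (\<Prod>i\<in>S. f i) (\<Sum>i\<in>S. e i)"
  by (induction S rule: finite_induct) (auto simp: deg_ge_mult intro: pointed_deg_ge[OF pointed_1, simplified])

text \<open>The zero grading is compatible, as the one-edge subpath at \<open>u\<close> is balanced,
  and contributes 1; any other grading contributes only terms of positive degree.\<close>

lemma pointed_greedy_sum: "pointed (greedy_sum m n) 0"
proof -
  let ?N = "m + n"
  let ?H = "horiz_edges m n" and ?V = "vert_edges m n"
  let ?W = "{\<omega> \<in> PiE {..<?N} (\<lambda>i. {..grade_bound m n i}). compat ?N ?H ?V \<omega>}"
  \<comment> \<open>\<open>undefined\<close> outside the edges is what \<open>PiE\<close>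
    requires.\<close>
  define z where "z = (\<lambda>i. if i < ?N then 0 else undefined :: nat)"
  have hv: "?H \<inter> ?V = {}" "?H \<union> ?V = {..<?N}" by (rule horiz_vert_edges)+
  have "compat ?N ?H ?V z"
    unfolding compat_def
  proof (intro ballI)
    fix u v assume uv: "u \<in> ?H" "v \<in> ?V"
    have uu: "subpath ?N u u \<inter> ?V = {}" "subpath ?N u u \<inter> ?H = {u}" using uv hv by (auto simp: subpath_def)
    have "u < ?N" using uv hv(2) by auto
    then have "card (subpath ?N u u \<inter> ?V) = (\<Sum>h\<in>subpath ?N u u \<inter> ?H. z h)" unfolding uu by (simp add: z_def)
    moreover have "u \<in> subpath ?N u v" using \<open>u < ?N\<close> by (auto simp: subpath_def)
    moreover have "u \<noteq> v" using uv hv by auto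
    ultimately show "\<exists>e\<in>subpath ?N u v.
        e \<noteq> v \<and> card (subpath ?N u e \<inter> ?V) = (\<Sum>h\<in>subpath ?N u e \<inter> ?H. z h) \<or>
        e \<noteq> u \<and> card (subpath ?N e v \<inter> ?H) = (\<Sum>h\<in>subpath ?N e v \<inter> ?V. z h)" by blast
  qed
  moreover have "z \<in> PiE {..<?N} (\<lambda>i. {..grade_bound m n i})" by (auto simp: z_def PiE_iff extensional_def)
  ultimately have zW: "z \<in> ?W" by blast
  have "finite (PiE {..<?N} (\<lambda>i. {..grade_bound m n i}))" by (intro finite_PiE) auto
  then have finW: "finite ?W" by (rule rev_finite_subset) blast
  have "greedy_sum m n = (\<Prod>i<?N. edge_term m n i (z i)) + (\<Sum>\<omega>\<in>?W - {z}. \<Prod>i<?N. edge_term m n i (\<omega> i))"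
    unfolding greedy_sum_def grading_sum_def by (rule sum.remove[OF finW zW])
  also have "(\<Prod>i<?N. edge_term m n i (z i)) = 1" by (intro prod.neutral) (auto simp: z_def edge_term_def)
  finally have eq: "greedy_sum m n = 1 + (\<Sum>\<omega>\<in>?W - {z}. \<Prod>i<?N. edge_term m n i (\<omega> i))" .
  have lphi: "deg_ge (edge_term m n i s) (int s)" for i s
    unfolding edge_term_def by (auto intro!: deg_ge_scal_mult deg_ge_xpow_power)
  have "deg_ge (\<Sum>\<omega>\<in>?W - {z}. \<Prod>i<?N. edge_term m n i (\<omega> i)) (total_degree 0 + 1)"
  proof (rule deg_ge_sum)
    fix \<omega> assume \<omega>: "\<omega> \<in> ?W - {z}"
    then have "\<exists>i<?N. \<omega> i \<noteq> 0"
      by (auto simp: z_def fun_eq_iff PiE_iff extensional_def split: if_splits)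
    then obtain i where i: "i < ?N" "\<omega> i \<noteq> 0" by blast
    then have "\<omega> i \<le> (\<Sum>i<?N. \<omega> i)" by (intro member_le_sum) auto
    then have "(\<Sum>i<?N. int (\<omega> i)) \<ge> 1" using i(2) by (simp flip: of_nat_sum)
    moreover have "deg_ge (\<Prod>i<?N. edge_term m n i (\<omega> i)) (\<Sum>i<?N. int (\<omega> i))"
      using lphi by (intro deg_ge_prod) auto
    ultimately show "deg_ge (\<Prod>i<?N. edge_term m n i (\<omega> i)) (total_degree 0 + 1)" by (auto elim: deg_ge_mono)
  qed
  then show ?thesis unfolding eq by (intro pointed_add_deg_ge) auto
qed

lemma pointed_greedy_laurent: "pointed (greedy_laurent a) (neg_mon a)"
  using pointed_mult[OF pointed_mult[OF pointed_xpow pointed_xpow] pointed_greedy_sum] by (simp add: greedy_laurent_def neg_mon_def)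

lemma greedy_laurent_in_lower_alg: "greedy_laurent a \<in> lower_alg pring"
proof (cases "fst a \<le> 0 \<or> snd a \<le> 0")
  case True
  then show ?thesis using greedy_laurent_eq_std_mon std_mon_in_lower_alg by metis
next
  case False
  then show ?thesis using greedy_laurent_in_lower_alg_pos by simp
qed

text \<open>\<open>greedy_laurent a\<close> and \<open>std_mon a\<close> share their lowest term, so
  their difference involves only standard monomials of smaller weight. The truncated weight
  decreases, since \<open>a\<close> and every index that needs the induction hypothesis have
  positive entries.\<close>

lemma std_mon_in_lincomb_greedy_laurent: "std_mon a \<in> lincomb (scal ` pring) greedy_laurent"
proof (induction "nat (fst a + snd a)" arbitrary: a rule: less_induct)
  case less
  interpret cR: csubring "scal ` pring" by (simp add: csubring_scal)
  interpret A: csubring "lower_alg pring" by simp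
  show ?case
  proof (cases "fst a \<le> 0 \<or> snd a \<le> 0")
    case True
    then show ?thesis using greedy_laurent_eq_std_mon cR.lincomb_base[of greedy_laurent a] by metis
  next
    case False
    have "greedy_laurent a - std_mon a \<in> lower_alg pring" using greedy_laurent_in_lower_alg std_mon_in_lower_alg by auto
    then have "greedy_laurent a - std_mon a \<in> lincomb (scal ` pring) std_mon" using lower_alg_eq_lincomb[OF csubring_pring order_refl] by simp
    then obtain S c where S: "finite S" "\<And>b. b \<in> S \<Longrightarrow> c b \<in> pring" and eq: "greedy_laurent a - std_mon a = (\<Sum>b\<in>S. scal (c b) * std_mon b)"
      by (rule lincomb_scal_cases) blast
    define S' where "S' = {b \<in> S. c b \<noteq> 0}"
    have eq': "greedy_laurent a - std_mon a = (\<Sum>b\<in>S'. scal (c b) * std_mon b)"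
      unfolding eq S'_def using S(1) by (intro sum.mono_neutral_right) auto
    have small: "fst b + snd b < fst a + snd a" if "b \<in> S'" for b
    proof -
      have "finite S'" "S' \<noteq> {}" using that S(1) unfolding S'_def by (simp, blast)
      then obtain b0 where b0: "b0 \<in> S'" "\<And>b'. b' \<in> S' \<Longrightarrow> fst b' + snd b' \<le> fst b0 + snd b0"
        using ex_max_weight by metis
      have "coef (greedy_laurent a - std_mon a) (neg_mon b0) = c b0"
        unfolding eq' using b0 \<open>finite S'\<close> pointed_std_mon by (intro lookup_lincomb_lead) auto
      then have nz: "coef (greedy_laurent a - std_mon a) (neg_mon b0) \<noteq> 0" using b0 by (simp add: S'_def)
      have "greedy_laurent a - std_mon a = (greedy_laurent a - sgl (neg_mon a) 1) - (std_mon a - sgl (neg_mon a) 1)" by simp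
      also have "deg_ge \<dots> (total_degree (neg_mon a) + 1)"
        using pointed_greedy_laurent[of a] pointed_std_mon[of a] unfolding pointed_def by (rule deg_ge_diff)
      finally have "deg_ge (greedy_laurent a - std_mon a) (total_degree (neg_mon a) + 1)" .
      then have "\<not> total_degree (neg_mon b0) < total_degree (neg_mon a) + 1" using nz deg_ge_lookup by blast
      then show ?thesis using b0(2)[OF that] by simp
    qed
    have "std_mon b \<in> lincomb (scal ` pring) greedy_laurent" if "b \<in> S'" for b
    proof (cases "fst b \<le> 0 \<or> snd b \<le> 0")
      case True
      then show ?thesis using greedy_laurent_eq_std_mon cR.lincomb_base[of greedy_laurent b] by metis
    next
      case F: False
      then show ?thesis using small[OF that] False by (intro less) auto
    qed
    then have "(\<Sum>b\<in>S'. scal (c b) * std_mon b) \<in> lincomb (scal ` pring) greedy_laurent"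
      using S(2) by (intro cR.lincomb_sum cR.lincomb_scale) (auto simp: S'_def)
    then have "greedy_laurent a - (\<Sum>b\<in>S'. scal (c b) * std_mon b) \<in> lincomb (scal ` pring) greedy_laurent"
      using cR.lincomb_base[of greedy_laurent a] by (rule cR.lincomb_diff[rotated])
    then show ?thesis unfolding eq'[symmetric] by simp
  qed
qed

lemma lincomb_greedy_laurent: "lincomb (scal ` pring) greedy_laurent = lower_alg pring"
proof
  interpret cR: csubring "scal ` pring" by (simp add: csubring_scal)
  have lower_alg: "lower_alg pring = lincomb (scal ` pring) std_mon" by (rule lower_alg_eq_lincomb[OF csubring_pring order_refl])
  show "lincomb (scal ` pring) greedy_laurent \<subseteq> lower_alg pring" unfolding lower_alg
    by (rule cR.lincomb_least) (use greedy_laurent_in_lower_alg lower_alg in blast)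
  show "lower_alg pring \<subseteq> lincomb (scal ` pring) greedy_laurent" unfolding lower_alg
    by (rule cR.lincomb_least) (rule std_mon_in_lincomb_greedy_laurent)
qed

end

subsection \<open>Degrees and normalizing exponents of the cluster variables\<close>

type_synonym cstate = "int \<times> int \<times> int \<times> int \<times> int \<times> int"

text \<open>The leading coefficient of P_i is p_{i,l_i} and that of its reversal is the inverse;
  this is the exponent, by the residue \<open>r\<close> of the position modulo 4.\<close>

definition csign :: "nat \<Rightarrow> int" where
  "csign r = (if r = 1 \<or> r = 2 then 1 else - 1)"

text \<open>\<open>ea\<close> and \<open>eb\<close> tell which of the two leading coefficients
  belongs to the exchange polynomial, the first one at odd positions.\<close>

definition ea :: "nat \<Rightarrow> int" where "ea r = (if odd r then 1 else 0)"
definition eb :: "nat \<Rightarrow> int" where "eb r = (if odd r then 0 else 1)"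

text \<open>Read off from the exchange relation. If a variable has lowest degree d > 0, the lowest
  term of its exchange polynomial is the constant 1. If d < 0, it is the leading term, of degree L
  d, whose coefficient is the leading one times the L-th power of the lowest coefficient of the
  variable. Division by the preceding variable subtracts its data. Normalizing exponents are the
  negatives of those in the lowest coefficient, whence the minus sign at
  \<open>csign\<close>.\<close>

fun cstep :: "nat \<Rightarrow> nat \<Rightarrow> nat \<Rightarrow> cstate \<Rightarrow> cstate" where
  "cstep l l' r (d0, d, a0, a, b0, b) = (let L = int (if odd r then l else l') in
     (d, (if d > 0 then 0 else L * d) - d0,
      a, (if d > 0 then 0 else L * a - csign r * ea r) - a0,
      b, (if d > 0 then 0 else L * b - csign r * eb r) - b0))"

text \<open>
  With these exponents, the exchange polynomial at the normalized cluster variable has coefficients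
  in R once divided by the coefficient of its lowest term.
\<close>

fun cgood :: "nat \<Rightarrow> nat \<Rightarrow> nat \<Rightarrow> cstate \<Rightarrow> bool" where
  "cgood l l' r (d0, d, a0, a, b0, b) = (let L = (if odd r then l else l') in d \<noteq> 0 \<and>
     (if d > 0 then
        if r = 1 \<or> r = 2 then a \<le> 0 \<and> b \<le> 0 \<or> L = 1 \<and> a \<le> ea r \<and> b \<le> eb r
        else a \<le> - ea r \<and> b \<le> - eb r
      else
        if r = 1 \<or> r = 2 then a \<ge> ea r \<and> b \<ge> eb r
        else a \<ge> 0 \<and> b \<ge> 0 \<or> L = 1 \<and> a \<ge> - ea r \<and> b \<ge> - eb r))"

text \<open>
  The entry \<open>cseq l l' k = (D k, D (k+1), A k, A (k+1), B k, B (k+1))\<close> describes the k-th and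
  the (k+1)-st cluster variable: D is the total degree of the lowest term, which becomes 1 after
  multiplication by the A-th and B-th powers of the leading coefficients of P_1 and P_2.
\<close>

primrec cseq :: "nat \<Rightarrow> nat \<Rightarrow> nat \<Rightarrow> cstate" where
  "cseq l l' 0 = (- 1, 1, 0, 0, 0, 0)"
| "cseq l l' (Suc k) = cstep l l' (Suc k mod 4) (cseq l l' k)"

text \<open>A state and the residue of its position modulo 4 determine all later states; as 4
  divides \<open>p\<close>, checking one period is enough.\<close>

lemma cgood_periodic:
  assumes "4 dvd p" "p > 0" "cseq l l' p = cseq l l' 0"
    and "list_all (\<lambda>k. cgood l l' (Suc k mod 4) (cseq l l' k)) [0..<p]"
  shows "cgood l l' (Suc k mod 4) (cseq l l' k)"
proof -
  have per: "cseq l l' (k + p) = cseq l l' k" for k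
  proof (induction k)
    case (Suc k)
    have "Suc (k + p) mod 4 = Suc k mod 4" using assms(1) by (auto elim!: dvdE simp: mod_mult_self2 simp flip: add_Suc)
    then show ?case using Suc by (simp del: cstep.simps)
  qed (use assms in simp)
  show ?thesis
  proof (induction k rule: less_induct)
    case (less k)
    show ?case
    proof (cases "k < p")
      case True
      then show ?thesis using assms(4) by (simp add: list_all_iff)
    next
      case False
      then have k: "k = (k - p) + p" by simp
      have "Suc k mod 4 = Suc (k - p) mod 4"
      proof -
        have "Suc k = Suc (k - p) + p" using k by simp
        then show ?thesis using assms(1) by (metis dvd_eq_mod_eq_0 mod_add_right_eq add.right_neutral)
      qed
      moreover have "cseq l l' k = cseq l l' (k - p)" using per[of "k - p"] k by simp
      ultimately show ?thesis using less[of "k - p"] False assms(2) by simp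
    qed
  qed
qed

text \<open>These are the types A_2, B_2 and G_2, where the degrees have the periods 5, 6 and 8. The
  lengths 20, 12 and 8 are the least common multiples with the period 4 of the exchange
  polynomials.\<close>

lemma cgood_finite_type:
  assumes "(l, l') \<in> {(1, 1), (1, 2), (2, 1), (1, 3), (3, 1)}"
  shows "cgood l l' (Suc k mod 4) (cseq l l' k)"
proof -
  have "cseq 1 1 20 = cseq 1 1 0" "list_all (\<lambda>k. cgood 1 1 (Suc k mod 4) (cseq 1 1 k)) [0..<20]"
    by code_simp+
  note 11 = cgood_periodic[OF _ _ this]
  have "cseq 1 2 12 = cseq 1 2 0" "list_all (\<lambda>k. cgood 1 2 (Suc k mod 4) (cseq 1 2 k)) [0..<12]"
    by code_simp+
  note 12 = cgood_periodic[OF _ _ this]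
  have "cseq 2 1 12 = cseq 2 1 0" "list_all (\<lambda>k. cgood 2 1 (Suc k mod 4) (cseq 2 1 k)) [0..<12]"
    by code_simp+
  note 21 = cgood_periodic[OF _ _ this]
  have "cseq 1 3 8 = cseq 1 3 0" "list_all (\<lambda>k. cgood 1 3 (Suc k mod 4) (cseq 1 3 k)) [0..<8]"
    by code_simp+
  note 13 = cgood_periodic[OF _ _ this]
  have "cseq 3 1 8 = cseq 3 1 0" "list_all (\<lambda>k. cgood 3 1 (Suc k mod 4) (cseq 3 1 k)) [0..<8]"
    by code_simp+
  note 31 = cgood_periodic[OF _ _ this]
  show ?thesis using assms 11 12 21 13 31 by auto
qed

text \<open>
  In infinite type \<open>d\<close> stays negative, so that the recursion is linear; it preserves lower bounds for
  the ratios of consecutive terms (l/2 and 2/l for \<open>d\<close>) if \<open>l * l' \<ge> 4\<close>.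
\<close>

fun cinv :: "nat \<Rightarrow> nat \<Rightarrow> nat \<Rightarrow> cstate \<Rightarrow> bool" where
  "cinv l l' r (d0, d, a0, a, b0, b) \<longleftrightarrow> d < 0 \<and>
     (if odd r then
        int l * d \<le> 2 * d0 \<and> int l * a - csign r > 0 \<and> int l * a - csign r \<ge> 2 * a0 \<and>
        b \<ge> 0 \<and> 2 * b \<ge> int l' * b0 + csign r \<and> 4 * b > int l' * b0 + csign r
      else
        2 * d \<le> int l * d0 \<and> a > 0 \<and> 2 * a \<ge> int l * a0 - csign r \<and>
        int l' * b - csign r > 0 \<and> int l' * b - csign r \<ge> 2 * b0)"

text \<open>The strict inequalities become the required ones by integrality: l a > 1 gives a \<ge>
  1, and l a > -1 gives a \<ge> 0; likewise for b.\<close>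

lemma cinv_cgood:
  assumes "cinv l l' r s" "l \<ge> 1" "l' \<ge> 1"
  shows "cgood l l' r s"
proof -
  obtain d0 d a0 a b0 b where s: "s = (d0, d, a0, a, b0, b)" by (cases s)
  have nonneg: "x \<ge> 0" if "int m * x > - 1" "m \<ge> 1" for m x
  proof (rule ccontr)
    assume "\<not> x \<ge> 0"
    then have "int m * x \<le> 1 * x" using that(2) by (intro mult_right_mono_neg) auto
    then show False using that(1) \<open>\<not> x \<ge> 0\<close> by linarith
  qed
  have pos: "x \<ge> 1" if "int m * x > 1" for m x
  proof (rule ccontr)
    assume "\<not> x \<ge> 1"
    then have "int m * x \<le> 0" using mult_nonneg_nonpos[of "int m" x] by auto
    then show False using that by simp
  qed
  show ?thesis
    using assms unfolding s
    by (auto simp: Let_def csign_def ea_def eb_def split: if_splits dest: pos nonneg)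
qed

text \<open>For consecutive degrees d0, d, d', d'': if d0/d \<le> l/2, then d'/d = l - d0/d \<ge>
  l/2, and then d''/d' = l' - d/d' \<ge> l' - 2/l \<ge> 2/l, which is where l l' \<ge> 4 enters. The
  bounds for \<open>a\<close> and \<open>b\<close> follow the same pattern, shifted by the
  contributions of \<open>csign\<close>.\<close>

lemma cinv_cstep:
  assumes inv: "cinv l l' (k mod 4) s" and l: "l \<ge> 1" "l' \<ge> 1" "l * l' \<ge> 4"
  shows "cinv l l' (Suc k mod 4) (cstep l l' (k mod 4) s)"
proof -
  obtain d0 d a0 a b0 b where s: "s = (d0, d, a0, a, b0, b)" by (cases s)
  have ll: "int l * int l' \<ge> 4" using l by (metis of_nat_le_iff of_nat_mult of_nat_numeral)
  have up: "int l * (int l' * x) \<ge> 4 * x" if "x \<ge> 0" for x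
    using mult_right_mono[OF ll that] by (simp add: mult.assoc)
  have down: "int l * (int l' * x) \<le> 4 * x" if "x \<le> 0" for x
    using mult_right_mono_neg[OF ll that] by (simp add: mult.assoc)
  have posl: "x > 0" if "int l * x > 0" for x using that by (simp add: zero_less_mult_iff)
  have negl: "x < 0" if "int l * x < 0" for x using that by (simp add: mult_less_0_iff)
  have k4: "k mod 4 < 4" by simp
  have par: "odd (Suc k mod 4) \<longleftrightarrow> even (k mod 4)" by (simp add: dvd_mod_iff)
  show ?thesis
  proof (cases "odd (k mod 4)")
    case True
    have sg: "csign (Suc k mod 4) = csign (k mod 4)"
    proof -
      have "k mod 4 = 1 \<or> k mod 4 = 3" using True k4 by presburger
      then show ?thesis by (auto simp: csign_def mod_Suc)
    qed
    have i: "d < 0" "int l * d \<le> 2 * d0" "int l * a - csign (k mod 4) > 0" "int l * a - csign (k mod 4) \<ge> 2 * a0"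
      "b \<ge> 0" "2 * b \<ge> int l' * b0 + csign (k mod 4)" "4 * b > int l' * b0 + csign (k mod 4)"
      using inv True unfolding s by auto
    have ld: "int l * d < 0" using i(1) l(1) by (simp add: mult_pos_neg)
    have e: "ea (k mod 4) = 1" "eb (k mod 4) = 0" using True by (simp_all add: ea_def eb_def)
    have st: "cstep l l' (k mod 4) s = (d, int l * d - d0, a, int l * a - csign (k mod 4) - a0, b, int l * b - b0)"
      using i(1) True e by (simp add: s Let_def)
    have ev: "\<not> odd (Suc k mod 4)" using par True by simp
    have "int l' * (int l * b - b0) = int l * (int l' * b) - int l' * b0" by (simp add: algebra_simps)
    moreover have "int l * (int l' * b) \<ge> 4 * b" using up i(5) by blast
    \<comment> \<open>Products are replaced by variables, so that the remaining problem is
      linear.\<close>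
    moreover have arith: "p - d0 < 0 \<and> 2 * (p - d0) \<le> p \<and> q - c - a0 > 0 \<and> 2 * (q - c - a0) \<ge> q - c \<and>
      u - c > 0 \<and> u - c \<ge> 2 * b"
      if "p \<le> 2 * d0" "p < 0" "q - c > 0" "q - c \<ge> 2 * a0" "b \<ge> 0" "2 * b \<ge> s + c" "4 * b > s + c"
        "u = t - s" "t \<ge> 4 * b" for p q s t u c :: int
      using that by auto
    ultimately have "int l * d - d0 < 0 \<and> 2 * (int l * d - d0) \<le> int l * d \<and>
      int l * a - csign (k mod 4) - a0 > 0 \<and> 2 * (int l * a - csign (k mod 4) - a0) \<ge> int l * a - csign (k mod 4) \<and>
      int l' * (int l * b - b0) - csign (k mod 4) > 0 \<and> int l' * (int l * b - b0) - csign (k mod 4) \<ge> 2 * b"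
      by (intro arith[OF i(2) ld i(3-7)])
    then show ?thesis unfolding st cinv.simps sg using ev by (simp only: if_False)
  next
    case False
    have sg: "csign (Suc k mod 4) = - csign (k mod 4)"
    proof -
      have "k mod 4 = 0 \<or> k mod 4 = 2" using False k4 by presburger
      then show ?thesis by (auto simp: csign_def mod_Suc)
    qed
    have i: "d < 0" "2 * d \<le> int l * d0" "a > 0" "2 * a \<ge> int l * a0 - csign (k mod 4)"
      "int l' * b - csign (k mod 4) > 0" "int l' * b - csign (k mod 4) \<ge> 2 * b0"
      using inv False unfolding s by auto
    have e: "ea (k mod 4) = 0" "eb (k mod 4) = 1" using False by (simp_all add: ea_def eb_def)
    have st: "cstep l l' (k mod 4) s = (d, int l' * d - d0, a, int l' * a - a0, b, int l' * b - csign (k mod 4) - b0)"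
      using i(1) False e by (simp add: s Let_def)
    have od: "odd (Suc k mod 4)" using par False by simp
    have D: "int l * (int l' * d - d0) \<le> 2 * d"
    proof -
      have "int l * (int l' * d - d0) = int l * (int l' * d) - int l * d0" by (simp add: algebra_simps)
      moreover have "int l * (int l' * d) \<le> 4 * d" using down i(1) by simp
      ultimately show ?thesis using i by linarith
    qed
    have "int l * (int l' * d - d0) < 0" using D i(1) by linarith
    then have D': "int l' * d - d0 < 0" by (rule negl)
    have A: "int l * (int l' * a - a0) \<ge> 4 * a - int l * a0"
    proof -
      have "int l * (int l' * a - a0) = int l * (int l' * a) - int l * a0" by (simp add: algebra_simps)
      moreover have "int l * (int l' * a) \<ge> 4 * a" using up i(3) by simp
      ultimately show ?thesis by linarith
    qed
    have "int l' * d - d0 < 0 \<and> int l * (int l' * d - d0) \<le> 2 * d \<and>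
      int l * (int l' * a - a0) + csign (k mod 4) > 0 \<and> int l * (int l' * a - a0) + csign (k mod 4) \<ge> 2 * a \<and>
      int l' * b - csign (k mod 4) - b0 \<ge> 0 \<and> 2 * (int l' * b - csign (k mod 4) - b0) \<ge> int l' * b - csign (k mod 4) \<and>
      4 * (int l' * b - csign (k mod 4) - b0) > int l' * b - csign (k mod 4)"
    proof -
      have "w - b0 \<ge> 0 \<and> 2 * (w - b0) \<ge> w \<and> 4 * (w - b0) > w" if "w > 0" "w \<ge> 2 * b0" for w
        using that by auto
      from this[OF i(5,6)] show ?thesis using D D' A i(3,4) by (intro conjI) auto
    qed
    then show ?thesis unfolding st cinv.simps sg using od by simp
  qed
qed

lemma cgood_cseq:
  assumes "l \<ge> 1" "l' \<ge> 1"
  shows "cgood l l' (Suc k mod 4) (cseq l l' k)"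
proof (cases "l * l' \<ge> 4")
  case True
  have 1: "cseq l l' (Suc 0) = (1, 1, 0, 0, 0, 0)" by (simp add: Let_def)
  have 2: "cseq l l' (Suc (Suc 0)) = (1, - 1, 0, 0, 0, 0)"
    by (subst cseq.simps(2), subst 1) (simp add: Let_def)
  \<comment> \<open>x_1 and x_2 have positive degree, so the invariant starts with the pair of x_2
    and x_3.\<close>
  have "cinv l l' (Suc (Suc (Suc k)) mod 4) (cseq l l' (Suc (Suc k)))" for k
  proof (induction k)
    case 0
    show ?case unfolding 2 by (simp add: csign_def)
  next
    case (Suc k)
    then show ?case using cinv_cstep[OF Suc assms True] by (simp only: cseq.simps)
  qed
  then have "cgood l l' (Suc (Suc (Suc k)) mod 4) (cseq l l' (Suc (Suc k)))" for k
    using assms by (intro cinv_cgood)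
  moreover have "cgood l l' (Suc 0 mod 4) (cseq l l' 0)" by (simp add: Let_def)
  moreover have "cgood l l' (Suc (Suc 0) mod 4) (cseq l l' (Suc 0))" unfolding 1 by (simp add: Let_def)
  moreover obtain j where "k = 0 \<or> k = Suc 0 \<or> k = Suc (Suc j)" by (metis not0_implies_Suc)
  ultimately show ?thesis by blast
next
  case False
  have "l \<le> 3" "l' \<le> 3"
    using False assms mult_le_mono[of 4 l 1 l'] mult_le_mono[of 1 l 4 l'] by linarith+
  then have "l \<in> {1, 2, 3}" "l' \<in> {1, 2, 3}" using assms by auto
  then have "(l, l') \<in> {(1, 1), (1, 2), (2, 1), (1, 3), (3, 1)}" using False by auto
  then show ?thesis by (rule cgood_finite_type)
qed

lemma ea_mod [simp]: "ea (k mod 4) = ea k" and eb_mod [simp]: "eb (k mod 4) = eb k"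
  by (simp_all add: ea_def eb_def dvd_mod_iff)

lemma ea_eb_nonneg [simp]: "ea k \<ge> 0" "eb k \<ge> 0"
  by (simp_all add: ea_def eb_def)

lemma pointed_power:
  assumes "pointed X m"
  shows "\<exists>m'. pointed (X ^ n) m' \<and> total_degree m' = int n * total_degree m"
proof (induction n)
  case 0
  show ?case by (rule exI[of _ 0]) simp
next
  case (Suc n)
  then obtain m' where m': "pointed (X ^ n) m'" "total_degree m' = int n * total_degree m" by blast
  show ?case
    by (rule exI[of _ "m + m'"]) (use pointed_mult[OF assms m'(1)] m'(2) in \<open>simp add: algebra_simps\<close>)
qed

context exchange
begin

definition var_deg :: "nat \<Rightarrow> nat \<Rightarrow> int" where
  "var_deg i k = fst (cseq (ll i) (ll (3 - i)) k)"

definition expA :: "nat \<Rightarrow> nat \<Rightarrow> int" where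
  "expA i k = fst (snd (snd (cseq (ll i) (ll (3 - i)) k)))"

definition expB :: "nat \<Rightarrow> nat \<Rightarrow> int" where
  "expB i k = fst (snd (snd (snd (snd (cseq (ll i) (ll (3 - i)) k)))))"

text \<open>At odd positions both sequences use P_i: for i = 2 the k-th member is x_{3-k}, and 3 - k
  has the parity opposite to k.\<close>

definition idx :: "nat \<Rightarrow> nat \<Rightarrow> nat" where
  "idx i k = (if odd k then i else 3 - i)"

text \<open>The unit p_{i,l_i}^a p_{3-i,l_{3-i}}^b among the Laurent coefficients; it lies in R for
  nonnegative exponents.\<close>

definition top_mon :: "nat \<Rightarrow> int \<Rightarrow> int \<Rightarrow> 'k pcoeff" where
  "top_mon i a b = sgl (sgl (prod_encode (i, ll i)) a
     + sgl (prod_encode (3 - i, ll (3 - i))) b) 1"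

text \<open>
  Two sequences of cluster variables are treated at once: the k-th member is x_k for \<open>i = 1\<close> and
  x_{3-k} for \<open>i = 2\<close>. The coefficient of z^j in the exchange polynomial at its k-th member is
  \<open>exch_coeff i k j\<close>.
\<close>

definition exch_coeff :: "nat \<Rightarrow> nat \<Rightarrow> nat \<Rightarrow> 'k pcoeff" where
  "exch_coeff i k j = (if k mod 4 = 1 \<or> k mod 4 = 2 then pcf (idx i k) j
     else top_mon i (- ea k) (- eb k) * pcf (idx i k) (ll (idx i k) - j))"

lemma cseq_eq:
  "cseq (ll i) (ll (3 - i)) k = (var_deg i k, var_deg i (Suc k), expA i k, expA i (Suc k), expB i k, expB i (Suc k))"
  by (cases "cseq (ll i) (ll (3 - i)) k") (simp add: var_deg_def expA_def expB_def Let_def)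

lemma exps_rec:
  "var_deg i (Suc (Suc k)) = (if var_deg i (Suc k) > 0 then 0 else int (ll (idx i (Suc k))) * var_deg i (Suc k)) - var_deg i k"
  "expA i (Suc (Suc k)) = (if var_deg i (Suc k) > 0 then 0
     else int (ll (idx i (Suc k))) * expA i (Suc k) - csign (Suc k mod 4) * ea (Suc k)) - expA i k"
  "expB i (Suc (Suc k)) = (if var_deg i (Suc k) > 0 then 0
     else int (ll (idx i (Suc k))) * expB i (Suc k) - csign (Suc k mod 4) * eb (Suc k)) - expB i k"
proof -
  have par: "odd (Suc k mod 4) = odd (Suc k)" by (simp add: dvd_mod_iff)
  have "cseq (ll i) (ll (3 - i)) (Suc k) = cstep (ll i) (ll (3 - i)) (Suc k mod 4) (cseq (ll i) (ll (3 - i)) k)"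
    by simp
  from this[unfolded cseq_eq cstep.simps Let_def par ea_mod eb_mod]
  have *: "var_deg i (Suc (Suc k)) = (if var_deg i (Suc k) > 0 then 0 else int (if odd (Suc k) then ll i else ll (3 - i)) * var_deg i (Suc k)) - var_deg i k"
    "expA i (Suc (Suc k)) = (if var_deg i (Suc k) > 0 then 0 else int (if odd (Suc k) then ll i else ll (3 - i)) * expA i (Suc k) - csign (Suc k mod 4) * ea (Suc k)) - expA i k"
    "expB i (Suc (Suc k)) = (if var_deg i (Suc k) > 0 then 0 else int (if odd (Suc k) then ll i else ll (3 - i)) * expB i (Suc k) - csign (Suc k mod 4) * eb (Suc k)) - expB i k"
    by blast+
  have L: "(if odd (Suc k) then ll i else ll (3 - i)) = ll (idx i (Suc k))" by (simp add: idx_def)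
  show "var_deg i (Suc (Suc k)) = (if var_deg i (Suc k) > 0 then 0 else int (ll (idx i (Suc k))) * var_deg i (Suc k)) - var_deg i k"
    "expA i (Suc (Suc k)) = (if var_deg i (Suc k) > 0 then 0
     else int (ll (idx i (Suc k))) * expA i (Suc k) - csign (Suc k mod 4) * ea (Suc k)) - expA i k"
    "expB i (Suc (Suc k)) = (if var_deg i (Suc k) > 0 then 0
     else int (ll (idx i (Suc k))) * expB i (Suc k) - csign (Suc k mod 4) * eb (Suc k)) - expB i k"
    using * unfolding L by blast+
qed

lemma exps_init:
  "var_deg i 0 = - 1" "var_deg i (Suc 0) = 1" "expA i 0 = 0" "expA i (Suc 0) = 0" "expB i 0 = 0" "expB i (Suc 0) = 0"
  by (simp_all add: var_deg_def expA_def expB_def Let_def)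

lemma exps_good:
  fixes i k :: nat
  defines "d \<equiv> var_deg i (Suc k)" and "a \<equiv> expA i (Suc k)" and "b \<equiv> expB i (Suc k)" and "r \<equiv> Suc k mod 4"
    and "L \<equiv> ll (idx i (Suc k))"
  shows "d \<noteq> 0"
    "d > 0 \<Longrightarrow> r = 1 \<or> r = 2 \<Longrightarrow> a \<le> 0 \<and> b \<le> 0 \<or> L = 1 \<and> a \<le> ea (Suc k) \<and> b \<le> eb (Suc k)"
    "d > 0 \<Longrightarrow> \<not> (r = 1 \<or> r = 2) \<Longrightarrow> a \<le> - ea (Suc k) \<and> b \<le> - eb (Suc k)"
    "d < 0 \<Longrightarrow> r = 1 \<or> r = 2 \<Longrightarrow> a \<ge> ea (Suc k) \<and> b \<ge> eb (Suc k)"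
    "d < 0 \<Longrightarrow> \<not> (r = 1 \<or> r = 2) \<Longrightarrow> a \<ge> 0 \<and> b \<ge> 0 \<or> L = 1 \<and> a \<ge> - ea (Suc k) \<and> b \<ge> - eb (Suc k)"
proof -
  have par: "odd (Suc k mod 4) = odd (Suc k)" by (simp add: dvd_mod_iff)
  have L: "(if odd (Suc k) then ll i else ll (3 - i)) = L" by (simp add: idx_def L_def)
  have "cgood (ll i) (ll (3 - i)) (Suc k mod 4) (cseq (ll i) (ll (3 - i)) k)"
    using ll_pos by (intro cgood_cseq) auto
  from this[unfolded cseq_eq cgood.simps Let_def par ea_mod eb_mod L, folded d_def a_def b_def r_def]
  have *: "d \<noteq> 0 \<and>
     (if d > 0 then
        if r = 1 \<or> r = 2 then a \<le> 0 \<and> b \<le> 0 \<or> L = 1 \<and> a \<le> ea (Suc k) \<and> b \<le> eb (Suc k)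
        else a \<le> - ea (Suc k) \<and> b \<le> - eb (Suc k)
      else
        if r = 1 \<or> r = 2 then a \<ge> ea (Suc k) \<and> b \<ge> eb (Suc k)
        else a \<ge> 0 \<and> b \<ge> 0 \<or> L = 1 \<and> a \<ge> - ea (Suc k) \<and> b \<ge> - eb (Suc k))" .
  show "d \<noteq> 0" using * by blast
  show "d > 0 \<Longrightarrow> r = 1 \<or> r = 2 \<Longrightarrow> a \<le> 0 \<and> b \<le> 0 \<or> L = 1 \<and> a \<le> ea (Suc k) \<and> b \<le> eb (Suc k)"
    using * by (simp only: if_True)
  show "d > 0 \<Longrightarrow> \<not> (r = 1 \<or> r = 2) \<Longrightarrow> a \<le> - ea (Suc k) \<and> b \<le> - eb (Suc k)"
    using * by (simp only: if_True if_False)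
  show "d < 0 \<Longrightarrow> r = 1 \<or> r = 2 \<Longrightarrow> a \<ge> ea (Suc k) \<and> b \<ge> eb (Suc k)"
    using * by (metis not_less_iff_gr_or_eq)
  show "d < 0 \<Longrightarrow> \<not> (r = 1 \<or> r = 2) \<Longrightarrow> a \<ge> 0 \<and> b \<ge> 0 \<or> L = 1 \<and> a \<ge> - ea (Suc k) \<and> b \<ge> - eb (Suc k)"
    using * by (metis not_less_iff_gr_or_eq)
qed

lemma top_mon_0 [simp]: "top_mon i 0 0 = 1" by (simp add: top_mon_def)

lemma top_mon_mult: "top_mon i a b * top_mon i c d = top_mon i (a + c) (b + d)"
  by (simp add: top_mon_def mult_single single_add algebra_simps)

lemma top_mon_power: "top_mon i a b ^ n = top_mon i (int n * a) (int n * b)"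
  by (induction n) (simp_all add: top_mon_mult algebra_simps)

lemma pcf_top: "pcf n (ll n) = pgen n (ll n)" using ll_pos[of n] by (simp add: pcf_def)

lemma pcf_top_idx: "i = 1 \<or> i = 2 \<Longrightarrow> pcf (idx i k) (ll (idx i k)) = top_mon i (ea k) (eb k)"
  unfolding pcf_top by (simp add: idx_def top_mon_def ea_def eb_def pgen_def)

lemma idx_12: "i = 1 \<or> i = 2 \<Longrightarrow> idx i k = 1 \<or> idx i k = 2" by (auto simp: idx_def)

lemma top_mon_in_pring: assumes i: "i = 1 \<or> i = 2" and "a \<ge> 0" "b \<ge> 0" shows "top_mon i a b \<in> pring"
proof -
  have "top_mon i a b = top_mon i 1 0 ^ nat a * top_mon i 0 1 ^ nat b" using assms by (simp add: top_mon_power top_mon_mult)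
  moreover have "top_mon i 1 0 = pcf i (ll i)" "top_mon i 0 1 = pcf (3 - i) (ll (3 - i))"
    using pcf_top_idx[OF i, of 1] pcf_top_idx[OF i, of 2] by (simp_all add: idx_def ea_def eb_def)
  moreover have "3 - i = 1 \<or> 3 - i = 2" using i by auto
  ultimately show ?thesis using i by auto
qed

lemma exch_coeff_0: "i = 1 \<or> i = 2 \<Longrightarrow> exch_coeff i k 0 = 1"
  by (simp add: exch_coeff_def pcf_top_idx top_mon_mult)

text \<open>\<open>X\<close> is the normalized variable, already with coefficients in R and with the
  predicted lowest degree.\<close>

definition pointed_at :: "nat \<Rightarrow> nat \<Rightarrow> 'k laurent \<Rightarrow> bool" where
  "pointed_at i k x \<longleftrightarrow> (\<exists>X m. x = scal (top_mon i (- expA i k) (- expB i k)) * X \<and> X \<in> laurent_over pring \<and> pointed X m \<and> total_degree m = var_deg i k)"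

text \<open>
  Up to the unit \<open>u\<close> below, the exchange polynomial evaluated at the k-th cluster variable has
  coefficients in \<open>pring\<close>, the one of the lowest term (constant or leading) being 1.
\<close>

lemma normalized_exchange_coeffs:
  fixes i k :: nat
  assumes i: "i = 1 \<or> i = 2"
  defines "L \<equiv> ll (idx i (Suc k))" and "a \<equiv> expA i (Suc k)" and "b \<equiv> expB i (Suc k)"
  defines "u \<equiv> top_mon i (expA i (Suc (Suc k)) + expA i k) (expB i (Suc (Suc k)) + expB i k)"
  defines "\<psi> \<equiv> \<lambda>j. u * exch_coeff i (Suc k) j * top_mon i (- a) (- b) ^ j"
  shows "j \<le> L \<Longrightarrow> \<psi> j \<in> pring" "var_deg i (Suc k) > 0 \<Longrightarrow> \<psi> 0 = 1" "var_deg i (Suc k) < 0 \<Longrightarrow> \<psi> L = 1"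
proof -
  let ?d = "var_deg i (Suc k)" and ?r = "Suc k mod 4" and ?n = "idx i (Suc k)" and ?e = "ea (Suc k)" and ?f = "eb (Suc k)"
  note rec = exps_rec[of i k, folded L_def a_def b_def]
  note good = exps_good[of i k, folded L_def a_def b_def]
  have n: "?n = 1 \<or> ?n = 2" using idx_12[OF i] .
  have top: "pcf ?n L = top_mon i ?e ?f" unfolding L_def by (rule pcf_top_idx[OF i])
  have L1: "L \<ge> 1" unfolding L_def by (rule ll_pos)
  have scale: "int j * x \<ge> c" if "j \<ge> 1" "x \<ge> c" "c \<ge> 0" for j x c
    using mult_mono[of 1 "int j" x x] that by simp
  have all: "(j \<le> L \<longrightarrow> \<psi> j \<in> pring) \<and> (?d > 0 \<longrightarrow> \<psi> 0 = 1) \<and> (?d < 0 \<longrightarrow> \<psi> L = 1)" for j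
  proof (cases "?d > 0")
    case True
    then have u: "u = 1" unfolding u_def using rec by simp
    show ?thesis
    proof (cases "?r = 1 \<or> ?r = 2")
      case r: True
      then have psi: "\<psi> j = pcf ?n j * top_mon i (- (int j * a)) (- (int j * b))" for j
        by (simp add: \<psi>_def u exch_coeff_def top_mon_power)
      have "\<psi> j \<in> pring" if "j \<le> L"
      proof (cases "j = 0")
        case False
        from good(2)[OF True r] show ?thesis
        proof
          assume "a \<le> 0 \<and> b \<le> 0"
          then show ?thesis unfolding psi
            using n by (intro pring.mult_closed top_mon_in_pring[OF i]) (auto simp: mult_nonneg_nonpos)
        next
          \<comment> \<open>For L = 1 the leading term is the only one besides the constant term,
            and its own coefficient makes up for an exponent of 1.\<close>
          assume *: "L = 1 \<and> a \<le> ?e \<and> b \<le> ?f"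
          then have "j = L" using that False by simp
          then have "\<psi> j = top_mon i (?e - a) (?f - b)" unfolding psi using * top by (simp add: top_mon_mult)
          then show ?thesis using * by (simp add: top_mon_in_pring[OF i])
        qed
      qed (simp add: psi)
      then show ?thesis using True psi[of 0] by simp
    next
      case r: False
      then have psi: "\<psi> j = pcf ?n (L - j) * top_mon i (- ?e - int j * a) (- ?f - int j * b)" for j
        by (simp add: \<psi>_def u exch_coeff_def top_mon_power L_def top_mon_mult mult_ac)
      have "\<psi> 0 = 1" unfolding psi by (simp add: top top_mon_mult)
      moreover have "\<psi> j \<in> pring" if "j \<ge> 1"
      proof -
        have "int j * - a \<ge> ?e" "int j * - b \<ge> ?f" using good(3)[OF True r] that by (intro scale; simp)+
        then show ?thesis unfolding psi using n by (intro pring.mult_closed top_mon_in_pring[OF i]) auto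
      qed
      ultimately show ?thesis using True by (cases "j = 0") auto
    qed
  next
    case False
    then have d: "?d < 0" using good(1) by simp
    then have u: "u = top_mon i (int L * a - csign ?r * ?e) (int L * b - csign ?r * ?f)"
      unfolding u_def using rec by simp
    show ?thesis
    proof (cases "?r = 1 \<or> ?r = 2")
      case r: True
      then have psi: "\<psi> j = pcf ?n j * top_mon i (int (L - j) * a - ?e) (int (L - j) * b - ?f)" if "j \<le> L" for j
        using that by (simp add: \<psi>_def u exch_coeff_def top_mon_power csign_def mult_ac)
          (simp add: top_mon_mult mult.left_commute[of _ "pcf ?n j"] of_nat_diff algebra_simps)
      have "\<psi> L = 1" unfolding psi[OF order_refl] by (simp add: top top_mon_mult)
      moreover have "\<psi> j \<in> pring" if "j < L"
      proof -
        have "int (L - j) * a \<ge> ?e" "int (L - j) * b \<ge> ?f"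
          using good(4)[OF d r] that by (intro scale; simp)+
        then show ?thesis unfolding psi[OF less_imp_le[OF that]] using n by (intro pring.mult_closed top_mon_in_pring[OF i]) auto
      qed
      ultimately show ?thesis using d by (cases "j = L") auto
    next
      case r: False
      then have psi: "\<psi> j = pcf ?n (L - j) * top_mon i (int (L - j) * a) (int (L - j) * b)" if "j \<le> L" for j
        using that by (simp add: \<psi>_def u exch_coeff_def top_mon_power csign_def L_def[symmetric] mult_ac)
          (simp add: top_mon_mult mult.left_commute[of _ "pcf ?n (L - j)"] of_nat_diff algebra_simps)
      have "\<psi> L = 1" unfolding psi[OF order_refl] by simp
      moreover have "\<psi> j \<in> pring" if "j < L"
      proof -
        from good(5)[OF d r] show ?thesis
        proof
          assume "0 \<le> a \<and> 0 \<le> b"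
          then show ?thesis unfolding psi[OF less_imp_le[OF that]]
            using n by (intro pring.mult_closed top_mon_in_pring[OF i]) auto
        next
          assume *: "L = 1 \<and> - ?e \<le> a \<and> - ?f \<le> b"
          then have "j = 0" using that by simp
          then have "\<psi> j = top_mon i (?e + a) (?f + b)" using psi[of 0] * top by (simp add: top_mon_mult)
          then show ?thesis using * by (simp add: top_mon_in_pring[OF i])
        qed
      qed
      ultimately show ?thesis using d by (cases "j = L") auto
    qed
  qed
  show "j \<le> L \<Longrightarrow> \<psi> j \<in> pring" "?d > 0 \<Longrightarrow> \<psi> 0 = 1" "?d < 0 \<Longrightarrow> \<psi> L = 1" using all by blast+
qed

text \<open>Normalizing all three variables turns the exchange relation into
  \<open>Y * X0 = h\<close> with \<open>h\<close> over R and pointed, its lowest term coming from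
  the constant term of the polynomial if d > 0 and from the leading one if d < 0. The two quotient
  lemmas then apply to \<open>Y\<close>.\<close>

lemma pointed_at_step:
  assumes i: "i = 1 \<or> i = 2" and x0: "pointed_at i k x0" and x1: "pointed_at i (Suc k) x1"
    and rel: "y * x0 = (\<Sum>j\<le>ll (idx i (Suc k)). scal (exch_coeff i (Suc k) j) * x1 ^ j)"
  shows "pointed_at i (Suc (Suc k)) y"
proof -
  define L where "L = ll (idx i (Suc k))"
  define d where "d = var_deg i (Suc k)"
  obtain X0 m0 where X0: "x0 = scal (top_mon i (- expA i k) (- expB i k)) * X0" "X0 \<in> laurent_over pring" "pointed X0 m0" "total_degree m0 = var_deg i k"
    using x0 unfolding pointed_at_def by blast
  obtain X1 m1 where X1: "x1 = scal (top_mon i (- expA i (Suc k)) (- expB i (Suc k))) * X1" "X1 \<in> laurent_over pring" "pointed X1 m1"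
      "total_degree m1 = d"
    using x1 unfolding pointed_at_def d_def by blast
  interpret la: csubring "laurent_over pring" by (simp add: csubring_laurent_over)
  define u where "u = top_mon i (expA i (Suc (Suc k)) + expA i k) (expB i (Suc (Suc k)) + expB i k)"
  define \<psi> where "\<psi> j = u * exch_coeff i (Suc k) j * top_mon i (- expA i (Suc k)) (- expB i (Suc k)) ^ j" for j
  note psi = normalized_exchange_coeffs[OF i, where k = k, folded L_def u_def d_def, folded \<psi>_def]
  define Y where "Y = scal (top_mon i (expA i (Suc (Suc k))) (expB i (Suc (Suc k)))) * y"
  define h where "h = (\<Sum>j\<le>L. scal (\<psi> j) * X1 ^ j)"
  have Yy: "y = scal (top_mon i (- expA i (Suc (Suc k))) (- expB i (Suc (Suc k)))) * Y"
    unfolding Y_def by (simp add: mult.assoc[symmetric] scal_mult[symmetric] top_mon_mult)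
  have "Y * X0 = scal u * (y * x0)"
    unfolding Y_def X0(1) u_def
    by (simp add: mult_ac, simp add: mult.assoc[symmetric] scal_mult[symmetric] top_mon_mult)
  also have "\<dots> = h"
    unfolding rel L_def[symmetric] sum_distrib_left h_def \<psi>_def X1(1)
    by (simp add: scal_mult scal_power power_mult_distrib mult_ac)
  finally have YX: "Y * X0 = h" .
  have hl: "h \<in> laurent_over pring"
    unfolding h_def using psi(1) X1(2) by (intro la.sum_closed la.mult_closed la.power_closed scal_in_laurent_over) auto
  have lowX: "deg_ge (X1 ^ j) (int j * d)" for j
    using pointed_power[OF X1(3), of j] pointed_deg_ge X1(4) by metis
  have "\<exists>mh. pointed h mh \<and> total_degree mh = (if d > 0 then 0 else int L * d)"
  proof (cases "d > 0")
    case True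
    have "{..L} = insert 0 {1..L}" by auto
    then have h: "h = 1 + (\<Sum>j\<in>{1..L}. scal (\<psi> j) * X1 ^ j)" unfolding h_def using psi(2)[OF True] by simp
    have "deg_ge (\<Sum>j\<in>{1..L}. scal (\<psi> j) * X1 ^ j) (total_degree 0 + 1)"
    proof (intro deg_ge_sum deg_ge_scal_mult deg_ge_mono[OF lowX])
      fix j assume "j \<in> {1..L}"
      then show "total_degree 0 + 1 \<le> int j * d" using True mult_mono[of 1 "int j" 1 d] by simp
    qed
    then have "pointed h 0" unfolding h by (intro pointed_add_deg_ge) auto
    then show ?thesis using True by auto
  next
    case False
    \<comment> \<open>Degree 0 is excluded; it would put all powers of \<open>X1\<close> into the
      same lowest degree.\<close>
    then have dn: "d < 0" using exps_good(1)[of i k] unfolding d_def by linarith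
    obtain mh where mh: "pointed (X1 ^ L) mh" "total_degree mh = int L * d" using pointed_power[OF X1(3), of L] X1(4) by auto
    have "h = X1 ^ L + (\<Sum>j<L. scal (\<psi> j) * X1 ^ j)"
      unfolding h_def using psi(3)[OF dn] by (simp flip: lessThan_Suc_atMost)
    moreover have "deg_ge (\<Sum>j<L. scal (\<psi> j) * X1 ^ j) (total_degree mh + 1)"
    proof (intro deg_ge_sum deg_ge_scal_mult deg_ge_mono[OF lowX])
      fix j assume "j \<in> {..<L}"
      then have "int (L - j) * d \<le> 1 * d" "int (L - j) = int L - int j" using dn by (auto intro!: mult_right_mono_neg[of 1 _ d, simplified])
      then have "int L * d - int j * d \<le> d" by (simp add: left_diff_distrib)
      then show "total_degree mh + 1 \<le> int j * d" using dn mh(2) by linarith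
    qed
    ultimately have "pointed h mh" using mh(1) by (simp add: pointed_add_deg_ge)
    then show ?thesis using mh(2) False by auto
  qed
  then obtain mh where mh: "pointed h mh" "total_degree mh = (if d > 0 then 0 else int L * d)" by blast
  have "pointed Y (mh - m0)" by (rule pointed_quotient[OF YX X0(3) mh(1)])
  moreover have "total_degree (mh - m0) = var_deg i (Suc (Suc k))"
    using mh(2) X0(4) exps_rec(1)[of i k] by (simp add: L_def d_def)
  moreover have "Y \<in> laurent_over pring" by (rule laurent_over_quotient[OF csubring_pring YX X0(3) X0(2) hl])
  ultimately show ?thesis unfolding pointed_at_def using Yy by blast
qed

text \<open>
  Modulo \<open>t2\<close>, the elements \<open>t1\<close> and \<open>t3\<close> are inverse to each other, so that the exchange relation
  at \<open>t1\<close> shows that \<open>t2\<close> divides the reversed polynomial at \<open>t3\<close>.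
\<close>

lemma lower_alg_step:
  assumes i: "i = 1 \<or> i = 2"
    and t: "t0 \<in> lower_alg UNIV" "t1 \<in> lower_alg UNIV" "t2 \<in> lower_alg UNIV" "t3 \<in> lower_alg UNIV"
    and r1: "t2 * t0 = (\<Sum>j\<le>ll (idx i k). scal (exch_coeff i k j) * t1 ^ j)"
    and r2: "t3 * t1 = (\<Sum>j\<le>ll (idx i (Suc k)). scal (exch_coeff i (Suc k) j) * t2 ^ j)"
  shows "\<exists>y\<in>lower_alg UNIV. y * t2 = (\<Sum>j\<le>ll (idx i (Suc (Suc k))). scal (exch_coeff i (Suc (Suc k)) j) * t3 ^ j)"
proof -
  interpret T: csubring "lower_alg UNIV" by simp
  have ccT: "scal c \<in> lower_alg UNIV" for c by (simp add: lower_alg_gens)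
  define L where "L = ll (idx i k)"
  define M where "M = ll (idx i (Suc k))"
  define w where "w = (\<Sum>j<M. scal (exch_coeff i (Suc k) (Suc j)) * t2 ^ j)"
  have "t3 * t1 = (\<Sum>j<Suc M. scal (exch_coeff i (Suc k) j) * t2 ^ j)" unfolding r2 M_def by (simp only: lessThan_Suc_atMost)
  also have "\<dots> = 1 + t2 * w"
    unfolding sum.lessThan_Suc_shift w_def sum_distrib_left using exch_coeff_0[OF i] by (simp add: mult_ac)
  finally have t31: "t3 * t1 = 1 + t2 * w" .
  have w: "w \<in> lower_alg UNIV" unfolding w_def using t ccT by (intro T.sum_closed T.mult_closed T.power_closed)
  have "\<forall>j. \<exists>w'. w' \<in> lower_alg UNIV \<and> (1 + t2 * w) ^ j = 1 + t2 * w'"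
    using T.one_plus_mult_power[OF t(3) w] by blast
  from choice[OF this] obtain ws where ws: "\<And>j. ws j \<in> lower_alg UNIV" "\<And>j. (1 + t2 * w) ^ j = 1 + t2 * ws j" by blast
  \<comment> \<open>Multiplying by \<open>t3 ^ L\<close> makes \<open>t1\<close> occur only in
    products \<open>t3 * t1\<close>, which are 1 modulo \<open>t2\<close>.\<close>
  have "t3 ^ L * (t2 * t0) = (\<Sum>j\<le>L. scal (exch_coeff i k j) * t3 ^ (L - j) * (t3 * t1) ^ j)"
    unfolding r1 L_def[symmetric] sum_distrib_left
  proof (rule sum.cong[OF refl])
    fix j assume "j \<in> {..L}"
    then have "t3 ^ L = t3 ^ (L - j) * t3 ^ j" by (simp flip: power_add)
    then show "t3 ^ L * (scal (exch_coeff i k j) * t1 ^ j) = scal (exch_coeff i k j) * t3 ^ (L - j) * (t3 * t1) ^ j"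
      by (simp add: power_mult_distrib mult_ac)
  qed
  also have "\<dots> = (\<Sum>j\<le>L. scal (exch_coeff i k j) * t3 ^ (L - j)) + t2 * (\<Sum>j\<le>L. scal (exch_coeff i k j) * t3 ^ (L - j) * ws j)"
    unfolding t31 ws(2) sum_distrib_left sum.distrib[symmetric] by (intro sum.cong) (auto simp: algebra_simps)
  finally have div: "(\<Sum>j\<le>L. scal (exch_coeff i k j) * t3 ^ (L - j)) = t2 * (t3 ^ L * t0 - (\<Sum>j\<le>L. scal (exch_coeff i k j) * t3 ^ (L - j) * ws j))"
    by (simp add: algebra_simps)
  have idx2: "idx i (Suc (Suc k)) = idx i k" by (simp add: idx_def)
  \<comment> \<open>Two positions later the exchange polynomial is the reversed one, up to this
    unit.\<close>
  define v where "v = (if k mod 4 = 1 \<or> k mod 4 = 2 then top_mon i (- ea k) (- eb k) else top_mon i (ea k) (eb k))"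
  have ck2: "exch_coeff i (Suc (Suc k)) j = v * exch_coeff i k (L - j)" if "j \<le> L" for j
  proof -
    have e2: "ea (Suc (Suc k)) = ea k" "eb (Suc (Suc k)) = eb k" by (simp_all add: ea_def eb_def)
    consider "k mod 4 = 0" | "k mod 4 = 1" | "k mod 4 = 2" | "k mod 4 = 3" by linarith
    then show ?thesis
      using that by cases (simp_all add: exch_coeff_def v_def idx2 e2 mod_Suc L_def[symmetric] mult.assoc[symmetric] top_mon_mult)
  qed
  have "(\<Sum>j\<le>ll (idx i (Suc (Suc k))). scal (exch_coeff i (Suc (Suc k)) j) * t3 ^ j) = (\<Sum>j\<le>L. scal v * (scal (exch_coeff i k (L - j)) * t3 ^ j))"
    unfolding idx2 L_def[symmetric] using ck2 by (intro sum.cong) (auto simp: scal_mult mult_ac)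
  also have "\<dots> = scal v * (\<Sum>j\<le>L. scal (exch_coeff i k (L - j)) * t3 ^ j)" by (simp add: sum_distrib_left)
  also have "(\<Sum>j\<le>L. scal (exch_coeff i k (L - j)) * t3 ^ j) = (\<Sum>j\<le>L. scal (exch_coeff i k j) * t3 ^ (L - j))"
    by (rule sum.reindex_bij_witness[of _ "\<lambda>j. L - j" "\<lambda>j. L - j"]) auto
  finally have "(\<Sum>j\<le>ll (idx i (Suc (Suc k))). scal (exch_coeff i (Suc (Suc k)) j) * t3 ^ j)
      = (scal v * (t3 ^ L * t0 - (\<Sum>j\<le>L. scal (exch_coeff i k j) * t3 ^ (L - j) * ws j))) * t2"
    unfolding div by (simp add: mult_ac)
  moreover have "scal v * (t3 ^ L * t0 - (\<Sum>j\<le>L. scal (exch_coeff i k j) * t3 ^ (L - j) * ws j)) \<in> lower_alg UNIV"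
    using t ws(1) ccT by (intro T.mult_closed T.diff_closed T.sum_closed T.power_closed)
  ultimately show ?thesis by (intro bexI) (rule sym)
qed

end

subsection \<open>Transfer to the field of fractions\<close>

lemma to_fract_power [simp]: "to_fract (x ^ n) = to_fract x ^ n"
  by (induction n) simp_all

lemma to_fract_prod [simp]: "to_fract (prod f S) = (\<Prod>i\<in>S. to_fract (f i))"
  by (induction S rule: infinite_finite_induct) simp_all

lemma emb_coeff_scal: "emb_coeff c = to_fract (scal c)"
  by (simp add: emb_coeff_def scal_def)

lemma xvar_xpow: "xvar i = to_fract (xpow i 1)"
  by (simp add: xvar_def xpow_def)

lemma pvar_pgen: "pvar i j = to_fract (scal (pgen i j))"
  by (simp add: pvar_def emb_coeff_scal pgen_def)

lemma const_scal: "const a = to_fract (scal (sgl 0 a))"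
  by (simp add: const_def emb_coeff_scal)

lemma power_int_to_fract:
  assumes "u * v = 1"
  shows "to_fract u powi k = to_fract (if k \<ge> 0 then u ^ nat k else v ^ nat (- k))"
proof -
  have "to_fract u * to_fract v = to_fract (u * v)" by simp
  then have "to_fract u * to_fract v = 1" using assms by simp
  then have "inverse (to_fract u) = to_fract v" by (rule inverse_unique)
  then show ?thesis by (simp add: power_int_def flip: power_inverse)
qed

lemma xvar_powi: "xvar i powi k = to_fract (xpow i k)"
  unfolding xvar_xpow by (subst power_int_to_fract[of _ "xpow i (- 1)"]) (auto simp: xpow_power)

lemma pvar_nonzero: "pvar i j \<noteq> 0"
proof -
  have "coef (scal (pgen i j)) 0 = pgen i j" "pgen i j \<noteq> 0"
    by (simp_all add: scal_def pgen_def) (metis lookup_single_eq lookup_zero zero_neq_one)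
  then have "scal (pgen i j) \<noteq> 0" by (metis lookup_zero)
  then show ?thesis by (simp add: pvar_pgen)
qed

lemma pcoef_nonzero: "pcoef i l j \<noteq> 0 \<longleftrightarrow> j \<le> l"
  by (simp add: pcoef_def pvar_nonzero)

lemma coeff_exch_poly: "coeff (exch_poly i l) j = pcoef i l j"
proof -
  have "(\<Sum>x=1..l. coeff (monom (pvar i x) x) j) = (if j \<in> {1..l} then pvar i j else 0)"
    by (simp add: coeff_monom)
  then show ?thesis by (simp add: exch_poly_def pcoef_def coeff_sum)
qed

lemma degree_exch_poly: "degree (exch_poly i l) = l"
proof (rule antisym)
  show "degree (exch_poly i l) \<le> l" by (rule degree_le) (auto simp: coeff_exch_poly pcoef_def)
  show "l \<le> degree (exch_poly i l)" by (rule le_degree) (simp add: coeff_exch_poly pcoef_nonzero)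
qed

lemma poly_exch_poly: "poly (exch_poly i l) x = (\<Sum>j\<le>l. pcoef i l j * x ^ j)"
  by (simp add: poly_altdef degree_exch_poly coeff_exch_poly)

lemma poly_exch_poly_bar:
  fixes x :: "'k::field_char_0 laurent fract"
  shows "poly (exch_poly_bar i l) x = (\<Sum>j\<le>l. inverse (pvar i l) * pcoef i l (l - j) * x ^ j)"
proof -
  have "degree (reflect_poly (exch_poly i l :: 'k laurent fract poly)) = l"
    by (subst degree_reflect_poly_eq) (simp_all add: coeff_exch_poly degree_exch_poly pcoef_def)
  then show ?thesis
    by (simp add: exch_poly_bar_def poly_altdef coeff_reflect_poly degree_exch_poly coeff_exch_poly sum_distrib_left mult.assoc)
qed

context exchange
begin

lemma pcoef_pcf: "pcoef i (ll i) j = to_fract (scal (pcf i j))"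
  by (simp add: pcoef_def pcf_def pvar_pgen)

lemma coeff_ring_pring: "(coeff_ring (ll 1) (ll 2) :: 'k laurent fract set) = to_fract ` scal ` pring"
proof -
  have "range const \<union> {pvar 1 j | j. 1 \<le> j \<and> j \<le> ll 1} \<union> {pvar 2 j | j. 1 \<le> j \<and> j \<le> ll 2}
    = (\<lambda>c. to_fract (scal c) :: 'k laurent fract) `
       (range (sgl 0) \<union> {pgen i j | i j. (i = 1 \<or> i = 2) \<and> 1 \<le> j \<and> j \<le> ll i})"
    by (auto simp: const_scal pvar_pgen)
  then have "(coeff_ring (ll 1) (ll 2) :: 'k laurent fract set) = (\<lambda>c. to_fract (scal c)) ` pring"
    unfolding coeff_ring_def pring_def
    by (simp only:) (rule subring_gen_image; simp add: scal_diff scal_mult)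
  then show ?thesis by (simp add: image_image)
qed

text \<open>The coefficients of P_i up to its degree are nonzero, so a weight vanishes exactly if
  some value exceeds the degree. Hence \<open>greedy\<close> and \<open>grading_sum\<close> range
  over the same gradings.\<close>

lemma weighted_gradings_eq:
  "weighted_gradings TYPE('k) (ll 1) (ll 2) m n =
     {\<omega> \<in> PiE {..<m + n} (\<lambda>i. {..grade_bound m n i}). compat (m + n) (horiz_edges m n) (vert_edges m n) \<omega>}"
proof -
  note hv = horiz_vert_edges[of m n]
  have fin: "finite (horiz_edges m n)" "finite (vert_edges m n)"
    by (simp_all add: horiz_edges_def vert_edges_def)
  have "grading_weight (ll 1) (ll 2) m n \<omega> \<noteq> (0 :: 'k laurent fract) \<longleftrightarrow> (\<forall>i<m + n. \<omega> i \<le> grade_bound m n i)" for \<omega>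
  proof -
    have "grading_weight (ll 1) (ll 2) m n \<omega> \<noteq> (0 :: 'k laurent fract) \<longleftrightarrow>
      (\<forall>i\<in>horiz_edges m n. \<omega> i \<le> ll 2) \<and> (\<forall>i\<in>vert_edges m n. \<omega> i \<le> ll 1)"
      unfolding grading_weight_def using fin by (simp add: prod_zero_iff pcoef_nonzero)
    also have "\<dots> \<longleftrightarrow> (\<forall>i\<in>horiz_edges m n \<union> vert_edges m n. \<omega> i \<le> grade_bound m n i)"
      using hv(4) unfolding grade_bound_def by (auto simp: disjoint_iff)
    finally show ?thesis unfolding hv(3) by auto
  qed
  then show ?thesis
    unfolding weighted_gradings_def compatible_eq_compat by (auto simp: PiE_iff)
qed

lemma greedy_greedy_laurent: "greedy (ll 1) (ll 2) a1 a2 = to_fract (greedy_laurent (a1, a2))"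
proof -
  define m where "m = nat (max a1 0)"
  define n where "n = nat (max a2 0)"
  note hv = horiz_vert_edges[of m n]
  let ?H = "horiz_edges m n" and ?V = "vert_edges m n"
  have fin: "finite ?H" "finite ?V" by (simp_all add: horiz_edges_def vert_edges_def)
  have trm: "grading_weight (ll 1) (ll 2) m n \<omega> * xvar 1 ^ (\<Sum>v\<in>?V. \<omega> v) * xvar 2 ^ (\<Sum>u\<in>?H. \<omega> u)
    = to_fract (\<Prod>i<m + n. edge_term m n i (\<omega> i))" for \<omega>
  proof -
    have "(\<Prod>i<m + n. edge_term m n i (\<omega> i)) = (\<Prod>i\<in>?H. edge_term m n i (\<omega> i)) * (\<Prod>i\<in>?V. edge_term m n i (\<omega> i))"
      unfolding hv(3)[symmetric] using fin hv(4) by (rule prod.union_disjoint)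
    also have "(\<Prod>i\<in>?H. edge_term m n i (\<omega> i)) = (\<Prod>i\<in>?H. scal (pcf 2 (\<omega> i)) * xpow 2 1 ^ \<omega> i)"
      by (intro prod.cong) (auto simp: edge_term_def)
    also have "(\<Prod>i\<in>?V. edge_term m n i (\<omega> i)) = (\<Prod>i\<in>?V. scal (pcf 1 (\<omega> i)) * xpow 1 1 ^ \<omega> i)"
      using hv(4) by (intro prod.cong) (auto simp: edge_term_def)
    finally show ?thesis
      unfolding grading_weight_def prod.distrib
      by (simp add: pcoef_pcf xvar_xpow power_sum[symmetric] mult_ac)
  qed
  show ?thesis
    unfolding greedy_def Let_def m_def[symmetric] n_def[symmetric] weighted_gradings_eq trm xvar_powi
    by (simp add: greedy_laurent_def greedy_sum_def grading_sum_def m_def n_def)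
qed

lemma poly_exch_poly_at:
  assumes i: "i = 1 \<or> i = 2"
  shows "poly (exch_poly_at (ll 1) (ll 2) (if i = 1 then int k else 3 - int k)) x
    = (\<Sum>j\<le>ll (idx i k). to_fract (scal (exch_coeff i k j)) * x ^ j)"
proof -
  let ?k = "if i = 1 then int k else 3 - int k"
  have bar: "to_fract (scal (top_mon i (- ea k) (- eb k))) = inverse (pvar (idx i k) (ll (idx i k)))"
  proof (rule inverse_unique[symmetric])
    have "pvar (idx i k) (ll (idx i k)) * to_fract (scal (top_mon i (- ea k) (- eb k)))
      = to_fract (scal (pcf (idx i k) (ll (idx i k)) * top_mon i (- ea k) (- eb k)))"
      unfolding pvar_pgen pcf_top by (simp add: scal_mult)
    also have "\<dots> = 1" unfolding pcf_top_idx[OF i] top_mon_mult by simp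
    finally show "pvar (idx i k) (ll (idx i k)) * to_fract (scal (top_mon i (- ea k) (- eb k))) = 1" .
  qed
  have eq: "exch_poly_at (ll 1) (ll 2) ?k = ((if k mod 4 = 1 \<or> k mod 4 = 2
      then exch_poly (idx i k) (ll (idx i k)) else exch_poly_bar (idx i k) (ll (idx i k))) :: 'k laurent fract poly)"
  proof -
    have odd: "odd k \<longleftrightarrow> k mod 4 = 1 \<or> k mod 4 = 3" by presburger
    consider "k mod 4 = 0" | "k mod 4 = 1" | "k mod 4 = 2" | "k mod 4 = 3" by linarith
    then show ?thesis
    proof cases
      case 1
      then have "int k mod 4 = 0" "(3 - int k) mod 4 = 3" by presburger+
      then show ?thesis using i 1 odd by (auto simp: exch_poly_at_def idx_def)
    next
      case 2
      then have "int k mod 4 = 1" "(3 - int k) mod 4 = 2" by presburger+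
      then show ?thesis using i 2 odd by (auto simp: exch_poly_at_def idx_def)
    next
      case 3
      then have "int k mod 4 = 2" "(3 - int k) mod 4 = 1" by presburger+
      then show ?thesis using i 3 odd by (auto simp: exch_poly_at_def idx_def)
    next
      case 4
      then have "int k mod 4 = 3" "(3 - int k) mod 4 = 0" by presburger+
      then show ?thesis using i 4 odd by (auto simp: exch_poly_at_def idx_def)
    qed
  qed
  show ?thesis unfolding eq
    by (simp add: poly_exch_poly poly_exch_poly_bar pcoef_pcf exch_coeff_def bar[symmetric] scal_mult)
qed

section \<open>Cluster variables and their normalization\<close>

definition prevar :: "nat \<Rightarrow> nat \<Rightarrow> 'k laurent fract" where
  "prevar i k = cluster_prevar (ll 1) (ll 2) (if i = 1 then int k else 3 - int k)"

lemma exch_poly_Pval: "i = 1 \<or> i = 2 \<Longrightarrow> poly (exch_poly i (ll i)) (xvar i) = to_fract (Pval i)"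
  by (simp add: poly_exch_poly Pval_def pcoef_pcf xvar_xpow)

lemma prevar_init:
  assumes i: "i = 1 \<or> i = 2"
  shows "prevar i 0 = to_fract (nbr i)" "prevar i 1 = to_fract (xpow i 1)"
    "prevar i 2 = to_fract (xpow (3 - i) 1)" "prevar i 3 = to_fract (nbr (3 - i))"
proof -
  have x1: "cluster_prevar (ll 1) (ll 2) 1 = (xvar 1 :: 'k laurent fract)" by (simp add: cluster_prevar.simps)
  have x2: "cluster_prevar (ll 1) (ll 2) 2 = (xvar 2 :: 'k laurent fract)" by (simp add: cluster_prevar.simps)
  have div: "to_fract (Pval i) / xvar (3 - i) = (to_fract (nbr i) :: 'k laurent fract)" if "i = 1 \<or> i = 2" for i
  proof -
    have "xvar (3 - i) \<noteq> (0 :: 'k laurent fract)" by (simp add: xvar_xpow)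
    moreover have "to_fract (nbr i) * xvar (3 - i) = to_fract (Pval i)"
      unfolding xvar_xpow to_fract_mult[symmetric] nbr_xpow[OF that] ..
    ultimately show ?thesis by (simp add: field_simps)
  qed
  have x0: "cluster_prevar (ll 1) (ll 2) 0 = to_fract (nbr 1)"
  proof -
    have "(cluster_prevar (ll 1) (ll 2) 0 :: 'k laurent fract)
      = poly (exch_poly 1 (ll 1)) (cluster_prevar (ll 1) (ll 2) 1) / cluster_prevar (ll 1) (ll 2) 2"
      by (subst cluster_prevar.simps) (simp add: exch_poly_at_def)
    then show ?thesis unfolding x1 x2 using div[of 1] exch_poly_Pval[of 1] by simp
  qed
  have x3: "cluster_prevar (ll 1) (ll 2) 3 = to_fract (nbr 2)"
  proof -
    have "(cluster_prevar (ll 1) (ll 2) 3 :: 'k laurent fract)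
      = poly (exch_poly 2 (ll 2)) (cluster_prevar (ll 1) (ll 2) 2) / cluster_prevar (ll 1) (ll 2) 1"
      by (subst cluster_prevar.simps) (simp add: exch_poly_at_def)
    then show ?thesis unfolding x1 x2 using div[of 2] exch_poly_Pval[of 2] by simp
  qed
  show "prevar i 0 = to_fract (nbr i)" "prevar i 1 = to_fract (xpow i 1)"
    "prevar i 2 = to_fract (xpow (3 - i) 1)" "prevar i 3 = to_fract (nbr (3 - i))"
    using i x0 x1 x2 x3 by (auto simp: prevar_def xvar_xpow)
qed

lemma prevar_rec:
  assumes i: "i = 1 \<or> i = 2" and k: "k \<ge> 3"
  shows "prevar i (Suc k) = (\<Sum>j\<le>ll (idx i k). to_fract (scal (exch_coeff i k j)) * prevar i k ^ j) / prevar i (k - 1)"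
proof (cases "i = 1")
  case True
  have "(cluster_prevar (ll 1) (ll 2) (int (Suc k)) :: 'k laurent fract) = poly (exch_poly_at (ll 1) (ll 2) (int k)) (cluster_prevar (ll 1) (ll 2) (int k))
      / cluster_prevar (ll 1) (ll 2) (int (k - 1))"
    using k by (subst cluster_prevar.simps) (simp add: of_nat_diff)
  then show ?thesis using True poly_exch_poly_at[OF i, of k] by (simp add: prevar_def)
next
  case False
  have "(cluster_prevar (ll 1) (ll 2) (3 - int (Suc k)) :: 'k laurent fract) = poly (exch_poly_at (ll 1) (ll 2) (3 - int k)) (cluster_prevar (ll 1) (ll 2) (3 - int k))
      / cluster_prevar (ll 1) (ll 2) (3 - int (k - 1))"
    using k by (subst cluster_prevar.simps) (simp add: of_nat_diff)
  then show ?thesis using False poly_exch_poly_at[OF i, of k] by (simp add: prevar_def)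
qed

text \<open>The first four members are generators. After that, \<open>lower_alg_step\<close> gives
  membership and \<open>pointed_at_step\<close> the lowest term; the latter also shows that members
  are nonzero, so that one may divide by them in the field.\<close>

lemma prevar_in_lower_alg:
  assumes i: "i = 1 \<or> i = 2"
  shows "\<exists>x. prevar i k = to_fract x \<and> x \<in> lower_alg UNIV \<and> pointed_at i k x"
proof (induction k rule: less_induct)
  case (less k)
  interpret la: csubring "laurent_over pring" by (simp add: csubring_laurent_over)
  have i3: "3 - i = 1 \<or> 3 - i = 2" "3 - (3 - i) = i" using i by auto
  have nbl: "nbr j \<in> laurent_over pring" if "j = 1 \<or> j = 2" for j using lower_alg_gens(2)[OF that] lower_alg_pring_laurent_over by blast
  have vpl: "xpow j 1 \<in> laurent_over pring" for j by (simp add: xpow_in_laurent_over)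
  have nonzero: "x \<noteq> 0" if p: "pointed_at i j x" for j x
  proof -
    obtain X m where X: "x = scal (top_mon i (- expA i j) (- expB i j)) * X" "pointed X m" using p unfolding pointed_at_def by blast
    have "scal (top_mon i (expA i j) (expB i j)) * x = X" unfolding X(1) by (simp add: mult.assoc[symmetric] scal_mult[symmetric] top_mon_mult)
    then show ?thesis using pointed_nonzero[OF X(2)] by auto
  qed
  have two: "var_deg i 2 = 1" "expA i 2 = 0" "expB i 2 = 0"
    using exps_rec[of i 0] by (simp_all add: exps_init numeral_2_eq_2)
  have three: "var_deg i 3 = - 1" "expA i 3 = 0" "expB i 3 = 0"
    using exps_rec[of i 1] two by (simp_all add: exps_init numeral_2_eq_2 numeral_3_eq_3)
  consider "k = 0" | "k = 1" | "k = 2" | "k = 3" | n where "k = Suc (Suc (Suc (Suc n)))"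
    by (metis One_nat_def not0_implies_Suc numeral_2_eq_2 numeral_3_eq_3)
  then show ?case
  proof cases
    case 1
    have "pointed_at i 0 (nbr i)" unfolding pointed_at_def
      using nbl[OF i] pointed_nbr[of i] by (intro exI[of _ "nbr i"] exI[of _ "sgl (3 - i) (- 1)"] conjI) (auto simp: exps_init)
    then show ?thesis using 1 prevar_init(1)[OF i] lower_alg_gens(2)[OF i] by blast
  next
    case 2
    have "pointed_at i (Suc 0) (xpow i 1)" unfolding pointed_at_def
      using vpl pointed_xpow[of i 1] by (intro exI[of _ "xpow i 1"] exI[of _ "sgl i 1"] conjI) (auto simp: exps_init)
    then show ?thesis using 2 prevar_init(2)[OF i] lower_alg_gens(1)[OF i] by auto
  next
    case 3
    have "pointed_at i 2 (xpow (3 - i) 1)" unfolding pointed_at_def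
      using vpl pointed_xpow[of "3 - i" 1] by (intro exI[of _ "xpow (3 - i) 1"] exI[of _ "sgl (3 - i) 1"] conjI) (auto simp: two)
    then show ?thesis using 3 prevar_init(3)[OF i] lower_alg_gens(1)[OF i3(1)] by blast
  next
    case 4
    have "pointed_at i 3 (nbr (3 - i))" unfolding pointed_at_def
      using nbl[OF i3(1)] pointed_nbr[of "3 - i"] by (intro exI[of _ "nbr (3 - i)"] exI[of _ "sgl (3 - (3 - i)) (- 1)"] conjI) (auto simp: three)
    then show ?thesis using 4 prevar_init(4)[OF i] lower_alg_gens(2)[OF i3(1)] by blast
  next
    case 5
    have lt: "n < k" "Suc n < k" "Suc (Suc n) < k" "Suc (Suc (Suc n)) < k" using 5 by simp_all
    obtain t0 where t0: "prevar i n = to_fract t0" "t0 \<in> lower_alg UNIV" "pointed_at i n t0" using less[OF lt(1)] by blast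
    obtain t1 where t1: "prevar i (Suc n) = to_fract t1" "t1 \<in> lower_alg UNIV" "pointed_at i (Suc n) t1" using less[OF lt(2)] by blast
    obtain t2 where t2: "prevar i (Suc (Suc n)) = to_fract t2" "t2 \<in> lower_alg UNIV" "pointed_at i (Suc (Suc n)) t2" using less[OF lt(3)] by blast
    obtain t3 where t3: "prevar i (Suc (Suc (Suc n))) = to_fract t3" "t3 \<in> lower_alg UNIV" "pointed_at i (Suc (Suc (Suc n))) t3" using less[OF lt(4)] by blast
    \<comment> \<open>For j = 0 and j = 1 this is the defining relation of a neighbour; from j = 2
      on it is the recursion.\<close>
    have rel: "prevar i (Suc (Suc j)) * prevar i j = (\<Sum>s\<le>ll (idx i (Suc j)). to_fract (scal (exch_coeff i (Suc j) s)) * prevar i (Suc j) ^ s)"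
      if nz: "prevar i j \<noteq> 0" for j
    proof -
      have top: "Pval h = (\<Sum>s\<le>ll h. scal (pcf h s) * xpow h 1 ^ s)" for h by (simp add: Pval_def)
      consider "j = 0" | "j = 1" | "j \<ge> 2" by linarith
      then show ?thesis
      proof cases
        case 1
        have "prevar i 2 * prevar i 0 = to_fract (nbr i * xpow (3 - i) 1)"
          unfolding prevar_init[OF i] by (simp add: mult.commute)
        also have "\<dots> = to_fract (Pval i)" unfolding nbr_xpow[OF i] ..
        finally show ?thesis using 1 prevar_init(2)[OF i]
          by (simp add: Pval_def idx_def exch_coeff_def numeral_2_eq_2)
      next
        case 2
        have "prevar i 3 * prevar i 1 = to_fract (nbr (3 - i) * xpow (3 - (3 - i)) 1)"
          unfolding prevar_init[OF i] i3 by simp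
        also have "\<dots> = to_fract (Pval (3 - i))" unfolding nbr_xpow[OF i3(1)] ..
        finally show ?thesis using 2 prevar_init(3)[OF i]
          by (simp add: Pval_def idx_def exch_coeff_def numeral_2_eq_2 numeral_3_eq_3)
      next
        case 3
        then show ?thesis using prevar_rec[OF i, of "Suc j"] nz by simp
      qed
    qed
    have t_nz: "t0 \<noteq> 0" "t1 \<noteq> 0" "t2 \<noteq> 0" using nonzero t0 t1 t2 by blast+
    have r1: "t2 * t0 = (\<Sum>s\<le>ll (idx i (Suc n)). scal (exch_coeff i (Suc n) s) * t1 ^ s)"
      using rel[of n] t_nz by (simp add: t0 t1 t2 flip: to_fract_mult to_fract_power to_fract_sum)
    have r2: "t3 * t1 = (\<Sum>s\<le>ll (idx i (Suc (Suc n))). scal (exch_coeff i (Suc (Suc n)) s) * t2 ^ s)"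
      using rel[of "Suc n"] t_nz by (simp add: t3 t1 t2 flip: to_fract_mult to_fract_power to_fract_sum)
    obtain y where y: "y \<in> lower_alg UNIV"
      "y * t2 = (\<Sum>s\<le>ll (idx i (Suc (Suc (Suc n)))). scal (exch_coeff i (Suc (Suc (Suc n))) s) * t3 ^ s)"
      using lower_alg_step[OF i t0(2) t1(2) t2(2) t3(2) r1 r2] by blast
    have "prevar i k * to_fract t2 = to_fract (y * t2)"
      unfolding y(2) using rel[of "Suc (Suc n)"] t_nz by (simp add: 5 t2 t3)
    then have "prevar i k = to_fract y" using t_nz by simp
    moreover have "pointed_at i k y" unfolding 5 by (rule pointed_at_step[OF i t2(3) t3(3) y(2)])
    ultimately show ?thesis using y(1) by blast
  qed
qed

lemma pvar_powi: "i = 1 \<or> i = 2 \<Longrightarrow>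
  pvar i (ll i) powi a * pvar (3 - i) (ll (3 - i)) powi b = to_fract (scal (top_mon i a b))"
proof -
  assume i: "i = 1 \<or> i = 2"
  have 1: "pgen i (ll i) = top_mon i 1 0" "pgen (3 - i) (ll (3 - i)) = top_mon i 0 1"
    by (simp_all add: pgen_def top_mon_def)
  have 2: "to_fract (scal (top_mon i c d)) powi e = to_fract (scal (top_mon i (e * c) (e * d)))" for c d e
    by (subst power_int_to_fract[of _ "scal (top_mon i (- c) (- d))"])
      (auto simp: top_mon_mult top_mon_power simp flip: scal_mult scal_power)
  show ?thesis unfolding pvar_pgen 1 2 by (simp add: top_mon_mult flip: to_fract_mult scal_mult)
qed

text \<open>The uniqueness behind \<open>cluster_var\<close>: \<open>X\<close> and its multiple by
  \<open>u\<close> have the same lowest monomial, whose coefficient is 1 in the former and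
  \<open>u\<close> in the latter.\<close>

lemma pointed_unit_unique:
  assumes "pointed X m" "pointed (scal u * X) m'" "u \<noteq> 0"
  shows "u = 1"
proof -
  have lm: "coef (scal u * X) m = u" using pointed_lookup[OF assms(1)] by simp
  have lm': "u * coef X m' = 1" using pointed_lookup[OF assms(2)] by simp
  have "m = m'"
  proof (rule ccontr)
    assume ne: "m \<noteq> m'"
    have "m \<in> supp (scal u * X)" using lm assms(3) by (simp add: in_keys_iff)
    then have "total_degree m' < total_degree m" using pointed_keys[OF assms(2)] ne by blast
    moreover have "m' \<in> supp X" using lm' by (auto simp: in_keys_iff)
    then have "total_degree m < total_degree m'" using pointed_keys[OF assms(1)] ne by blast
    ultimately show False by simp
  qed
  then show ?thesis using lm' pointed_lookup[OF assms(1)] by simp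
qed

lemma cluster_var_eqI:
  assumes "cluster_prevar (ll 1) (ll 2) k = to_fract (scal (top_mon 1 a b) * X)" "pointed X m"
  shows "cluster_var (ll 1) (ll 2) k = to_fract X"
  unfolding cluster_var_def
proof (rule the_equality)
  have p1: "pvar 1 (ll 1) powi c * pvar 2 (ll 2) powi d = to_fract (scal (top_mon 1 c d))" for c d
    using pvar_powi[of 1 c d] by simp
  have *: "pvar 1 (ll 1) powi c * pvar 2 (ll 2) powi d * cluster_prevar (ll 1) (ll 2) k
      = to_fract (scal (top_mon 1 (c + a) (d + b)) * X)" for c d
    unfolding p1 assms(1) to_fract_mult[symmetric] by (simp add: mult.assoc[symmetric] scal_mult[symmetric] top_mon_mult)
  have "to_fract X = pvar 1 (ll 1) powi (- a) * pvar 2 (ll 2) powi (- b) * cluster_prevar (ll 1) (ll 2) k"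
    unfolding * by simp
  moreover have "unit_lowest_term X" using assms(2) by (auto simp: unit_lowest_term_iff)
  ultimately show "(\<exists>c d. to_fract X = pvar 1 (ll 1) powi c * pvar 2 (ll 2) powi d * cluster_prevar (ll 1) (ll 2) k) \<and>
      (\<exists>f. to_fract X = to_fract f \<and> unit_lowest_term f)" by blast
  fix y :: "'k laurent fract"
  assume "(\<exists>c d. y = pvar 1 (ll 1) powi c * pvar 2 (ll 2) powi d * cluster_prevar (ll 1) (ll 2) k) \<and>
      (\<exists>f. y = to_fract f \<and> unit_lowest_term f)"
  then obtain c d f where y: "y = to_fract (scal (top_mon 1 (c + a) (d + b)) * X)" "y = to_fract f" "unit_lowest_term f"
    unfolding * by blast
  then have f: "f = scal (top_mon 1 (c + a) (d + b)) * X" by (metis to_fract_eq_iff)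
  obtain m' where "pointed f m'" using y(3) by (auto simp: unit_lowest_term_iff)
  moreover have "top_mon 1 (c + a) (d + b) \<noteq> 0"
    unfolding top_mon_def by (metis lookup_single_eq lookup_zero zero_neq_one)
  ultimately have "top_mon 1 (c + a) (d + b) = 1" using pointed_unit_unique[OF assms(2)] f by blast
  then show "y = to_fract X" using y(1) by simp
qed

text \<open>The pre-variable is polynomial in x_0, ..., x_3 over the large coefficient ring, its
  normalization has coefficients in R, and \<open>lower_alg_saturated\<close> combines the
  two.\<close>

lemma cluster_var_in_lower_alg: "\<exists>X\<in>lower_alg pring. cluster_var (ll 1) (ll 2) k = to_fract X"
proof -
  \<comment> \<open>Nonnegative \<open>k\<close> are reached by the first sequence, negative ones by
    the second as 3 - n.\<close>
  define i where "i = (if k \<ge> 0 then 1 else 2 :: nat)"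
  define n where "n = nat (if k \<ge> 0 then k else 3 - k)"
  have i: "i = 1 \<or> i = 2" by (simp add: i_def)
  have k: "prevar i n = cluster_prevar (ll 1) (ll 2) k" by (simp add: prevar_def i_def n_def)
  obtain x where x: "prevar i n = to_fract x" "x \<in> lower_alg UNIV" "pointed_at i n x" using prevar_in_lower_alg[OF i] by blast
  then obtain X m where X: "x = scal (top_mon i (- expA i n) (- expB i n)) * X" "X \<in> laurent_over pring" "pointed X m"
    unfolding pointed_at_def by blast
  interpret A: csubring "lower_alg UNIV" by simp
  have "X = scal (top_mon i (expA i n) (expB i n)) * x"
    unfolding X(1) by (simp add: mult.assoc[symmetric] scal_mult[symmetric] top_mon_mult)
  also have "\<dots> \<in> lower_alg UNIV" using x(2) lower_alg_gens(3) by blast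
  finally have "X \<in> lower_alg pring" using lower_alg_saturated X(2) by blast
  moreover have "top_mon 2 a b = top_mon 1 b a" for a b by (simp add: top_mon_def add.commute)
  then have "\<exists>a b. top_mon i (- expA i n) (- expB i n) = top_mon 1 a b" using i by metis
  then have "cluster_var (ll 1) (ll 2) k = to_fract X"
    using cluster_var_eqI[OF _ X(3)] k x(1) X(1) by metis
  ultimately show ?thesis by blast
qed

lemma cluster_var_init:
  shows "cluster_var (ll 1) (ll 2) 1 = (to_fract (xpow 1 1) :: 'k laurent fract)"
    "cluster_var (ll 1) (ll 2) 2 = (to_fract (xpow 2 1) :: 'k laurent fract)"
    "cluster_var (ll 1) (ll 2) 0 = to_fract (nbr 1)"
    "cluster_var (ll 1) (ll 2) 3 = to_fract (nbr 2)"
proof -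
  have *: "cluster_var (ll 1) (ll 2) k = to_fract X" if "cluster_prevar (ll 1) (ll 2) k = to_fract X" "pointed X m"
    for k m and X :: "'k laurent"
    by (rule cluster_var_eqI[of k 0 0]) (use that in auto)
  have init: "cluster_prevar (ll 1) (ll 2) 0 = to_fract (nbr 1)"
    "cluster_prevar (ll 1) (ll 2) 1 = (to_fract (xpow 1 1) :: 'k laurent fract)"
    "cluster_prevar (ll 1) (ll 2) 2 = (to_fract (xpow 2 1) :: 'k laurent fract)"
    "cluster_prevar (ll 1) (ll 2) 3 = to_fract (nbr 2)"
    using prevar_init[of 1] by (simp_all add: prevar_def)
  show "cluster_var (ll 1) (ll 2) 1 = (to_fract (xpow 1 1) :: 'k laurent fract)"
    "cluster_var (ll 1) (ll 2) 2 = (to_fract (xpow 2 1) :: 'k laurent fract)"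
    "cluster_var (ll 1) (ll 2) 0 = to_fract (nbr 1)"
    "cluster_var (ll 1) (ll 2) 3 = to_fract (nbr 2)"
    by (rule *[OF init(2) pointed_xpow] *[OF init(3) pointed_xpow] *[OF init(1) pointed_nbr] *[OF init(4) pointed_nbr])+
qed

text \<open>One inclusion is \<open>cluster_var_in_lower_alg\<close>; for the other, x_0, x_1, x_2,
  x_3 have lowest coefficient 1 and thus are cluster variables as they stand.\<close>

lemma cluster_algebra_lower_alg: "(cluster_algebra (ll 1) (ll 2) :: 'k laurent fract set) = to_fract ` lower_alg pring"
proof
  let ?X = "range (cluster_var (ll 1) (ll 2)) :: 'k laurent fract set"
  have img: "subring_gen (to_fract ` S) = to_fract ` subring_gen S" for S :: "'k laurent set"
    by (rule subring_gen_image) simp_all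
  show "cluster_algebra (ll 1) (ll 2) \<subseteq> to_fract ` lower_alg pring"
    unfolding cluster_algebra_def subalgebra_gen_def
  proof (rule csubring.subring_gen_least)
    show "csubring (to_fract ` lower_alg pring :: 'k laurent fract set)"
      unfolding lower_alg_def img[symmetric] by simp
    show "coeff_ring (ll 1) (ll 2) \<union> ?X \<subseteq> to_fract ` lower_alg pring"
      using cluster_var_in_lower_alg lower_alg_gens(3)[of _ pring] unfolding coeff_ring_pring by fast
  qed
  show "to_fract ` lower_alg pring \<subseteq> (cluster_algebra (ll 1) (ll 2) :: 'k laurent fract set)"
    unfolding lower_alg_def img[symmetric] cluster_algebra_def subalgebra_gen_def coeff_ring_pring
  proof (rule subring_gen_mono)
    have "to_fract (xpow i 1) \<in> ?X \<and> to_fract (nbr i) \<in> ?X" if "i = 1 \<or> i = 2" for i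
      using that cluster_var_init by (metis rangeI)
    then show "to_fract ` (scal ` pring \<union> {xpow i 1 |i. i = 1 \<or> i = 2} \<union> {nbr i |i. i = 1 \<or> i = 2})
        \<subseteq> to_fract ` scal ` pring \<union> ?X" by auto
  qed
qed

text \<open>Injectivity of \<open>to_fract\<close> carries independence from the Laurent polynomials
  to the field, after \<open>lift\<close> has taken the coefficients back to
  \<open>pring\<close>.\<close>

lemma greedy_basis:
  "module_basis (coeff_ring (ll 1) (ll 2) :: 'k laurent fract set)
     (\<lambda>(a1, a2). greedy (ll 1) (ll 2) a1 a2) (cluster_algebra (ll 1) (ll 2))"
proof -
  let ?R = "coeff_ring (ll 1) (ll 2) :: 'k laurent fract set"
  have g: "(\<lambda>(a1, a2). greedy (ll 1) (ll 2) a1 a2) = (\<lambda>a. to_fract (greedy_laurent a) :: 'k laurent fract)"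
    by (simp add: greedy_greedy_laurent fun_eq_iff split_beta del: One_nat_def)
  have lift: "\<exists>d. \<forall>i\<in>S. c i = to_fract (scal (d i)) \<and> d i \<in> pring" if "\<forall>i\<in>S. c i \<in> ?R" for S and c :: "int \<times> int \<Rightarrow> 'k laurent fract"
    using that unfolding coeff_ring_pring by (intro bchoice) blast
  have span: "to_fract ` lincomb (scal ` pring) greedy_laurent = lincomb ?R (\<lambda>a. to_fract (greedy_laurent a))"
  proof
    show "to_fract ` lincomb (scal ` pring) greedy_laurent \<subseteq> lincomb ?R (\<lambda>a. to_fract (greedy_laurent a))"
    proof
      fix x :: "'k laurent fract" assume "x \<in> to_fract ` lincomb (scal ` pring) greedy_laurent"
      then obtain f where f: "f \<in> lincomb (scal ` pring) greedy_laurent" "x = to_fract f" by blast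
      from f(1) obtain S c where S: "finite S" "\<And>i. i \<in> S \<Longrightarrow> c i \<in> pring" "f = (\<Sum>i\<in>S. scal (c i) * greedy_laurent i)"
        by (rule lincomb_scal_cases) blast
      show "x \<in> lincomb ?R (\<lambda>a. to_fract (greedy_laurent a))"
        unfolding lincomb_def coeff_ring_pring
        by (rule CollectI, rule exI[of _ S], rule exI[of _ "\<lambda>i. to_fract (scal (c i))"]) (use S f in auto)
    qed
    show "lincomb ?R (\<lambda>a. to_fract (greedy_laurent a)) \<subseteq> to_fract ` lincomb (scal ` pring) greedy_laurent"
    proof
      fix x :: "'k laurent fract" assume "x \<in> lincomb ?R (\<lambda>a. to_fract (greedy_laurent a))"
      then obtain S c where S: "finite S" "\<forall>i\<in>S. c i \<in> ?R" "x = (\<Sum>i\<in>S. c i * to_fract (greedy_laurent i))"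
        unfolding lincomb_def by blast
      obtain d where d: "\<forall>i\<in>S. c i = to_fract (scal (d i)) \<and> d i \<in> pring" using lift[OF S(2)] by blast
      have "x = to_fract (\<Sum>i\<in>S. scal (d i) * greedy_laurent i)" unfolding S(3) using d by simp
      moreover have "(\<Sum>i\<in>S. scal (d i) * greedy_laurent i) \<in> lincomb (scal ` pring) greedy_laurent"
        unfolding lincomb_def
        by (rule CollectI, rule exI[of _ S], rule exI[of _ "\<lambda>i. scal (d i)"]) (use S d in auto)
      ultimately show "x \<in> to_fract ` lincomb (scal ` pring) greedy_laurent" by blast
    qed
  qed
  have "\<forall>i\<in>S. c i = 0" if S: "finite S" "\<forall>i\<in>S. c i \<in> ?R" "(\<Sum>i\<in>S. c i * to_fract (greedy_laurent i)) = 0" for S c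
  proof -
    obtain d where d: "\<forall>i\<in>S. c i = to_fract (scal (d i)) \<and> d i \<in> pring" using lift[OF S(2)] by blast
    have "to_fract (\<Sum>i\<in>S. scal (d i) * greedy_laurent i) = (\<Sum>i\<in>S. c i * to_fract (greedy_laurent i))" using d by simp
    then have "(\<Sum>i\<in>S. scal (d i) * greedy_laurent i) = 0" using S(3) by (simp del: to_fract_sum)
    then have "d a = 0" if "a \<in> S" for a
      using lincomb_independent[OF S(1), of greedy_laurent d a] pointed_greedy_laurent that by blast
    then show ?thesis using d by simp
  qed
  moreover have "(cluster_algebra (ll 1) (ll 2) :: 'k laurent fract set) = lincomb ?R (\<lambda>a. to_fract (greedy_laurent a))"
    unfolding cluster_algebra_lower_alg lincomb_greedy_laurent[symmetric] by (rule span)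
  ultimately show ?thesis unfolding module_basis_def g lincomb_def by blast
qed

end

theorem theorem7p3:
  fixes l1 l2 :: nat
  assumes "l1 \<ge> 1" and "l2 \<ge> 1"
  shows "module_basis (coeff_ring l1 l2 :: 'k::field_char_0 laurent fract set)
           (\<lambda>(a1, a2). greedy l1 l2 a1 a2) (cluster_algebra l1 l2)"
proof -
  \<comment> \<open>All indices other than 1 get the value \<open>l2\<close>, so that
    \<open>ll_pos\<close> holds for every index.\<close>
  interpret exchange "\<lambda>i. if i = 1 then l1 else l2" "TYPE('k)"
    by unfold_locales (use assms in auto)
  show ?thesis using greedy_basis by simp
qed

end
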